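(* Assume that $\varepsilon\in C^{(3)}(\mathbb{T}^d)$ is a real-valued even Morse function with a unique minimum at $0\in\mathbb{T}^d$ and that $\hat v\in\ell^1(\mathbb{Z}^d)$ is non-positive and even. Let $\mu>0$ and $k\in\mathbb{G}$. Then the following statements hold: (i) Let $d\ge3$. If an even function $\hat f\in\ell_0(\mathbb{Z}^d)$ solves $\widehat H_\mu(k)\hat f=\mathcal{E}_{\min}(k)\hat f$, then $\hat\psi:=|\widehat V|^{1/2}\hat f\in\ell^{2,e}(\mathbb{Z}^d)$ solves $\hat\psi=\mathbb{B}_\mu(k,\mathcal{E}_{\min}(k))\hat\psi$. (ii) Let $d=3,4$. If $\hat\psi\in\ell^{2,e}(\mathbb{Z}^d)$ solves $\hat\psi=\mathbb{B}_\mu(k,\mathcal{E}_{\min}(k))\hat\psi$, then $\hat f:=\widehat R_0(k,\mathcal{E}_{\min}(k))|\widehat V|^{1/2}\hat\psi\in\ell_0(\mathbb{Z}^d)$ solves $\widehat H_\mu(k)\hat f=\mathcal{E}_{\min}(k)\hat f$. (iii) Let $d\ge5$. If $\hat\psi\in\ell^{2,e}(\mathbb{Z}^d)$ solves $\hat\psi=\mathbb{B}_\mu(k,\mathcal{E}_{\min}(k))\hat\psi$, then $\hat f:=\widehat R_0(k,\mathcal{E}_{\min}(k))|\widehat V|^{1/2}\hat\psi\in\ell^{2,e}(\mathbb{Z}^d)$ solves $\widehat H_\mu(k)\hat f=\mathcal{E}_{\min}(k)\hat f$. (iv) Let $d\ge3$. The threshold $\mathcal{E}_{\min}(k)$ is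 a singular point (a resonance or an eigenvalue) of the essential spectrum of $\widehat H_\mu(k)$ with multiplicity $m$ if and only if the number $1$ is an eigenvalue of $\mathbb{B}_\mu(k,\mathcal{E}_{\min}(k))$ with multiplicity $m$. (v) Let $d\ge3$. Counting multiplicities, the number $\mathcal{N}_-(\mathcal{E}_{\min}(k),\widehat H_\mu(k))$ of eigenvalues of $\widehat H_\mu(k)$ less than $\mathcal{E}_{\min}(k)$ equals the number $\mathcal{N}_+(1,\mathbb{B}_\mu(k,\mathcal{E}_{\min}(k)))$ of eigenvalues of $\mathbb{B}_\mu(k,\mathcal{E}_{\min}(k))$ greater than $1$.
   Context: Let $\mathbb{T}^d=(\mathbb{R}/2\pi\mathbb{Z})^d$, identified with $[-\pi,\pi)^d$ (so that $k/2$ is well defined for $k\in\mathbb{T}^d$), with normalized Haar measure $\eta(\mathrm{d}p)=\mathrm{d}^dp/(2\pi)^d$, and $(p,x)=\sum_j p_jx_j$. Let $\ell^{2,e}(\mathbb{Z}^d)$ be the Hilbert space of square-summable even functions on $\mathbb{Z}^d$ and $\ell_0(\mathbb{Z}^d)$ the Banach space of functions on $\mathbb{Z}^d$ vanishing at infinity. Let $\hat\varepsilon\in\ell^1(\mathbb{Z}^d)$ be real-valued and even, and $\varepsilon(p)=\sum_{x\in\mathbb{Z}^d}e^{\mathrm{i}(p,x)}\hat\varepsilon(x)$. For $k\in\mathbb{T}^d$ put $\mathcal{E}_k(p)=\varepsilon(\tfrac k2+p)+\varepsilon(\tfrac k2-p)$ and $\mathcal{E}_{\min}(k)=\min_q\mathcal{E}_k(q)$.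 Define $(\widehat H_0(k)\hat f)(x)=\sum_{s\in\mathbb{Z}^d}\hat{\mathcal{E}}_k(x-s)\hat f(s)$ with $\hat{\mathcal{E}}_k(x)=\int_{\mathbb{T}^d}e^{-\mathrm{i}(p,x)}\mathcal{E}_k(p)\,\eta(\mathrm{d}p)$, $(\widehat V\hat f)(x)=\hat v(x)\hat f(x)$, $(|\widehat V|^{1/2}\hat f)(x)=|\hat v(x)|^{1/2}\hat f(x)$, and $\widehat H_\mu(k)=\widehat H_0(k)+\mu\widehat V$. These are bounded operators on $\ell^{2,e}(\mathbb{Z}^d)$, and the same formulas define $\widehat H_\mu(k)\hat f$ for $\hat f\in\ell_0(\mathbb{Z}^d)$. The bottom (threshold) of the essential spectrum of $\widehat H_\mu(k)$ on $\ell^{2,e}(\mathbb{Z}^d)$ is $\mathcal{E}_{\min}(k)$. $\mathbb{G}\subset\mathbb{T}^d$ denotes the maximal open neighborhood of $0\in\mathbb{T}^d$ such that for every $k\in\mathbb{G}$ the function $\mathcal{E}_k(\cdot)\in C^{(3)}(\mathbb{T}^d)$ is a Morse function and its minimum $\mathcal{E}_{\min}(k)$ is attained at the point $p=0$. For $d\ge3$, $k\in\mathbb{G}$, let $\widehat{\mathcal{R}}_0(k,\mathcal{E}_{\min}(k);x)=\int_{\mathbb{T}^d}\frac{e^{\mathrm{i}(q,x)}}{\mathcal{E}_k(q)-\mathcal{E}_{\min}(k)}\eta(\mathrm{d}q)$, let $\widehat R_0(k,\mathcal{E}_{\min}(k))$ be convolution with this kernel, $(\widehat R_0(k,\mathcal{E}_{\min}(k))\hat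 g)(x)=\sum_y\widehat{\mathcal{R}}_0(k,\mathcal{E}_{\min}(k);x-y)\hat g(y)$ for $\hat g\in\ell^1(\mathbb{Z}^d)$, and let the generalized Birman–Schwinger operator $\mathbb{B}_\mu(k,\mathcal{E}_{\min}(k))$ be the compact operator on $\ell^{2,e}(\mathbb{Z}^d)$ with kernel $\mu|\hat v(x)|^{1/2}\widehat{\mathcal{R}}_0(k,\mathcal{E}_{\min}(k);x-y)|\hat v(y)|^{1/2}$, $x,y\in\mathbb{Z}^d$. By definition, the threshold $\mathcal{E}_{\min}(k)$ is called a singular point of multiplicity $m$ (respectively a regular point) of $\widehat H_\mu(k)$ if $1$ is an eigenvalue of multiplicity $m$ of (respectively is not an eigenvalue of) $\mathbb{B}_\mu(k,\mathcal{E}_{\min}(k))$. In the paper's terminology a singular point is called a threshold resonance when $d=3,4$ and the solution $\hat f=\widehat R_0(k,\mathcal{E}_{\min}(k))|\widehat V|^{1/2}\hat\psi$ lies in $\ell_0(\mathbb{Z}^d)\setminus\ell^{2,e}(\mathbb{Z}^d)$, and a threshold eigenvalue when $\hat f\in\ell^{2,e}(\mathbb{Z}^d)$. *)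

theory Defs
  imports
    "HOL-Analysis.Analysis"
    "HOL-Library.Function_Algebras"
    "HOL-Library.Extended_Nat"
begin

section \<open>The torus\<close>

text \<open>
  The dimension \<open>d\<close> is \<open>CARD('n)\<close>. Functions on the torus are \<open>2\<pi>\<close>-periodic functions on
  \<open>real ^ 'n\<close>, and points of the torus are identified with their representatives in the
  half-open box below. The choice of representative matters for the quasi-momentum \<open>k\<close>, since
  only \<open>k/2\<close> enters.
\<close>

definition torus :: "(real ^ 'n) set" where
  "torus = {p. \<forall>j. - pi \<le> p $ j \<and> p $ j < pi}"

text \<open>Openness is that of the quotient topology, so it is tested on the periodic extension;
  in particular a neighbourhood may wrap around the boundary of the box.\<close>

definition torus_open :: "(real ^ 'n) set \<Rightarrow> bool" where
  "torus_open U \<longleftrightarrow> U \<subseteq> torus \<and>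
     open {p. \<exists>m :: int ^ 'n. (\<chi> j. p $ j - 2 * pi * of_int (m $ j)) \<in> U}"

definition haar :: "(real ^ 'n) measure" where
  "haar = density lborel (\<lambda>p. ennreal (indicator torus p / (2 * pi) ^ CARD('n)))"

definition pairing :: "real ^ 'n \<Rightarrow> int ^ 'n \<Rightarrow> real" where
  "pairing p x = (\<Sum>j\<in>UNIV. p $ j * of_int (x $ j))"

section \<open>Functions of class \<open>C\<^sup>m\<close> and Morse functions\<close>

definition partial_deriv :: "'n \<Rightarrow> (real ^ 'n \<Rightarrow> real) \<Rightarrow> real ^ 'n \<Rightarrow> real" where
  "partial_deriv i f p = frechet_derivative f (at p) (axis i 1)"

primrec Cm :: "nat \<Rightarrow> (real ^ 'n \<Rightarrow> real) \<Rightarrow> bool" where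
  "Cm 0 f \<longleftrightarrow> continuous_on UNIV f"
| "Cm (Suc m) f \<longleftrightarrow> (\<forall>p. f differentiable (at p)) \<and> (\<forall>i. Cm m (partial_deriv i f))"

definition hessian :: "(real ^ 'n \<Rightarrow> real) \<Rightarrow> real ^ 'n \<Rightarrow> real ^ 'n ^ 'n" where
  "hessian f p = (\<chi> i j. partial_deriv i (partial_deriv j f) p)"

text \<open>To be used together with \<open>Cm m f\<close> for some \<open>m \<ge> 2\<close>.\<close>

definition morse :: "(real ^ 'n \<Rightarrow> real) \<Rightarrow> bool" where
  "morse f \<longleftrightarrow> (\<forall>p. (\<forall>i. partial_deriv i f p = 0) \<longrightarrow> det (hessian f p) \<noteq> 0)"

section \<open>Spaces of functions on the lattice\<close>

definition even_fun :: "('a :: group_add \<Rightarrow> 'b) \<Rightarrow> bool" where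
  "even_fun f \<longleftrightarrow> (\<forall>x. f (- x) = f x)"

definition ell1 :: "(int ^ 'n \<Rightarrow> 'b :: real_normed_vector) set" where
  "ell1 = {f. (\<lambda>x. norm (f x)) summable_on UNIV}"

definition ell2e :: "(int ^ 'n \<Rightarrow> complex) set" where
  "ell2e = {f. (\<lambda>x. (cmod (f x))\<^sup>2) summable_on UNIV \<and> even_fun f}"

definition ell0 :: "(int ^ 'n \<Rightarrow> complex) set" where
  "ell0 = {f. (f \<longlongrightarrow> 0) cofinite}"

section \<open>Eigenvalues and multiplicities on the space of even square-summable functions\<close>

definition cscale :: "complex \<Rightarrow> ('a \<Rightarrow> complex) \<Rightarrow> 'a \<Rightarrow> complex" where
  "cscale c f = (\<lambda>x. c * f x)"

interpretation cfun: vector_space "cscale :: complex \<Rightarrow> ('a \<Rightarrow> complex) \<Rightarrow> 'a \<Rightarrow> complex"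
  by standard (auto simp: cscale_def algebra_simps)

text \<open>The library's \<open>dim\<close> is a natural number, and is 0 on infinite-dimensional subspaces;
  hence the following extended version.\<close>

definition cdimension :: "('a \<Rightarrow> complex) set \<Rightarrow> enat" where
  "cdimension S = (SUP B \<in> {B. B \<subseteq> S \<and> finite B \<and> cfun.independent B}. enat (card B))"

definition eigenspace ::
  "((int ^ 'n \<Rightarrow> complex) \<Rightarrow> (int ^ 'n \<Rightarrow> complex)) \<Rightarrow> real \<Rightarrow> (int ^ 'n \<Rightarrow> complex) set" where
  "eigenspace A z = {f \<in> ell2e. A f = cscale (complex_of_real z) f}"

definition eigenvalue_of_multiplicity ::
  "((int ^ 'n \<Rightarrow> complex) \<Rightarrow> (int ^ 'n \<Rightarrow> complex)) \<Rightarrow> real \<Rightarrow> nat \<Rightarrow> bool" where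
  "eigenvalue_of_multiplicity A z m \<longleftrightarrow> m \<ge> 1 \<and> cdimension (eigenspace A z) = enat m"

text \<open>The number, counted with multiplicity, of the eigenvalues of \<open>A\<close> lying in \<open>S\<close>. Real
  eigenvalues suffice, the operators considered here being self-adjoint.\<close>

definition eigenvalue_count ::
  "((int ^ 'n \<Rightarrow> complex) \<Rightarrow> (int ^ 'n \<Rightarrow> complex)) \<Rightarrow> real set \<Rightarrow> enat" where
  "eigenvalue_count A S =
     (SUP F \<in> {F. finite F \<and> F \<subseteq> S}. \<Sum>z\<in>F. cdimension (eigenspace A z))"

definition N_minus ::
  "real \<Rightarrow> ((int ^ 'n \<Rightarrow> complex) \<Rightarrow> (int ^ 'n \<Rightarrow> complex)) \<Rightarrow> enat" where
  "N_minus z A = eigenvalue_count A {..<z}"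

definition N_plus ::
  "real \<Rightarrow> ((int ^ 'n \<Rightarrow> complex) \<Rightarrow> (int ^ 'n \<Rightarrow> complex)) \<Rightarrow> enat" where
  "N_plus z A = eigenvalue_count A {z<..}"

section \<open>The Hamiltonians\<close>

definition Ek :: "(real ^ 'n \<Rightarrow> real) \<Rightarrow> real ^ 'n \<Rightarrow> real ^ 'n \<Rightarrow> real" where
  "Ek \<epsilon> k p = \<epsilon> (k /\<^sub>R 2 + p) + \<epsilon> (k /\<^sub>R 2 - p)"

text \<open>For continuous periodic \<open>\<epsilon>\<close> the infimum is attained.\<close>

definition Emin :: "(real ^ 'n \<Rightarrow> real) \<Rightarrow> real ^ 'n \<Rightarrow> real" where
  "Emin \<epsilon> k = (INF q. Ek \<epsilon> k q)"

text \<open>The defining properties are preserved under unions, so the maximal neighbourhood is the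
  union of all neighbourhoods having them.\<close>

definition GG :: "(real ^ 'n \<Rightarrow> real) \<Rightarrow> (real ^ 'n) set" where
  "GG \<epsilon> = \<Union> {U. torus_open U \<and> 0 \<in> U \<and>
     (\<forall>k\<in>U. Cm 3 (Ek \<epsilon> k) \<and> morse (Ek \<epsilon> k) \<and> Ek \<epsilon> k 0 = Emin \<epsilon> k)}"

definition Ek_hat :: "(real ^ 'n \<Rightarrow> real) \<Rightarrow> real ^ 'n \<Rightarrow> int ^ 'n \<Rightarrow> complex" where
  "Ek_hat \<epsilon> k x = (\<integral>p. cis (- pairing p x) * complex_of_real (Ek \<epsilon> k p) \<partial>haar)"

definition H0 ::
  "(real ^ 'n \<Rightarrow> real) \<Rightarrow> real ^ 'n \<Rightarrow> (int ^ 'n \<Rightarrow> complex) \<Rightarrow> (int ^ 'n \<Rightarrow> complex)" where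
  "H0 \<epsilon> k f = (\<lambda>x. \<Sum>\<^sub>\<infinity>s. Ek_hat \<epsilon> k (x - s) * f s)"

definition Vop :: "(int ^ 'n \<Rightarrow> real) \<Rightarrow> (int ^ 'n \<Rightarrow> complex) \<Rightarrow> (int ^ 'n \<Rightarrow> complex)" where
  "Vop v f = (\<lambda>x. complex_of_real (v x) * f x)"

definition sqrt_absV ::
  "(int ^ 'n \<Rightarrow> real) \<Rightarrow> (int ^ 'n \<Rightarrow> complex) \<Rightarrow> (int ^ 'n \<Rightarrow> complex)" where
  "sqrt_absV v f = (\<lambda>x. complex_of_real (sqrt \<bar>v x\<bar>) * f x)"

definition H ::
  "(real ^ 'n \<Rightarrow> real) \<Rightarrow> (int ^ 'n \<Rightarrow> real) \<Rightarrow> real \<Rightarrow> real ^ 'n \<Rightarrow>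
     (int ^ 'n \<Rightarrow> complex) \<Rightarrow> (int ^ 'n \<Rightarrow> complex)" where
  "H \<epsilon> v \<mu> k f = H0 \<epsilon> k f + cscale (complex_of_real \<mu>) (Vop v f)"

section \<open>The free resolvent and the Birman--Schwinger operator\<close>

definition R0_kernel ::
  "(real ^ 'n \<Rightarrow> real) \<Rightarrow> real ^ 'n \<Rightarrow> real \<Rightarrow> int ^ 'n \<Rightarrow> complex" where
  "R0_kernel \<epsilon> k z x = (\<integral>q. cis (pairing q x) / complex_of_real (Ek \<epsilon> k q - z) \<partial>haar)"

definition R0 ::
  "(real ^ 'n \<Rightarrow> real) \<Rightarrow> real ^ 'n \<Rightarrow> real \<Rightarrow>
     (int ^ 'n \<Rightarrow> complex) \<Rightarrow> (int ^ 'n \<Rightarrow> complex)" where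
  "R0 \<epsilon> k z g = (\<lambda>x. \<Sum>\<^sub>\<infinity>y. R0_kernel \<epsilon> k z (x - y) * g y)"

definition BS ::
  "(real ^ 'n \<Rightarrow> real) \<Rightarrow> (int ^ 'n \<Rightarrow> real) \<Rightarrow> real \<Rightarrow> real ^ 'n \<Rightarrow> real \<Rightarrow>
     (int ^ 'n \<Rightarrow> complex) \<Rightarrow> (int ^ 'n \<Rightarrow> complex)" where
  "BS \<epsilon> v \<mu> k z \<psi> = (\<lambda>x. \<Sum>\<^sub>\<infinity>y.
     complex_of_real \<mu> * complex_of_real (sqrt \<bar>v x\<bar>) * R0_kernel \<epsilon> k z (x - y)
       * complex_of_real (sqrt \<bar>v y\<bar>) * \<psi> y)"

section \<open>Singular points, threshold resonances and threshold eigenvalues\<close>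

definition singular_point ::
  "(real ^ 'n \<Rightarrow> real) \<Rightarrow> (int ^ 'n \<Rightarrow> real) \<Rightarrow> real \<Rightarrow> real ^ 'n \<Rightarrow> nat \<Rightarrow> bool" where
  "singular_point \<epsilon> v \<mu> k m \<longleftrightarrow> eigenvalue_of_multiplicity (BS \<epsilon> v \<mu> k (Emin \<epsilon> k)) 1 m"

text \<open>If the multiplicity exceeds 1, different solutions may be of different type, and the
  threshold may be a resonance and an eigenvalue at the same time.\<close>

definition threshold_resonance ::
  "(real ^ 'n \<Rightarrow> real) \<Rightarrow> (int ^ 'n \<Rightarrow> real) \<Rightarrow> real \<Rightarrow> real ^ 'n \<Rightarrow> bool" where
  "threshold_resonance \<epsilon> v \<mu> k \<longleftrightarrow> CARD('n) \<in> {3, 4} \<and> (\<exists>m. singular_point \<epsilon> v \<mu> k m) \<and>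
     (\<exists>\<psi>\<in>ell2e. \<psi> \<noteq> 0 \<and> \<psi> = BS \<epsilon> v \<mu> k (Emin \<epsilon> k) \<psi> \<and>
        R0 \<epsilon> k (Emin \<epsilon> k) (sqrt_absV v \<psi>) \<in> ell0 - ell2e)"

definition threshold_eigenvalue ::
  "(real ^ 'n \<Rightarrow> real) \<Rightarrow> (int ^ 'n \<Rightarrow> real) \<Rightarrow> real \<Rightarrow> real ^ 'n \<Rightarrow> bool" where
  "threshold_eigenvalue \<epsilon> v \<mu> k \<longleftrightarrow> (\<exists>m. singular_point \<epsilon> v \<mu> k m) \<and>
     (\<exists>\<psi>\<in>ell2e. \<psi> \<noteq> 0 \<and> \<psi> = BS \<epsilon> v \<mu> k (Emin \<epsilon> k) \<psi> \<and>
        R0 \<epsilon> k (Emin \<epsilon> k) (sqrt_absV v \<psi>) \<in> ell2e)"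

end

theory Submission
  imports Defs
begin

text \<open>
  Write \<open>w = \<E>\<^sub>k - \<E>\<^sub>m\<^sub>i\<^sub>n \<ge> 0\<close>, let \<open>W\<close> be the operator with symbol \<open>w\<close>, and let \<open>S\<close> be multiplication by
  \<open>(\<mu> |v|)\<^sup>1\<^sup>/\<^sup>2\<close>, so that the shifted Hamiltonian is \<open>W - S\<^sup>2\<close> and the Birman--Schwinger operator is
  \<open>S W\<^sup>-\<^sup>1 S\<close>. Since \<open>\<E>\<^sub>k\<close> is Morse, \<open>w\<close> grows quadratically at its finitely many zeros, so \<open>1/w\<close> is
  integrable for \<open>d \<ge> 3\<close> and square integrable for \<open>d \<ge> 5\<close>; hence \<open>W\<^sup>-\<^sup>1\<close> maps \<open>\<ell>\<^sup>1\<close> into null sequences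
  (Riemann--Lebesgue), respectively into square-summable sequences (Bessel).

  The correspondence of solutions needs that \<open>W h = 0\<close> has no nonzero solution vanishing at infinity:
  a pseudofunction on the torus supported in a finite set is zero. The form
  \<open>T f g = \<Sum>x. h x * ft f x * cnj (ft g x)\<close> vanishes when the supports of \<open>f\<close> and \<open>g\<close> are separated from
  the zeros of \<open>w\<close> (as differences); cutting the torus into \<open>n\<close> small boxes, only \<open>O(n)\<close> pairs of boxes contribute to
  \<open>h 0 = T 1 1\<close>, each \<open>o(1/n)\<close> because \<open>h\<close> is a null sequence.

  For the eigenvalue counts, both \<open>W - S\<^sup>2\<close> and \<open>1 - S W\<^sup>-\<^sup>1 S\<close> have weakly lower semicontinuous forms,
  so the number of their negative eigenvalues is the maximal dimension of a subspace on which the form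
  is negative; such subspaces are carried into each other by \<open>S\<close> and by \<open>(W + d)\<^sup>-\<^sup>1 S\<close>, \<open>d\<close> small.
\<close>

section \<open>Sums as integrals against the counting measure\<close>

text \<open>A solution of the threshold equation is only a null sequence: its Fourier series need
  not define a function, so \<open>W h = 0\<close> cannot be read as a pointwise product with
  \<open>w\<close>. Treating the series as a distribution does not help directly either, because
  \<open>w\<close> is used through its absolutely summable coefficients alone and such a symbol need
  not multiply distributions. Hence the detour through a sesquilinear form, whose arguments are
  bounded functions, so that every sum converges absolutely and cutting a function by an indicator
  is harmless. The eigenvalue counts are suprema of dimensions of eigenspaces, and no spectral
  theorem is invoked. Semicontinuity lets a negative infimum of the form over the unit ball be
  attained, also on the orthogonal complement of eigenvectors already found; so each negative
  subspace of dimension \<open>N\<close> yields \<open>N\<close> orthonormal eigenvectors. Counts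
  are compared through the statements \<open>enat N \<le> count\<close> for all \<open>N\<close>,
  which treats finite and infinite counts alike. Dominated convergence is the main limit tool, for
  sums as well as for torus integrals; this is why sums are written as integrals against the
  counting measure.\<close>

abbreviation counting :: "'a measure" where "counting \<equiv> count_space UNIV"

lemma integrable_counting_iff:
  fixes f :: "'a \<Rightarrow> 'b :: {banach, second_countable_topology}"
  shows "integrable counting f \<longleftrightarrow> (\<lambda>x. norm (f x)) summable_on UNIV"
  using abs_summable_equivalent[of f UNIV] by (simp add: Infinite_Set_Sum.abs_summable_on_def)

text \<open>For complex families summability and absolute summability coincide, and outside that
  case both sides take the default value 0; so no hypothesis appears.\<close>

lemma infsum_eq_integral_counting:
  fixes f :: "'a \<Rightarrow> complex"
  shows "infsum f UNIV = (\<integral>x. f x \<partial>counting)"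
proof (cases "integrable counting f")
  case True
  then have "Infinite_Set_Sum.abs_summable_on f UNIV"
    by (simp add: Infinite_Set_Sum.abs_summable_on_def)
  from infsetsum_infsum[OF this] show ?thesis by (simp add: infsetsum_def)
next
  case False
  then have "\<not> f summable_on UNIV"
    by (simp add: integrable_counting_iff summable_on_iff_abs_summable_on_complex)
  with False show ?thesis by (simp add: infsum_not_exists not_integrable_integral_eq)
qed

lemma integrable_counting_bound:
  fixes f :: "'a \<Rightarrow> 'b :: {banach, second_countable_topology}"
    and g :: "'a \<Rightarrow> 'c :: {banach, second_countable_topology}"
  assumes "integrable counting f" and "\<And>x. norm (g x) \<le> norm (f x)"
  shows "integrable counting g"
  by (rule Bochner_Integration.integrable_bound[OF assms(1)]) (auto simp: assms(2))

text \<open>Fubini with one discrete variable: countability of the index makes joint measurability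
  automatic, so only the sections and the sum of their norms have to be controlled.\<close>

lemma
  fixes f :: "'a::countable \<Rightarrow> 'b \<Rightarrow> 'c :: {banach, second_countable_topology}"
  assumes "sigma_finite_measure M" and int: "\<And>x. integrable M (f x)"
    and abs: "integrable counting (\<lambda>x. \<integral>y. norm (f x y) \<partial>M)"
  shows integral_counting_swap: "(\<integral>x. (\<integral>y. f x y \<partial>M) \<partial>counting) = (\<integral>y. (\<integral>x. f x y \<partial>counting) \<partial>M)"
    and integrable_integral_counting: "integrable M (\<lambda>y. \<integral>x. f x y \<partial>counting)"
proof -
  interpret M: sigma_finite_measure M by fact
  interpret C: sigma_finite_measure "counting :: 'a measure" by (rule sigma_finite_measure_count_space)
  interpret P: pair_sigma_finite "counting :: 'a measure" M ..
  have "integrable (counting \<Otimes>\<^sub>M M) (case_prod f)"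
    by (rule P.Fubini_integrable) (use int abs in \<open>auto intro!: measurable_pair_measure_countable1\<close>)
  then show "(\<integral>x. (\<integral>y. f x y \<partial>M) \<partial>counting) = (\<integral>y. (\<integral>x. f x y \<partial>counting) \<partial>M)"
    and "integrable M (\<lambda>y. \<integral>x. f x y \<partial>counting)"
    by (simp_all add: P.Fubini_integral P.integrable_snd)
qed

lemma integral_counting_bij:
  fixes f :: "'a \<Rightarrow> 'c :: {banach, second_countable_topology}"
  assumes "bij g"
  shows "(\<integral>x. f (g x) \<partial>counting) = (\<integral>x. f x \<partial>counting)"
    and "integrable counting (\<lambda>x. f (g x)) \<longleftrightarrow> integrable counting f"
  using integral_bij_count_space[of g UNIV UNIV f] integrable_bij_count_space[of g UNIV UNIV f] assms by auto

lemma bij_minus_const [simp]: "bij (\<lambda>s. x - s :: 'a :: group_add)"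
  by (rule bij_betw_byWitness[where f' = "\<lambda>s. - s + x"]) (auto simp: algebra_simps)

lemma bij_diff_const [simp]: "bij (\<lambda>s. s - x :: 'a :: group_add)"
  by (rule bij_betw_byWitness[where f' = "\<lambda>s. s + x"]) auto

lemma bij_add_const [simp]: "bij (\<lambda>s. s + x :: 'a :: group_add)"
  by (rule bij_betw_byWitness[where f' = "\<lambda>s. s - x"]) auto

section \<open>The torus\<close>

text \<open>\<open>lborel\<close> is the image of a product measure indexed by \<open>Basis\<close>;
  the work lies in passing from basis vectors to coordinates.\<close>

lemma integral_lborel_prod_vec:
  fixes f :: "'n::finite \<Rightarrow> real \<Rightarrow> complex"
  assumes f: "\<And>j. integrable lborel (f j)"
  shows "(\<integral>p. (\<Prod>j\<in>UNIV. f j (p $ j)) \<partial>(lborel :: (real ^ 'n) measure)) = (\<Prod>j\<in>UNIV. \<integral>t. f j t \<partial>lborel)"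
proof -
  interpret product_sigma_finite "\<lambda>_ :: real ^ 'n. lborel :: real measure" ..
  \<comment> \<open>Reindexes the factors by basis vectors, the index set of the product
    measure.\<close>
  define g where "g b = f (THE j. b = axis j 1)" for b :: "real ^ 'n"
  have g_axis: "g (axis j 1) = f j" for j
    unfolding g_def by (simp add: axis_eq_axis)
  have Basis: "(Basis :: (real ^ 'n) set) = range (\<lambda>j. axis j 1)" by (auto simp: Basis_vec_def)
  have inj: "inj (\<lambda>j. axis j 1 :: real ^ 'n)" by (auto simp: inj_on_def axis_eq_axis)
  have [measurable]: "f j \<in> borel_measurable borel" for j using f[of j] by auto
  have "(\<integral>p. (\<Prod>j\<in>UNIV. f j (p $ j)) \<partial>(lborel :: (real ^ 'n) measure))
      = (\<integral>x. (\<Prod>j\<in>UNIV. f j ((\<Sum>b\<in>Basis. x b *\<^sub>R b) $ j)) \<partial>(\<Pi>\<^sub>M b\<in>(Basis :: (real ^ 'n) set). lborel))"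
    by (subst lborel_eq, subst integral_distr) simp_all
  also have "\<dots> = (\<integral>x. (\<Prod>b\<in>Basis. g b (x b)) \<partial>(\<Pi>\<^sub>M b\<in>(Basis :: (real ^ 'n) set). lborel))"
  proof (rule Bochner_Integration.integral_cong[OF refl])
    fix x :: "real ^ 'n \<Rightarrow> real"
    have "(\<Sum>b\<in>Basis. x b *\<^sub>R b) $ j = x (axis j 1)" for j
    proof -
      have "(\<Sum>b\<in>Basis. x b *\<^sub>R b) $ j = (\<Sum>b\<in>Basis. x b *\<^sub>R b) \<bullet> axis j 1" 
        by (simp add: inner_axis)
      also have "\<dots> = x (axis j 1)" by (subst inner_sum_left_Basis) (auto simp: Basis)
      finally show ?thesis .
    qed
    then show "(\<Prod>j\<in>UNIV. f j ((\<Sum>b\<in>Basis. x b *\<^sub>R b) $ j)) = (\<Prod>b\<in>Basis. g b (x b))"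
      unfolding Basis by (simp add: prod.reindex[OF inj] g_axis)
  qed
  also have "\<dots> = (\<Prod>b\<in>Basis. \<integral>t. g b t \<partial>lborel)"
    by (rule product_integral_prod) (auto simp: Basis g_axis f)
  also have "\<dots> = (\<Prod>j\<in>UNIV. \<integral>t. f j t \<partial>lborel)"
    unfolding Basis by (simp add: prod.reindex[OF inj] g_axis)
  finally show ?thesis .
qed

lemma torus_borel [measurable]: "torus \<in> sets borel"
proof -
  have "torus = (\<Inter>j. {p :: real ^ 'n. - pi \<le> p $ j} \<inter> {p. p $ j < pi})" by (auto simp: torus_def)
  also have "\<dots> \<in> sets borel" 
    by (intro sets.countable_INT'') (auto intro!: borel_closed borel_open closed_Collect_le open_Collect_less continuous_intros)
  finally show ?thesis .
qed

lemma sets_haar [measurable_cong, simp]: "sets haar = sets borel"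
  by (simp add: haar_def)

lemma space_haar [simp]: "space haar = UNIV"
  by (simp add: haar_def)

lemma integral_haar:
  fixes f :: "real ^ 'n::finite \<Rightarrow> complex"
  assumes [measurable]: "f \<in> borel_measurable borel"
  shows "(\<integral>p. f p \<partial>haar) = (\<integral>p. (indicator torus p / (2 * pi) ^ CARD('n)) *\<^sub>R f p \<partial>lborel)"
  unfolding haar_def by (subst integral_density) auto

lemma continuous_on_cis [continuous_intros]:
  "continuous_on S f \<Longrightarrow> continuous_on S (\<lambda>p. cis (f p))"
  unfolding cis_conv_exp by (intro continuous_intros)

lemma measurable_cis [measurable]: "cis \<in> borel_measurable borel"
  by (intro borel_measurable_continuous_onI continuous_intros)

lemma integral_circle_cis:
  "(\<integral>t. (indicator {-pi..<pi} t / (2 * pi)) *\<^sub>R cis (t * of_int m) \<partial>lborel) = (if m = 0 then 1 else 0)"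
proof -
  have I: "set_integrable lborel {-pi..pi} (\<lambda>t. cis (t * of_int m))"
    unfolding set_integrable_def by (rule borel_integrable_compact) (auto intro!: continuous_intros)
  have "(\<integral>t. (indicator {-pi..<pi} t / (2 * pi)) *\<^sub>R cis (t * of_int m) \<partial>lborel)
      = (\<integral>t. (1 / (2 * pi)) *\<^sub>R (indicator {-pi..pi} t *\<^sub>R cis (t * of_int m)) \<partial>lborel)"
    by (rule integral_cong_AE) (auto intro!: AE_I[of _ _ "{pi}"] simp: indicator_def)
  also have "\<dots> = (1 / (2 * pi)) *\<^sub>R (\<integral>t. indicator {-pi..pi} t *\<^sub>R cis (t * of_int m) \<partial>lborel)"
    by (rule integral_scaleR_right)
  also have "(\<integral>t. indicator {-pi..pi} t *\<^sub>R cis (t * of_int m) \<partial>lborel) = (if m = 0 then 2 * pi else 0)"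
  proof (cases "m = 0")
    case True
    then show ?thesis by (simp add: scaleR_conv_of_real)
  next
    case False
    define F where "F t = cis (t * of_int m) / (\<i> * of_int m)" for t
    have "(\<integral>t. indicator {-pi..pi} t *\<^sub>R cis (t * of_int m) \<partial>lborel) = F pi - F (-pi)"
    proof (rule integral_FTC_Icc)
      fix x :: real
      have "((\<lambda>z. exp (\<i> * (z * of_int m)) / (\<i> * of_int m)) has_field_derivative cis (x * of_int m)) (at (of_real x))"
        unfolding cis_conv_exp using False by (auto intro!: derivative_eq_intros simp: mult_ac)
      then show "(F has_vector_derivative cis (x * of_int m)) (at x within {-pi..pi})"
        unfolding F_def[abs_def] cis_conv_exp of_real_mult of_real_of_int_eq by (rule has_vector_derivative_real_field)
    qed (auto intro!: continuous_intros simp: cis_conv_exp)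
    also have "F pi = F (- pi)"
    proof -
      have "sin (pi * of_int m) = 0" by (simp add: sin_times_pi_eq_0 mult.commute[of pi])
      then have "cis (pi * of_int m) = cis (- pi * of_int m)" by (simp add: complex_eq_iff)
      then show ?thesis by (simp add: F_def)
    qed
    finally show ?thesis using False by simp
  qed
  finally show ?thesis by (simp add: scaleR_conv_of_real)
qed

lemma cis_sum: "cis (\<Sum>i\<in>A. f i) = (\<Prod>i\<in>A. cis (f i))"
  by (induction A rule: infinite_finite_induct) (auto simp flip: cis_mult)

lemma continuous_on_pairing [continuous_intros]:
  "continuous_on S f \<Longrightarrow> continuous_on S (\<lambda>p. pairing (f p) x)"
  unfolding pairing_def by (intro continuous_intros)

lemma measurable_pairing [measurable]: "(\<lambda>p. pairing p x) \<in> borel_measurable borel"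
  by (intro borel_measurable_continuous_onI continuous_intros)

text \<open>The density of \<open>haar\<close> and the character both factorise over coordinates,
  which leaves the circle integral. The case \<open>x = 0\<close> also supplies the total mass
  1.\<close>

lemma integral_haar_cis:
  "(\<integral>p. cis (pairing p x) \<partial>(haar :: (real ^ 'n::finite) measure)) = (if x = 0 then 1 else 0)"
proof -
  define f where "f j t = (indicator {-pi..<pi} t / (2 * pi)) *\<^sub>R cis (t * of_int (x $ j))" for j t
  have f: "integrable lborel (f j)" for j
  proof (rule Bochner_Integration.integrable_bound)
    show "integrable lborel (\<lambda>t. indicator {-pi..<pi} t *\<^sub>R (1::real))" by simp
    show "AE t in lborel. norm (f j t) \<le> norm (indicator {- pi..<pi} t *\<^sub>R (1::real))"
      using pi_gt3 by (auto simp: f_def indicator_def)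
  qed (unfold f_def[abs_def], measurable)
  have "(\<integral>p. cis (pairing p x) \<partial>(haar :: (real ^ 'n::finite) measure))
     = (\<integral>p. (\<Prod>j\<in>UNIV. f j (p $ j)) \<partial>(lborel :: (real ^ 'n) measure))"
    by (subst integral_haar)
      (auto intro!: Bochner_Integration.integral_cong simp: f_def pairing_def cis_sum scaleR_conv_of_real
        prod.distrib prod_dividef indicator_def torus_def not_le not_less)
  also have "\<dots> = (\<Prod>j\<in>UNIV. if x $ j = 0 then 1 else 0)"
    unfolding integral_lborel_prod_vec[OF f] by (rule prod.cong) (simp_all add: f_def[abs_def] integral_circle_cis)
  also have "\<dots> = (if x = 0 then 1 else 0)" by (auto simp: vec_eq_iff)
  finally show ?thesis .
qed

lemma finite_measure_haar: "finite_measure (haar :: (real ^ 'n::finite) measure)"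
proof
  have "emeasure lborel (torus :: (real ^ 'n) set) \<le> emeasure lborel (cbox (- vec pi) (vec pi) :: (real ^ 'n) set)"
    by (rule emeasure_mono) (auto simp: torus_def mem_box_cart less_imp_le)
  also have "\<dots> < \<infinity>" by (rule emeasure_lborel_cbox_finite)
  finally have fin: "emeasure lborel (torus :: (real ^ 'n) set) < \<infinity>" .
  have density_eq: "ennreal (indicator torus p / c) = ennreal (1 / c) * indicator torus p" for p :: "real ^ 'n" and c
    by (cases "p \<in> torus") auto
  have "emeasure (haar :: (real ^ 'n) measure) (space haar) = emeasure (haar :: (real ^ 'n) measure) UNIV"
    by simp
  also have "\<dots> = (\<integral>\<^sup>+p. ennreal (1 / (2 * pi) ^ CARD('n)) * indicator (torus :: (real ^ 'n) set) p \<partial>lborel)"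
    unfolding haar_def by (subst emeasure_density) (simp_all add: density_eq del: power_mult_distrib)
  also have "\<dots> < \<infinity>" using fin by (subst nn_integral_cmult_indicator) (auto simp: ennreal_mult_less_top)
  finally show "emeasure (haar :: (real ^ 'n) measure) (space haar) \<noteq> \<infinity>" by simp
qed

interpretation haar: finite_measure haar by (rule finite_measure_haar)

lemma sigma_finite_haar: "sigma_finite_measure haar" ..

lemma measure_haar_UNIV [simp]: "measure (haar :: (real ^ 'n::finite) measure) UNIV = 1"
  using integral_haar_cis[of "0 :: int ^ 'n"] by (simp add: pairing_def scaleR_conv_of_real)

section \<open>Absolutely convergent lattice sums: partial sums, finite supports, decay\<close>

lemma
  fixes f :: "'a \<Rightarrow> real"
  assumes nn: "\<And>x. 0 \<le> f x" and le: "\<And>F. finite F \<Longrightarrow> sum f F \<le> C"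
  shows integrable_counting_if_sums_bounded: "integrable counting f"
    and integral_counting_le_if_sums_le: "(\<integral>x. f x \<partial>counting) \<le> C"
proof -
  have "f summable_on UNIV"
    by (rule nonneg_bdd_above_summable_on) (use nn le in \<open>auto simp: bdd_above_def\<close>)
  then show I: "integrable counting f"
    by (simp add: integrable_counting_iff nn)
  then have "(\<integral>x. f x \<partial>counting) = infsum f UNIV"
    using infsetsum_infsum[of f UNIV] by (simp add: infsetsum_def Infinite_Set_Sum.abs_summable_on_def)
  also have "\<dots> \<le> C"
    by (rule infsum_le_finite_sums[OF \<open>f summable_on UNIV\<close>]) (use le in auto)
  finally show "(\<integral>x. f x \<partial>counting) \<le> C" .
qed

lemma integral_counting_finite_support:
  fixes f :: "'a \<Rightarrow> 'b :: {banach, second_countable_topology}"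
  assumes "finite F" and "\<And>x. x \<notin> F \<Longrightarrow> f x = 0"
  shows "integrable counting f" and "(\<integral>x. f x \<partial>counting) = sum f F"
proof -
  have "finite {x. f x \<noteq> 0}" by (rule finite_subset[OF _ assms(1)]) (use assms(2) in auto)
  then show "integrable counting f"
    by (simp add: integrable_counting_iff finite_nonzero_values_imp_summable_on)
  have "(\<integral>x. f x \<partial>counting) = sum f {x \<in> UNIV. f x \<noteq> 0}"
    by (rule lebesgue_integral_count_space_finite_support) (use \<open>finite {x. f x \<noteq> 0}\<close> in simp)
  also have "\<dots> = sum f F"
    by (rule sum.mono_neutral_left) (use assms in auto)
  finally show "(\<integral>x. f x \<partial>counting) = sum f F" .
qed

lemma sum_le_integral_counting:
  fixes f :: "'a \<Rightarrow> real"
  assumes "integrable counting f" and "\<And>x. 0 \<le> f x" and "finite F"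
  shows "sum f F \<le> (\<integral>x. f x \<partial>counting)"
proof -
  note fin = integral_counting_finite_support[OF assms(3), of "\<lambda>x. f x * indicator F x"]
  have "sum f F = (\<integral>x. f x * indicator F x \<partial>counting)"
    by (subst fin(2)) (auto intro: sum.cong)
  also have "\<dots> \<le> (\<integral>x. f x \<partial>counting)"
    by (rule integral_mono) (use assms fin(1) in \<open>auto simp: indicator_def\<close>)
  finally show ?thesis .
qed

text \<open>Infinitely many values of norm at least \<open>e\<close> would contain \<open>n\<close>
  of them with \<open>n * e\<close> above the total sum.\<close>

lemma integrable_counting_tendsto_0:
  fixes f :: "'a \<Rightarrow> 'b :: {banach, second_countable_topology}"
  assumes "integrable counting f"
  shows "(f \<longlongrightarrow> 0) cofinite"
proof (rule tendstoI)
  fix e :: real assume e: "e > 0"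
  show "eventually (\<lambda>x. dist (f x) 0 < e) cofinite"
    unfolding eventually_cofinite
  proof (rule ccontr)
    assume "infinite {x. \<not> dist (f x) 0 < e}"
    define C where "C = (\<integral>x. norm (f x) \<partial>counting)"
    obtain n :: nat where n: "C < real n * e" using reals_Archimedean3[OF e] by blast
    obtain F where F: "finite F" "card F = n" "F \<subseteq> {x. \<not> dist (f x) 0 < e}"
      using infinite_arbitrarily_large[OF \<open>infinite _\<close>] by blast
    have "real n * e \<le> (\<Sum>x\<in>F. norm (f x))"
      using sum_mono[of F "\<lambda>_. e" "\<lambda>x. norm (f x)"] F by (auto simp: subset_iff not_less)
    also have "\<dots> \<le> C" unfolding C_def
      by (rule sum_le_integral_counting) (use assms F in auto)
    finally show False using n by simp
  qed
qed

section \<open>Fourier series\<close>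

lemma pairing_simps [simp]:
  "pairing p (x + y) = pairing p x + pairing p y"
  "pairing p (x - y) = pairing p x - pairing p y"
  "pairing p (- x) = - pairing p x"
  "pairing p 0 = 0"
  "pairing (p + q) x = pairing p x + pairing q x"
  "pairing (p - q) x = pairing p x - pairing q x"
  "pairing (- p) x = - pairing p x"
  "pairing 0 x = 0"
  by (simp_all add: pairing_def algebra_simps sum.distrib sum_subtractf sum_negf)

text \<open>The opposite signs make \<open>ft\<close> a left inverse of \<open>dft\<close> (see
  \<open>ft_dft\<close>). With this choice the resolvent kernel is itself an \<open>ft\<close>, and
  convolution with \<open>ft \<phi>\<close> becomes multiplication of \<open>dft\<close> by
  \<open>\<phi>\<close>.\<close>

definition ft :: "(real ^ 'n \<Rightarrow> complex) \<Rightarrow> int ^ 'n \<Rightarrow> complex" where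
  "ft \<phi> x = (\<integral>q. cis (pairing q x) * \<phi> q \<partial>haar)"

definition dft :: "(int ^ 'n \<Rightarrow> complex) \<Rightarrow> real ^ 'n \<Rightarrow> complex" where
  "dft g q = (\<integral>y. g y * cis (- pairing q y) \<partial>counting)"

lemma integrable_cis_mult:
  fixes \<phi> :: "real ^ 'n::finite \<Rightarrow> complex"
  assumes "integrable haar \<phi>"
  shows "integrable haar (\<lambda>q. cis (pairing q x) * \<phi> q)"
proof (rule Bochner_Integration.integrable_bound[OF assms])
  show "(\<lambda>q. cis (pairing q x) * \<phi> q) \<in> borel_measurable haar"
    using borel_measurable_integrable[OF assms] by measurable
qed (simp add: norm_mult)

lemma ft_diff: "integrable haar \<phi> \<Longrightarrow> integrable haar \<psi> \<Longrightarrow> ft (\<lambda>q. \<phi> q - \<psi> q) x = ft \<phi> x - ft \<psi> x"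
  by (simp add: ft_def ring_distribs integrable_cis_mult)

lemma norm_ft_le:
  assumes "integrable haar \<phi>" shows "cmod (ft \<phi> x) \<le> (\<integral>q. cmod (\<phi> q) \<partial>haar)"
  unfolding ft_def by (rule order_trans[OF integral_norm_bound]) (simp add: norm_mult)

lemma ft_cis_mult: "ft (\<lambda>q. cis (pairing q s) * \<phi> q) x = ft \<phi> (x + s)"
  unfolding ft_def by (simp add: mult.assoc[symmetric] cis_mult)

text \<open>The mean square distance from \<open>\<phi>\<close> to its partial Fourier sum
  \<open>S\<close> is nonnegative. Expanded, both cross terms and the square of \<open>S\<close>
  equal the coefficient sum, by orthogonality of the characters.\<close>

lemma bessel_finite:
  fixes \<phi> :: "real ^ 'n::finite \<Rightarrow> complex"
  assumes m [measurable]: "\<phi> \<in> borel_measurable borel"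
    and sq: "integrable haar (\<lambda>q. (cmod (\<phi> q))\<^sup>2)" and F: "finite F"
  shows "(\<Sum>x\<in>F. (cmod (ft \<phi> x))\<^sup>2) \<le> (\<integral>q. (cmod (\<phi> q))\<^sup>2 \<partial>haar)"
proof -
  have int: "integrable haar \<phi>"
  proof (rule Bochner_Integration.integrable_bound)
    show "integrable (haar :: (real ^ 'n) measure) (\<lambda>q. (cmod (\<phi> q))\<^sup>2 + 1)" using sq by simp
    have "a \<le> a\<^sup>2 + 1" if "0 \<le> a" for a :: real
      using zero_le_power2[of "a - 1"] that unfolding power2_diff by simp
    then show "AE q in haar. norm (\<phi> q) \<le> norm ((cmod (\<phi> q))\<^sup>2 + 1)" by auto
  qed auto
  define c where "c x = ft \<phi> x" for x
  define S where "S q = (\<Sum>x\<in>F. c x * cis (- pairing q x))" for q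
  have [measurable]: "S \<in> borel_measurable borel"
    unfolding S_def by measurable
  have intcis: "integrable haar (\<lambda>q :: real ^ 'n. cis (pairing q x))" for x
    by (rule haar.integrable_const_bound[of _ 1]) auto
  have intcis': "integrable haar (\<lambda>q :: real ^ 'n. cis (- pairing q x))" for x
    by (rule haar.integrable_const_bound[of _ 1]) auto
  have cnjS: "cnj (S q) = (\<Sum>x\<in>F. cnj (c x) * cis (pairing q x))" for q
    by (simp add: S_def cis_cnj)
  have phiS: "integrable haar (\<lambda>q. \<phi> q * cnj (S q))"
             "(\<integral>q. \<phi> q * cnj (S q) \<partial>haar) = (\<Sum>x\<in>F. (cmod (c x))\<^sup>2)"
  proof -
    have *: "\<phi> q * cnj (S q) = (\<Sum>x\<in>F. cnj (c x) * (cis (pairing q x) * \<phi> q))" for q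
      unfolding cnjS sum_distrib_left by (rule sum.cong) (simp_all only: mult_ac)
    show "integrable haar (\<lambda>q. \<phi> q * cnj (S q))"
      unfolding * by (intro Bochner_Integration.integrable_sum integrable_mult_right integrable_cis_mult int)
    have "(\<integral>q. \<phi> q * cnj (S q) \<partial>haar) = (\<Sum>x\<in>F. cnj (c x) * c x)"
      unfolding * c_def ft_def
      by (subst Bochner_Integration.integral_sum) (auto intro!: integrable_mult_right integrable_cis_mult int)
    then show "(\<integral>q. \<phi> q * cnj (S q) \<partial>haar) = (\<Sum>x\<in>F. (cmod (c x))\<^sup>2)"
      by (simp add: complex_norm_square[symmetric] mult.commute[of "cnj _"])
  qed
  have SS: "integrable haar (\<lambda>q. S q * cnj (S q))"
           "(\<integral>q. S q * cnj (S q) \<partial>haar) = (\<Sum>x\<in>F. (cmod (c x))\<^sup>2)"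
  proof -
    have *: "S q * cnj (S q) = (\<Sum>x\<in>F. \<Sum>y\<in>F. c x * cnj (c y) * cis (pairing q (y - x)))" for q
    proof -
      have "(c x * cis (- pairing q x)) * (cnj (c y) * cis (pairing q y)) = c x * cnj (c y) * cis (pairing q (y - x))" for x y
      proof -
        have "cis (- pairing q x) * cis (pairing q y) = cis (pairing q (y - x))" by (simp add: cis_mult)
        then show ?thesis by (metis (no_types, lifting) mult.assoc mult.left_commute)
      qed
      then show ?thesis unfolding cnjS unfolding S_def sum_product by (simp only:)
    qed
    show "integrable haar (\<lambda>q. S q * cnj (S q))"
      unfolding * by (intro Bochner_Integration.integrable_sum integrable_mult_right intcis)
    have "(\<integral>q. S q * cnj (S q) \<partial>haar) = (\<Sum>x\<in>F. \<Sum>y\<in>F. c x * cnj (c y) * (if y - x = 0 then 1 else 0))"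
      unfolding * by (simp only: Bochner_Integration.integral_sum Bochner_Integration.integrable_sum
        integrable_mult_right integral_mult_right_zero intcis integral_haar_cis)
    also have "\<dots> = (\<Sum>x\<in>F. c x * cnj (c x))"
      by (rule sum.cong) (use F in \<open>auto simp: if_distrib cong: if_cong\<close>)
    finally show "(\<integral>q. S q * cnj (S q) \<partial>haar) = (\<Sum>x\<in>F. (cmod (c x))\<^sup>2)"
      by (simp add: complex_norm_square[symmetric])
  qed
  have sqC: "integrable haar (\<lambda>q. complex_of_real ((cmod (\<phi> q))\<^sup>2))" using sq by (rule integrable_of_real)
  have square_expand: "(a - b) * (a' - b') = a * a' - a * b' - a' * b + b * b'" for a b a' b' :: complex
    by (simp add: algebra_simps)
  have expand: "complex_of_real ((cmod (\<phi> q - S q))\<^sup>2)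
      = complex_of_real ((cmod (\<phi> q))\<^sup>2) - \<phi> q * cnj (S q) - cnj (\<phi> q * cnj (S q)) + S q * cnj (S q)" for q
    by (simp only: complex_norm_square complex_cnj_diff complex_cnj_mult complex_cnj_cnj square_expand)
  have "complex_of_real (\<integral>q. (cmod (\<phi> q - S q))\<^sup>2 \<partial>haar) = (\<integral>q. complex_of_real ((cmod (\<phi> q - S q))\<^sup>2) \<partial>haar)"
    by (rule integral_complex_of_real[symmetric])
  also have "\<dots> = (\<integral>q. complex_of_real ((cmod (\<phi> q))\<^sup>2) \<partial>haar) - (\<integral>q. \<phi> q * cnj (S q) \<partial>haar)
      - (\<integral>q. cnj (\<phi> q * cnj (S q)) \<partial>haar) + (\<integral>q. S q * cnj (S q) \<partial>haar)"
    unfolding expand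
    by (simp only: Bochner_Integration.integral_diff Bochner_Integration.integral_add
         Bochner_Integration.integrable_diff integrable_cnj sqC phiS(1) SS(1))
  also have "\<dots> = complex_of_real ((\<integral>q. (cmod (\<phi> q))\<^sup>2 \<partial>haar) - (\<Sum>x\<in>F. (cmod (c x))\<^sup>2))"
    by (simp only: Bochner_Integration.integral_cnj phiS(2) SS(2) integral_complex_of_real complex_cnj_complex_of_real of_real_diff) simp
  finally have "(\<integral>q. (cmod (\<phi> q - S q))\<^sup>2 \<partial>haar) = (\<integral>q. (cmod (\<phi> q))\<^sup>2 \<partial>haar) - (\<Sum>x\<in>F. (cmod (c x))\<^sup>2)"
    unfolding of_real_eq_iff .
  moreover have "0 \<le> (\<integral>q. (cmod (\<phi> q - S q))\<^sup>2 \<partial>haar)" by simp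
  ultimately show ?thesis by (simp add: c_def)
qed

lemma
  fixes \<phi> :: "real ^ 'n::finite \<Rightarrow> complex"
  assumes "\<phi> \<in> borel_measurable borel" and "integrable haar (\<lambda>q. (cmod (\<phi> q))\<^sup>2)"
  shows integrable_ft_square: "integrable counting (\<lambda>x. (cmod (ft \<phi> x))\<^sup>2)"
    and bessel_inequality: "(\<integral>x. (cmod (ft \<phi> x))\<^sup>2 \<partial>counting) \<le> (\<integral>q. (cmod (\<phi> q))\<^sup>2 \<partial>haar)"
  using integrable_counting_if_sums_bounded integral_counting_le_if_sums_le bessel_finite[OF assms]
  by (metis zero_le_power2)+

text \<open>Cutting off large values changes all coefficients by a uniformly small amount, and the
  bounded remainder is square integrable, so Bessel makes its coefficients decay.\<close>

lemma riemann_lebesgue: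
  fixes \<phi> :: "real ^ 'n::finite \<Rightarrow> complex"
  assumes int: "integrable haar \<phi>"
  shows "(ft \<phi> \<longlongrightarrow> 0) cofinite"
proof (rule tendstoI)
  fix e :: real assume e: "e > 0"
  have [measurable]: "\<phi> \<in> borel_measurable borel" using borel_measurable_integrable[OF int] by simp
  \<comment> \<open>Truncation in height, not in space: this is what yields square
    integrability.\<close>
  define \<psi> where "\<psi> n q = (if cmod (\<phi> q) \<le> real n then \<phi> q else 0)" for n q
  have [measurable]: "\<psi> n \<in> borel_measurable borel" for n unfolding \<psi>_def by measurable
  have int\<psi>: "integrable haar (\<psi> n)" for n
    by (rule Bochner_Integration.integrable_bound[OF int]) (auto simp: \<psi>_def)
  have "(\<lambda>n. \<integral>q. cmod (\<phi> q - \<psi> n q) \<partial>haar) \<longlonglongrightarrow> (\<integral>q. 0 \<partial>(haar :: (real ^ 'n) measure))"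
  proof (rule integral_dominated_convergence[where w = "\<lambda>q. cmod (\<phi> q)"])
    show "AE q in haar. (\<lambda>n. cmod (\<phi> q - \<psi> n q)) \<longlonglongrightarrow> 0"
    proof (rule AE_I2)
      fix q
      obtain N :: nat where N: "cmod (\<phi> q) \<le> real N" using real_arch_simple by blast
      then have "eventually (\<lambda>n. cmod (\<phi> q - \<psi> n q) = 0) sequentially"
        by (intro eventually_sequentiallyI[of N]) (auto simp: \<psi>_def intro: order_trans)
      then show "(\<lambda>n. cmod (\<phi> q - \<psi> n q)) \<longlonglongrightarrow> 0" by (rule tendsto_eventually)
    qed
  qed (use int in \<open>auto simp: \<psi>_def\<close>)
  then have "eventually (\<lambda>n. (\<integral>q. cmod (\<phi> q - \<psi> n q) \<partial>haar) < e / 2) sequentially"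
    using e order_tendstoD(2)[of _ 0 sequentially "e / 2"] by simp
  then obtain n where n: "(\<integral>q. cmod (\<phi> q - \<psi> n q) \<partial>haar) < e / 2"
    by (meson eventually_happens sequentially_bot)
  have "integrable haar (\<lambda>q. (cmod (\<psi> n q))\<^sup>2)"
    by (rule haar.integrable_const_bound[of _ "(real n)\<^sup>2"]) (auto simp: \<psi>_def intro!: power_mono)
  then have "((\<lambda>x. (cmod (ft (\<psi> n) x))\<^sup>2) \<longlongrightarrow> 0) cofinite"
    by (intro integrable_counting_tendsto_0 integrable_ft_square) auto
  from order_tendstoD(2)[OF this, of "(e / 2)\<^sup>2"] e
  have "eventually (\<lambda>x. (cmod (ft (\<psi> n) x))\<^sup>2 < (e / 2)\<^sup>2) cofinite" by simp
  then show "eventually (\<lambda>x. dist (ft \<phi> x) 0 < e) cofinite"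
  proof eventually_elim
    case (elim x)
    then have "cmod (ft (\<psi> n) x) < e / 2" by (rule power2_less_imp_less) (use e in simp)
    moreover have "cmod (ft \<phi> x - ft (\<psi> n) x) < e / 2"
    proof -
      have "ft \<phi> x - ft (\<psi> n) x = ft (\<lambda>q. \<phi> q - \<psi> n q) x"
        by (rule ft_diff[symmetric]) (use int int\<psi> in auto)
      then show ?thesis using norm_ft_le[of "\<lambda>q. \<phi> q - \<psi> n q" x] int int\<psi> n by simp
    qed
    ultimately show ?case
      using norm_triangle_sub[of "ft \<phi> x" "ft (\<psi> n) x"] by simp
  qed
qed

text \<open>One application of Fubini for an arbitrary argument map \<open>\<sigma>\<close>; it is
  used with \<open>x - y\<close>, \<open>- y\<close> and \<open>y\<close>, for convolutions,
  products with \<open>dft\<close> and inner products.\<close>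

lemma
  fixes \<phi> :: "real ^ 'n::finite \<Rightarrow> complex" and g :: "int ^ 'n \<Rightarrow> complex"
  assumes int: "integrable haar \<phi>" and g: "integrable counting g"
  shows integral_ft_mult: "(\<integral>y. ft \<phi> (\<sigma> y) * g y \<partial>counting)
      = (\<integral>q. \<phi> q * (\<integral>y. g y * cis (pairing q (\<sigma> y)) \<partial>counting) \<partial>haar)"
    and integrable_ft_mult: "integrable counting (\<lambda>y. ft \<phi> (\<sigma> y) * g y)"
    and integrable_mult_cis_sum: "integrable haar (\<lambda>q. \<phi> q * (\<integral>y. g y * cis (pairing q (\<sigma> y)) \<partial>counting))"
proof -
  define f where "f y q = cis (pairing q (\<sigma> y)) * \<phi> q * g y" for y q
  have f: "integrable haar (f y)" for y
    unfolding f_def by (intro integrable_mult_left integrable_cis_mult int)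
  have fn: "(\<integral>q. norm (f y q) \<partial>haar) = (\<integral>q. norm (\<phi> q) \<partial>haar) * norm (g y)" for y
    by (simp add: f_def norm_mult)
  have abs: "integrable counting (\<lambda>y. \<integral>q. norm (f y q) \<partial>haar)"
    unfolding fn using g by simp
  note sw = integral_counting_swap[OF sigma_finite_haar f abs] 
    integrable_integral_counting[OF sigma_finite_haar f abs]
  have 1: "(\<integral>q. f y q \<partial>haar) = ft \<phi> (\<sigma> y) * g y" for y
    unfolding f_def ft_def by simp
  have 2: "(\<integral>y. f y q \<partial>counting) = \<phi> q * (\<integral>y. g y * cis (pairing q (\<sigma> y)) \<partial>counting)" for q
  proof -
    have "(\<integral>y. f y q \<partial>counting) = (\<integral>y. \<phi> q * (g y * cis (pairing q (\<sigma> y))) \<partial>counting)"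
      by (simp add: f_def mult_ac)
    then show ?thesis by simp
  qed
  show "(\<integral>y. ft \<phi> (\<sigma> y) * g y \<partial>counting)
      = (\<integral>q. \<phi> q * (\<integral>y. g y * cis (pairing q (\<sigma> y)) \<partial>counting) \<partial>haar)"
    using sw(1) unfolding 1 2 .
  show "integrable haar (\<lambda>q. \<phi> q * (\<integral>y. g y * cis (pairing q (\<sigma> y)) \<partial>counting))"
    using sw(2) unfolding 2 .
  show "integrable counting (\<lambda>y. ft \<phi> (\<sigma> y) * g y)"
  proof (rule integrable_counting_bound)
    show "integrable counting (\<lambda>y. (\<integral>q. cmod (\<phi> q) \<partial>haar) *\<^sub>R g y)" using g by simp
    show "norm (ft \<phi> (\<sigma> y) * g y) \<le> norm ((\<integral>q. cmod (\<phi> q) \<partial>haar) *\<^sub>R g y)" for y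
      using norm_ft_le[OF int, of "\<sigma> y"] by (simp add: norm_mult mult_right_mono)
  qed
qed

lemma integrable_mult_cis_counting:
  "integrable counting g \<Longrightarrow> integrable counting (\<lambda>y. g y * cis (h y))"
  by (erule integrable_counting_bound) (simp add: norm_mult)

lemma norm_dft_le: "cmod (dft g q) \<le> (\<integral>y. cmod (g y) \<partial>counting)"
  unfolding dft_def by (rule order_trans[OF integral_norm_bound]) (simp add: norm_mult)

lemma dft_diff: "integrable counting f \<Longrightarrow> integrable counting g \<Longrightarrow>
  dft (\<lambda>x. f x - g x) q = dft f q - dft g q"
  by (simp add: dft_def left_diff_distrib integrable_mult_cis_counting)

lemma continuous_on_dft: 
  fixes g :: "int ^ 'n::finite \<Rightarrow> complex"
  assumes g: "integrable counting g"
  shows "continuous_on S (dft g)"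
  unfolding continuous_on_sequentially
proof (intro allI impI ballI, elim conjE)
  fix u :: "nat \<Rightarrow> real ^ 'n" and a assume u: "u \<longlonglongrightarrow> a"
  show "(dft g \<circ> u) \<longlonglongrightarrow> dft g a"
    unfolding o_def dft_def
  proof (rule integral_dominated_convergence[where w = "\<lambda>y. cmod (g y)"])
    show "AE y in counting. (\<lambda>n. g y * cis (- pairing (u n) y)) \<longlonglongrightarrow> g y * cis (- pairing a y)"
    proof (rule AE_I2, rule tendsto_mult[OF tendsto_const])
      fix y :: "int ^ 'n"
      have "isCont (\<lambda>p. cis (- pairing p y)) a"
        using continuous_on_cis[OF continuous_on_minus[OF continuous_on_pairing[OF continuous_on_id]], of UNIV y]
        by (simp add: continuous_on_eq_continuous_at)
      then show "(\<lambda>n. cis (- pairing (u n) y)) \<longlonglongrightarrow> cis (- pairing a y)"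
        using u by (rule isCont_tendsto_compose)
    qed
  qed (use g in \<open>auto simp: norm_mult\<close>)
qed

lemma measurable_dft [measurable]: "integrable counting g \<Longrightarrow> dft g \<in> borel_measurable borel"
  by (intro borel_measurable_continuous_onI continuous_on_dft)

lemma integrable_mult_dft:
  fixes \<phi> :: "real ^ 'n::finite \<Rightarrow> complex"
  assumes "integrable haar \<phi>" "integrable counting g"
  shows "integrable haar (\<lambda>q. \<phi> q * dft g q)"
  using integrable_mult_cis_sum[OF assms, of "\<lambda>y. - y"] by (simp add: dft_def)

lemma ft_convolution:
  fixes \<phi> :: "real ^ 'n::finite \<Rightarrow> complex"
  assumes "integrable haar \<phi>" "integrable counting g"
  shows "(\<integral>y. ft \<phi> (x - y) * g y \<partial>counting) = ft (\<lambda>q. \<phi> q * dft g q) x"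
proof -
  have "(\<integral>y. ft \<phi> (x - y) * g y \<partial>counting)
      = (\<integral>q. \<phi> q * (\<integral>y. g y * cis (pairing q (x - y)) \<partial>counting) \<partial>haar)"
    by (rule integral_ft_mult[OF assms])
  also have "\<dots> = ft (\<lambda>q. \<phi> q * dft g q) x"
    unfolding ft_def
  proof (rule Bochner_Integration.integral_cong[OF refl])
    fix q
    have "(\<integral>y. g y * cis (pairing q (x - y)) \<partial>counting) = (\<integral>y. cis (pairing q x) * (g y * cis (- pairing q y)) \<partial>counting)"
      by (rule Bochner_Integration.integral_cong[OF refl]) (simp add: mult_ac cis_mult)
    then show "\<phi> q * (\<integral>y. g y * cis (pairing q (x - y)) \<partial>counting) = cis (pairing q x) * (\<phi> q * dft g q)"
      by (simp add: dft_def)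
  qed
  finally show ?thesis .
qed

lemma ft_convolution':
  fixes \<phi> :: "real ^ 'n::finite \<Rightarrow> complex"
  assumes "integrable haar \<phi>" "integrable counting g"
  shows "(\<integral>y. g (x - y) * ft \<phi> y \<partial>counting) = ft (\<lambda>q. \<phi> q * dft g q) x"
  using integral_counting_bij(1)[OF bij_minus_const[of x], of "\<lambda>y. ft \<phi> (x - y) * g y"]
  ft_convolution[OF assms, of x] by (simp add: mult.commute)

lemma integral_ft_mult_cnj:
  fixes \<phi> :: "real ^ 'n::finite \<Rightarrow> complex"
  assumes "integrable haar \<phi>" "integrable counting g"
  shows "(\<integral>y. ft \<phi> y * cnj (g y) \<partial>counting) = (\<integral>q. \<phi> q * cnj (dft g q) \<partial>haar)"
proof -
  have "cnj (dft g q) = (\<integral>y. cnj (g y) * cis (pairing q y) \<partial>counting)" for q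
  proof -
    have "cnj (\<integral>y. g y * cis (- pairing q y) \<partial>counting) = (\<integral>y. cnj (g y * cis (- pairing q y)) \<partial>counting)"
      by (rule Bochner_Integration.integral_cnj[symmetric])
    then show ?thesis by (simp only: dft_def complex_cnj_mult cis_cnj minus_minus)
  qed
  then show ?thesis using integral_ft_mult[OF assms(1) integrable_cnj[OF assms(2)], of "\<lambda>y. y"] by simp
qed

section \<open>Square-summable functions\<close>

definition sqsum :: "('a \<Rightarrow> complex) \<Rightarrow> bool" where
  "sqsum f \<longleftrightarrow> integrable counting (\<lambda>x. (cmod (f x))\<^sup>2)"

definition nsq :: "('a \<Rightarrow> complex) \<Rightarrow> real" where
  "nsq f = (\<integral>x. (cmod (f x))\<^sup>2 \<partial>counting)"

definition ip :: "('a \<Rightarrow> complex) \<Rightarrow> ('a \<Rightarrow> complex) \<Rightarrow> complex" where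
  "ip f g = (\<integral>x. f x * cnj (g x) \<partial>counting)"

lemma ell2e_iff: "f \<in> ell2e \<longleftrightarrow> sqsum f \<and> even_fun f"
  by (simp add: ell2e_def sqsum_def integrable_counting_iff)

lemma mult_le_sum_squares: "a * b \<le> a\<^sup>2 + b\<^sup>2" for a b :: real
proof -
  have "0 \<le> (a - b)\<^sup>2 + (a\<^sup>2 + b\<^sup>2)" by simp
  then show ?thesis by (simp add: power2_diff)
qed

lemma integrable_sq_mult:
  fixes f g :: "'a \<Rightarrow> real"
  assumes "integrable counting (\<lambda>x. (f x)\<^sup>2)" and "integrable counting (\<lambda>x. (g x)\<^sup>2)"
  shows "integrable counting (\<lambda>x. f x * g x)"
proof (rule integrable_counting_bound)
  show "integrable counting (\<lambda>x. (f x)\<^sup>2 + (g x)\<^sup>2)" using assms by simp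
  show "norm (f x * g x) \<le> norm ((f x)\<^sup>2 + (g x)\<^sup>2)" for x
    using mult_le_sum_squares[of "\<bar>f x\<bar>" "\<bar>g x\<bar>"] by (simp add: abs_mult)
qed

lemma sqsum_mult:
  assumes "sqsum f" "sqsum g"
  shows "integrable counting (\<lambda>x. cmod (f x) * cmod (g x))" "integrable counting (\<lambda>x. f x * g x)"
    "integrable counting (\<lambda>x. f x * cnj (g x))"
proof -
  show 1: "integrable counting (\<lambda>x. cmod (f x) * cmod (g x))"
    using assms by (intro integrable_sq_mult) (auto simp: sqsum_def)
  show "integrable counting (\<lambda>x. f x * g x)" "integrable counting (\<lambda>x. f x * cnj (g x))"
    by (rule integrable_counting_bound[OF 1], simp add: norm_mult)+
qed

lemma sqsum_add: assumes "sqsum f" "sqsum g" shows "sqsum (f + g)"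
  unfolding sqsum_def
proof (rule integrable_counting_bound)
  show "integrable counting (\<lambda>x. (cmod (f x))\<^sup>2 + (cmod (g x))\<^sup>2 + 2 * (cmod (f x) * cmod (g x)))"
    using assms sqsum_mult(1)[OF assms] by (simp add: sqsum_def)
  fix x
  have "(cmod (f x + g x))\<^sup>2 \<le> (cmod (f x) + cmod (g x))\<^sup>2"
    by (intro power_mono norm_triangle_ineq) auto
  then show "norm ((cmod ((f + g) x))\<^sup>2) \<le> norm ((cmod (f x))\<^sup>2 + (cmod (g x))\<^sup>2 + 2 * (cmod (f x) * cmod (g x)))"
    by (simp add: power2_sum)
qed

lemma sqsum_cscale: "sqsum f \<Longrightarrow> sqsum (cscale c f)"
  by (simp add: sqsum_def cscale_def norm_mult power_mult_distrib)

lemma sqsum_bound: "sqsum f \<Longrightarrow> (\<And>x. cmod (g x) \<le> cmod (f x)) \<Longrightarrow> sqsum g"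
  unfolding sqsum_def by (erule integrable_counting_bound) (auto intro: power_mono)

lemma ell2e_add: "f \<in> ell2e \<Longrightarrow> g \<in> ell2e \<Longrightarrow> f + g \<in> ell2e"
  by (simp add: ell2e_iff sqsum_add even_fun_def)

lemma ell2e_cscale: "f \<in> ell2e \<Longrightarrow> cscale c f \<in> ell2e"
  by (simp add: ell2e_iff sqsum_cscale) (simp add: even_fun_def cscale_def)

lemma sqsum_0: "sqsum 0"
  by (simp add: sqsum_def)

lemma ell2e_0: "0 \<in> ell2e"
  by (simp add: ell2e_iff even_fun_def sqsum_0)

lemma ell2e_sum: "(\<And>i. i \<in> I \<Longrightarrow> f i \<in> ell2e) \<Longrightarrow> (\<Sum>i\<in>I. f i) \<in> ell2e"
  by (induction I rule: infinite_finite_induct) (auto simp: ell2e_0 ell2e_add)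

lemma ell2e_sqsum: "f \<in> ell2e \<Longrightarrow> sqsum f"
  by (simp add: ell2e_iff)

lemma nsq_nonneg [simp]: "0 \<le> nsq f"
  by (simp add: nsq_def)

lemma ip_self: "ip f f = of_real (nsq f)"
  unfolding ip_def nsq_def by (simp add: complex_norm_square[symmetric] del: of_real_power)

lemma ip_add_left: "sqsum f \<Longrightarrow> sqsum g \<Longrightarrow> sqsum h \<Longrightarrow> ip (f + g) h = ip f h + ip g h"
  by (simp add: ip_def ring_distribs sqsum_mult)

lemma ip_add_right: "sqsum f \<Longrightarrow> sqsum g \<Longrightarrow> sqsum h \<Longrightarrow> ip h (f + g) = ip h f + ip h g"
  by (simp add: ip_def ring_distribs sqsum_mult)

lemma ip_cscale_left: "ip (cscale c f) g = c * ip f g"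
  by (simp add: ip_def cscale_def mult.assoc)

lemma ip_cscale_right: "ip f (cscale c g) = cnj c * ip f g"
  by (simp add: ip_def cscale_def mult.left_commute)

lemma ip_cnj: "cnj (ip f g) = ip g f"
  unfolding ip_def by (rule trans[OF Bochner_Integration.integral_cnj[symmetric]]) (simp add: mult.commute)

lemma ip_0_left [simp]: "ip 0 g = 0" by (simp add: ip_def)

lemma ip_0_right [simp]: "ip g 0 = 0" by (simp add: ip_def)

lemma ip_sum_left: "(\<And>i. i \<in> I \<Longrightarrow> f i \<in> ell2e) \<Longrightarrow> g \<in> ell2e \<Longrightarrow> ip (\<Sum>i\<in>I. f i) g = (\<Sum>i\<in>I. ip (f i) g)"
  by (induction I rule: infinite_finite_induct) (auto simp: ip_add_left ell2e_sum ell2e_sqsum)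

lemma ip_sum_right: "(\<And>i. i \<in> I \<Longrightarrow> f i \<in> ell2e) \<Longrightarrow> g \<in> ell2e \<Longrightarrow> ip g (\<Sum>i\<in>I. f i) = (\<Sum>i\<in>I. ip g (f i))"
  by (induction I rule: infinite_finite_induct) (auto simp: ip_add_right ell2e_sum ell2e_sqsum)

lemma nsq_cscale: "nsq (cscale c f) = (cmod c)\<^sup>2 * nsq f"
  by (simp add: nsq_def cscale_def norm_mult power_mult_distrib)

lemma nsq_uminus [simp]: "nsq (- f) = nsq f"
  by (simp add: nsq_def)

lemma nsq_eq_0: assumes "sqsum f" shows "nsq f = 0 \<longleftrightarrow> f = 0"
proof
  assume 0: "nsq f = 0"
  show "f = 0"
  proof
    fix x
    have "(cmod (f x))\<^sup>2 \<le> nsq f"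
      using sum_le_integral_counting[of "\<lambda>x. (cmod (f x))\<^sup>2" "{x}"] assms by (simp add: sqsum_def nsq_def)
    then show "f x = 0 x" using 0 by simp
  qed
qed (simp add: nsq_def)

lemma cmod_sq_le_nsq: assumes "sqsum f" shows "(cmod (f x))\<^sup>2 \<le> nsq f"
  using sum_le_integral_counting[of "\<lambda>x. (cmod (f x))\<^sup>2" "{x}"] assms by (simp add: sqsum_def nsq_def)

lemma nsq_add: "sqsum f \<Longrightarrow> sqsum g \<Longrightarrow> nsq (f + g) = nsq f + 2 * Re (ip f g) + nsq g"
proof -
  assume "sqsum f" "sqsum g"
  then have "ip (f + g) (f + g) = ip f f + ip f g + cnj (ip f g) + ip g g"
    by (simp add: ip_add_left ip_add_right sqsum_add ip_cnj)
  then show ?thesis unfolding ip_self by (simp add: complex_eq_iff)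
qed

text \<open>The discriminant criterion. It is the source of every Cauchy-Schwarz type bound below
  and of the first-order condition for minimizers.\<close>

lemma power2_le_mult_if_quadratic_nonneg:
  fixes a b c :: real
  assumes "\<And>t. 0 \<le> a + 2 * t * b + t\<^sup>2 * c" and "0 \<le> c"
  shows "b\<^sup>2 \<le> a * c"
proof (cases "c = 0")
  case True
  have "b = 0"
  proof (rule ccontr)
    assume "b \<noteq> 0"
    \<comment> \<open>For this \<open>t\<close> the linear expression \<open>a + 2 * t * b\<close>
      equals -1.\<close>
    then show False using assms(1)[of "- (a + 1) / (2 * b)"] True by (simp add: field_simps)
  qed
  with True show ?thesis by simp
next
  case False
  then have "c > 0" using assms(2) by simp
  have "0 \<le> c * (a + 2 * (- b / c) * b + (- b / c)\<^sup>2 * c)"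
    using assms(1)[of "- b / c"] \<open>c > 0\<close> by simp
  also have "\<dots> = a * c - b\<^sup>2" using \<open>c > 0\<close> by (simp add: field_simps power2_eq_square)
  finally show ?thesis by simp
qed

lemma ip_cauchy_schwarz: 
  assumes "sqsum f" "sqsum g" shows "(cmod (ip f g))\<^sup>2 \<le> nsq f * nsq g"
proof -
  have re: "(Re (ip f g))\<^sup>2 \<le> nsq f * nsq g" if fg: "sqsum f" "sqsum g" for f g :: "'a \<Rightarrow> complex"
  proof (rule power2_le_mult_if_quadratic_nonneg)
    fix t :: real
    have "0 \<le> nsq (f + cscale (of_real t) g)" by simp
    also have "\<dots> = nsq f + 2 * t * Re (ip f g) + t\<^sup>2 * nsq g"
      using fg by (simp add: nsq_add sqsum_cscale nsq_cscale ip_cscale_right)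
    finally show "0 \<le> nsq f + 2 * t * Re (ip f g) + t\<^sup>2 * nsq g" .
  qed simp
  define z where "z = ip f g"
  \<comment> \<open>The phase that rotates \<open>ip f g\<close> onto the nonnegative reals. It is 0
    when \<open>z = 0\<close>, hence only \<open>cmod c \<le> 1\<close>.\<close>
  define c where "c = cnj z / complex_of_real (cmod z)"
  have c: "cmod c \<le> 1" by (simp add: c_def norm_divide)
  have "c * z = complex_of_real (cmod z)"
    by (cases "z = 0") (simp_all add: c_def mult.commute[of "cnj z"] complex_norm_square[symmetric] power2_eq_square)
  then have "Re (ip (cscale c f) g) = cmod (ip f g)"
    by (simp add: ip_cscale_left z_def[symmetric])
  then have "(cmod (ip f g))\<^sup>2 \<le> nsq (cscale c f) * nsq g"
    using re[OF sqsum_cscale[OF assms(1)] assms(2), of c] by simp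
  also have "\<dots> \<le> nsq f * nsq g"
    unfolding nsq_cscale using c power_le_one[of "cmod c" 2]
    by (intro mult_right_mono) (auto intro: mult_left_le_one_le)
  finally show ?thesis .
qed

subsection \<open>Weak convergence\<close>

text \<open>The functions \<open>h n\<close> have no common majorant, but \<open>h n x * g x\<close>
  splits into \<open>\<eta> * (h n x)^2\<close>, small in total by the uniform bound
  \<open>D\<close>, and a remainder majorised by the fixed summable function
  \<open>(g x)^2 / (4 * \<eta>)\<close>.\<close>

lemma dominated_pairing_tendsto_0:
  fixes h :: "nat \<Rightarrow> 'a \<Rightarrow> real" and g :: "'a \<Rightarrow> real"
  assumes h: "\<And>n x. 0 \<le> h n x" "\<And>n. integrable counting (\<lambda>x. (h n x)\<^sup>2)"
      "\<And>n. (\<integral>x. (h n x)\<^sup>2 \<partial>counting) \<le> D" "\<And>x. (\<lambda>n. h n x) \<longlonglongrightarrow> 0"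
    and g: "\<And>x. 0 \<le> g x" "integrable counting (\<lambda>x. (g x)\<^sup>2)"
  shows "(\<lambda>n. \<integral>x. h n x * g x \<partial>counting) \<longlonglongrightarrow> 0"
proof (rule LIMSEQ_I)
  fix e :: real assume e: "0 < e"
  have D: "0 \<le> D" using h(3)[of 0] by (intro order_trans[OF _ h(3)[of 0]]) simp
  \<comment> \<open>Chosen for \<open>\<eta> * D < e / 2\<close>; the added 1 covers
    \<open>D = 0\<close>.\<close>
  define \<eta> where "\<eta> = e / (2 * (D + 1))"
  have \<eta>: "\<eta> > 0" "\<eta> * D < e / 2" using e D by (simp_all add: \<eta>_def field_simps)
  define m where "m n x = max 0 (h n x * g x - \<eta> * (h n x)\<^sup>2)" for n x
  have m_le: "m n x \<le> (g x)\<^sup>2 / (4 * \<eta>)" for n x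
  proof -
    have "0 \<le> (2 * \<eta> * h n x - g x)\<^sup>2" by simp
    also have "\<dots> = 4 * \<eta>\<^sup>2 * (h n x)\<^sup>2 - 4 * \<eta> * (h n x * g x) + (g x)\<^sup>2"
      by (simp add: power2_diff power_mult_distrib)
    finally have "4 * \<eta> * (h n x * g x - \<eta> * (h n x)\<^sup>2) \<le> (g x)\<^sup>2"
      by (simp add: algebra_simps power2_eq_square)
    then show ?thesis using \<eta>(1) g(1) by (simp add: m_def field_simps)
  qed
  have m0: "(\<lambda>n. \<integral>x. m n x \<partial>counting) \<longlonglongrightarrow> (\<integral>x. 0 \<partial>(counting :: 'a measure))"
  proof (rule integral_dominated_convergence[where w = "\<lambda>x. (g x)\<^sup>2 / (4 * \<eta>)"])
    show "AE x in counting. (\<lambda>n. m n x) \<longlonglongrightarrow> 0"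
    proof (rule AE_I2)
      fix x
      have "(\<lambda>n. max 0 (h n x * g x - \<eta> * (h n x)\<^sup>2)) \<longlonglongrightarrow> max 0 (0 * g x - \<eta> * 0\<^sup>2)"
        by (intro tendsto_intros h)
      then show "(\<lambda>n. m n x) \<longlonglongrightarrow> 0" by (simp add: m_def)
    qed
    show "AE x in counting. norm (m n x) \<le> (g x)\<^sup>2 / (4 * \<eta>)" for n
      using m_le[of n] by (auto simp: m_def)
  qed (use g in auto)
  have mi: "integrable counting (m n)" for n
  proof (rule integrable_counting_bound)
    show "integrable counting (\<lambda>x. (g x)\<^sup>2 / (4 * \<eta>))" using g by simp
    show "norm (m n x) \<le> norm ((g x)\<^sup>2 / (4 * \<eta>))" for x
      using m_le[of n x] \<eta>(1) by (simp add: m_def)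
  qed
  from m0 e obtain N where N: "\<And>n. n \<ge> N \<Longrightarrow> (\<integral>x. m n x \<partial>counting) < e / 2"
    using order_tendstoD(2)[OF m0, of "e / 2"] by (auto simp: eventually_sequentially)
  show "\<exists>N. \<forall>n\<ge>N. norm ((\<integral>x. h n x * g x \<partial>counting) - 0) < e"
  proof (intro exI allI impI)
    fix n assume "n \<ge> N"
    have "(\<integral>x. h n x * g x \<partial>counting) \<le> (\<integral>x. m n x + \<eta> * (h n x)\<^sup>2 \<partial>counting)"
      by (rule integral_mono) (use mi h(2) g integrable_sq_mult[OF h(2) g(2)] in \<open>auto simp: m_def\<close>)
    also have "\<dots> = (\<integral>x. m n x \<partial>counting) + \<eta> * (\<integral>x. (h n x)\<^sup>2 \<partial>counting)"
      using mi h(2) by simp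
    also have "\<dots> < e / 2 + e / 2"
      using N[OF \<open>n \<ge> N\<close>] \<eta> mult_left_mono[OF h(3)[of n], of \<eta>] by linarith
    finally have "(\<integral>x. h n x * g x \<partial>counting) < e" by simp
    moreover have "0 \<le> (\<integral>x. h n x * g x \<partial>counting)" using h g by simp
    ultimately show "norm ((\<integral>x. h n x * g x \<partial>counting) - 0) < e" by simp
  qed
qed

text \<open>Fatou's lemma for sums: each finite partial sum passes to the limit and keeps the bound
  \<open>C\<close>.\<close>

lemma
  assumes u: "\<And>n. sqsum (u n)" "\<And>n. nsq (u n) \<le> C" "\<And>x. (\<lambda>n. u n x) \<longlonglongrightarrow> f x"
  shows sqsum_pointwise_limit: "sqsum f" and nsq_pointwise_limit_le: "nsq f \<le> C"
proof -
  have F: "(\<Sum>x\<in>F. (cmod (f x))\<^sup>2) \<le> C" if "finite F" for F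
  proof (rule LIMSEQ_le_const2)
    show "(\<lambda>n. \<Sum>x\<in>F. (cmod (u n x))\<^sup>2) \<longlonglongrightarrow> (\<Sum>x\<in>F. (cmod (f x))\<^sup>2)"
      by (intro tendsto_intros u)
    have "(\<Sum>x\<in>F. (cmod (u n x))\<^sup>2) \<le> C" for n
      using sum_le_integral_counting[of "\<lambda>x. (cmod (u n x))\<^sup>2" F] that u(1)[of n] u(2)[of n]
      by (simp add: sqsum_def nsq_def)
    then show "\<exists>N. \<forall>n\<ge>N. (\<Sum>x\<in>F. (cmod (u n x))\<^sup>2) \<le> C" by blast
  qed
  show "sqsum f" unfolding sqsum_def
    by (rule integrable_counting_if_sums_bounded[OF _ F]) auto
  show "nsq f \<le> C" unfolding nsq_def
    by (rule integral_counting_le_if_sums_le[OF _ F]) auto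
qed

text \<open>Bounded norms and pointwise convergence amount to weak convergence, and a
  square-summable weight turns it into convergence in weighted \<open>l1\<close> norm. With the
  weight \<open>rv\<close> this expresses the compactness of the potential.\<close>

lemma weighted_l1_pointwise_limit:
  assumes u: "\<And>n. sqsum (u n)" "\<And>n. nsq (u n) \<le> C" "\<And>x. (\<lambda>n. u n x) \<longlonglongrightarrow> f x"
    and g: "\<And>x. 0 \<le> g x" "integrable counting (\<lambda>x. (g x)\<^sup>2)"
  shows "(\<lambda>n. \<integral>x. cmod (u n x - f x) * g x \<partial>counting) \<longlonglongrightarrow> 0"
proof (rule dominated_pairing_tendsto_0)
  have f: "sqsum f" "nsq f \<le> C"
    using sqsum_pointwise_limit[OF u] nsq_pointwise_limit_le[OF u] by auto
  define mf where "mf = cscale (-1) f"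
  have mf: "sqsum mf" unfolding mf_def by (rule sqsum_cscale[OF f(1)])
  have nmf: "nsq mf = nsq f" by (simp add: mf_def)
  have eq: "u n + mf = (\<lambda>x. u n x - f x)" for n by (simp add: fun_eq_iff cscale_def mf_def)
  show "integrable counting (\<lambda>x. (cmod (u n x - f x))\<^sup>2)" for n
    using sqsum_add[OF u(1) mf, of n] by (simp add: eq sqsum_def)
  show "(\<integral>x. (cmod (u n x - f x))\<^sup>2 \<partial>counting) \<le> 4 * C" for n
  proof -
    have "(cmod (ip (u n) (mf)))\<^sup>2 \<le> nsq (u n) * nsq (mf)"
      by (rule ip_cauchy_schwarz[OF u(1) mf])
    also have "\<dots> \<le> C * C"
      using u(2)[of n] f(2) order_trans[OF nsq_nonneg u(2)[of n]] by (intro mult_mono) (auto simp: nmf)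
    finally have "cmod (ip (u n) (mf)) \<le> C"
      using order_trans[OF nsq_nonneg u(2)[of n]] by (simp add: power2_eq_square[symmetric])
    then have "Re (ip (u n) (mf)) \<le> C" using complex_Re_le_cmod order_trans by blast
    then have "nsq (u n + mf) \<le> 4 * C"
      using u(2)[of n] f(2) by (simp add: nsq_add[OF u(1) mf] nmf)
    then show ?thesis by (simp add: eq nsq_def)
  qed
  show "(\<lambda>n. cmod (u n x - f x)) \<longlonglongrightarrow> 0" for x
    using u(3)[of x] by (simp add: LIM_zero tendsto_norm_zero)
qed (use g in auto)

lemma ip_pointwise_limit:
  assumes u: "\<And>n. sqsum (u n)" "\<And>n. nsq (u n) \<le> C" "\<And>x. (\<lambda>n. u n x) \<longlonglongrightarrow> f x"
    and g: "sqsum g"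
  shows "(\<lambda>n. ip (u n) g) \<longlonglongrightarrow> ip f g"
proof -
  have f: "sqsum f" using sqsum_pointwise_limit[OF u] .
  have "(\<lambda>n. \<integral>x. cmod (u n x - f x) * cmod (g x) \<partial>counting) \<longlonglongrightarrow> 0"
    by (rule weighted_l1_pointwise_limit[OF u]) (use g in \<open>auto simp: sqsum_def\<close>)
  moreover have "norm (ip (u n) g - ip f g) \<le> (\<integral>x. cmod (u n x - f x) * cmod (g x) \<partial>counting)" for n
  proof -
    have "ip (u n) g - ip f g = (\<integral>x. (u n x - f x) * cnj (g x) \<partial>counting)"
      unfolding ip_def using sqsum_mult[OF u(1) g] sqsum_mult[OF f g] by (simp add: left_diff_distrib)
    also have "norm \<dots> \<le> (\<integral>x. norm ((u n x - f x) * cnj (g x)) \<partial>counting)"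
      by (rule integral_norm_bound)
    finally show ?thesis by (simp add: norm_mult)
  qed
  ultimately have "(\<lambda>n. ip (u n) g - ip f g) \<longlonglongrightarrow> 0"
    by (rule Lim_null_comparison[OF always_eventually[OF allI], rotated])
  then show ?thesis by (simp add: LIM_zero_iff)
qed

text \<open>Tychonoff: a countable product of closed discs is compact and metrizable, hence
  sequentially compact.\<close>

lemma bounded_pointwise_subsequence:
  fixes u :: "nat \<Rightarrow> 'a::countable \<Rightarrow> complex"
  assumes "\<And>n x. cmod (u n x) \<le> C"
  obtains r f where "strict_mono r" and "\<And>x. (\<lambda>n. u (r n) x) \<longlonglongrightarrow> f x"
proof -
  have "compactin (product_topology (\<lambda>_::'a. euclidean) UNIV) (PiE UNIV (\<lambda>_. cball (0::complex) C))"
    unfolding compactin_PiE by (auto simp: compactin_euclidean_iff)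
  then have "compact (PiE UNIV (\<lambda>_::'a. cball (0::complex) C))"
    by (simp add: euclidean_product_topology compactin_euclidean_iff)
  then have "seq_compact (PiE UNIV (\<lambda>_::'a. cball (0::complex) C))"
    by (simp add: compact_eq_seq_compact_metric)
  moreover have "\<forall>n. u n \<in> PiE UNIV (\<lambda>_. cball 0 C)" using assms by (auto simp: PiE_def)
  ultimately obtain f r where r: "strict_mono r" "(u \<circ> r) \<longlonglongrightarrow> f"
    by (meson seq_compactE)
  have "(\<lambda>n. u (r n) x) \<longlonglongrightarrow> f x" for x
    using continuous_on_tendsto_compose[OF continuous_on_product_coordinates[of x] r(2)] by (simp add: o_def)
  with r(1) show ?thesis by (rule that)
qed

section \<open>Eigenvalues below a threshold and negative subspaces\<close>

definition qform :: "((int ^ 'n \<Rightarrow> complex) \<Rightarrow> (int ^ 'n \<Rightarrow> complex)) \<Rightarrow> (int ^ 'n \<Rightarrow> complex) \<Rightarrow> real" where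
  "qform A f = Re (ip (A f) f)"

text \<open>Negativity on all nontrivial combinations forces the \<open>N\<close> vectors to be linearly independent.\<close>

definition neg_family :: "((int ^ 'n \<Rightarrow> complex) \<Rightarrow> (int ^ 'n \<Rightarrow> complex)) \<Rightarrow> nat \<Rightarrow> bool" where
  "neg_family A N \<longleftrightarrow> (\<exists>e. (\<forall>i<N. e i \<in> ell2e) \<and>
     (\<forall>c. (\<exists>i<N. c i \<noteq> 0) \<longrightarrow> qform A (\<Sum>i<N. cscale (c i) (e i)) < 0))"

definition neg_eigenvectors :: "((int ^ 'n \<Rightarrow> complex) \<Rightarrow> (int ^ 'n \<Rightarrow> complex)) \<Rightarrow> nat \<Rightarrow>
    (nat \<Rightarrow> int ^ 'n \<Rightarrow> complex) \<Rightarrow> (nat \<Rightarrow> real) \<Rightarrow> bool" where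
  "neg_eigenvectors A N e l \<longleftrightarrow>
     (\<forall>i<N. e i \<in> ell2e \<and> A (e i) = cscale (of_real (l i)) (e i) \<and> l i < 0) \<and>
     (\<forall>i<N. \<forall>j<N. ip (e i) (e j) = (if i = j then 1 else 0))"

lemma sum_fun_apply: "(\<Sum>i\<in>I. f i) x = (\<Sum>i\<in>I. f i x)" for f :: "'i \<Rightarrow> 'a \<Rightarrow> complex"
  by (induction I rule: infinite_finite_induct) auto

lemma sum_enat: "(\<Sum>i\<in>I. enat (n i)) = enat (\<Sum>i\<in>I. n i)"
  by (induction I rule: infinite_finite_induct) (auto simp: zero_enat_def)

text \<open>The \<open>N\<close> columns lie in the span of \<open>k < N\<close> unit vectors, so
  they are dependent.\<close>

lemma underdetermined_system:
  fixes M :: "nat \<Rightarrow> nat \<Rightarrow> complex"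
  assumes "k < N"
  obtains c where "\<exists>i<N. c i \<noteq> 0" and "\<And>j. j < k \<Longrightarrow> (\<Sum>i<N. c i * M j i) = 0"
proof -
  define V where "V i = (\<lambda>j. if j < k then M j i else 0)" for i
  show thesis
  proof (cases "inj_on V {..<N}")
    \<comment> \<open>Independence is a property of sets, so two equal columns must be treated
      apart; coefficients 1 and -1 on them solve the system.\<close>
    case False
    then obtain i i' where i: "i < N" "i' < N" "i \<noteq> i'" "V i = V i'" by (auto simp: inj_on_def)
    define c where "c m = (if m = i then 1 else if m = i' then -1 else 0 :: complex)" for m
    show thesis
    proof (rule that)
      show "\<exists>m<N. c m \<noteq> 0" using i by (auto simp: c_def intro!: exI[of _ i])
      fix j assume j: "j < k"
      have "M j i = M j i'" using fun_cong[OF i(4), of j] j by (simp add: V_def)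
      have "(\<Sum>m<N. c m * M j m) = (\<Sum>m\<in>{i, i'}. c m * M j m)"
        by (rule sum.mono_neutral_right) (use i in \<open>auto simp: c_def\<close>)
      also have "\<dots> = 0" using i \<open>M j i = M j i'\<close> by (simp add: c_def)
      finally show "(\<Sum>m<N. c m * M j m) = 0" .
    qed
  next
    case True
    define \<delta> where "\<delta> j = (\<lambda>m. if m = j then 1 else 0 :: complex)" for j :: nat
    have sub: "V ` {..<N} \<subseteq> cfun.span (\<delta> ` {..<k})"
    proof
      fix v assume "v \<in> V ` {..<N}"
      then obtain i where v: "v = V i" by auto
      have "V i = (\<Sum>j<k. cscale (M j i) (\<delta> j))"
        by (rule ext) (simp add: V_def \<delta>_def sum_fun_apply cscale_def if_distrib sum.delta cong: if_cong)
      also have "\<dots> \<in> cfun.span (\<delta> ` {..<k})"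
        by (intro cfun.span_sum cfun.span_scale cfun.span_base) auto
      finally show "v \<in> cfun.span (\<delta> ` {..<k})" using v by simp
    qed
    have "cfun.dependent (V ` {..<N})"
    proof (rule ccontr)
      assume "\<not> cfun.dependent (V ` {..<N})"
      then have "card (V ` {..<N}) \<le> card (\<delta> ` {..<k})"
        using cfun.independent_span_bound[OF _ _ sub] by simp
      also have "\<dots> \<le> k" using card_image_le[of "{..<k}" \<delta>] by simp
      finally show False using assms card_image[OF True] by simp
    qed
    then obtain u where u: "\<exists>v\<in>V ` {..<N}. u v \<noteq> 0" "(\<Sum>v\<in>V ` {..<N}. cscale (u v) v) = 0"
      by (auto simp: cfun.dependent_finite)
    show thesis
    proof (rule that)
      show "\<exists>i<N. u (V i) \<noteq> 0" using u(1) by auto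
      fix j assume j: "j < k"
      have "(\<Sum>i<N. cscale (u (V i)) (V i)) = 0" using u(2) by (simp add: sum.reindex[OF True])
      from fun_cong[OF this, of j] show "(\<Sum>i<N. u (V i) * M j i) = 0"
        using j by (simp add: sum_fun_apply cscale_def V_def)
    qed
  qed
qed

text \<open>\<open>lsc\<close> is sequential weak lower semicontinuity on the unit ball, with weak
  convergence expressed by bounded norms and pointwise limits. It is stated for sequences whose form
  values converge, which is the situation of a minimizing sequence.\<close>

locale semibounded_form =
  fixes A :: "(int ^ 'n::finite \<Rightarrow> complex) \<Rightarrow> (int ^ 'n \<Rightarrow> complex)" and K :: real
  assumes maps: "f \<in> ell2e \<Longrightarrow> A f \<in> ell2e"
    and add: "f \<in> ell2e \<Longrightarrow> g \<in> ell2e \<Longrightarrow> A (f + g) = A f + A g"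
    and scale: "f \<in> ell2e \<Longrightarrow> A (cscale c f) = cscale c (A f)"
    and hermitian: "f \<in> ell2e \<Longrightarrow> g \<in> ell2e \<Longrightarrow> ip (A f) g = ip f (A g)"
    and lower_bound: "f \<in> ell2e \<Longrightarrow> nsq f \<le> 1 \<Longrightarrow> - K \<le> qform A f"
    and lsc: "(\<And>n. u n \<in> ell2e) \<Longrightarrow> (\<And>n. nsq (u n) \<le> 1) \<Longrightarrow> f \<in> ell2e \<Longrightarrow>
      (\<And>x. (\<lambda>n. u n x) \<longlonglongrightarrow> f x) \<Longrightarrow> (\<lambda>n. qform A (u n)) \<longlonglongrightarrow> r \<Longrightarrow> qform A f \<le> r"
begin

lemma A_0: "A 0 = 0"
  using scale[OF ell2e_0, of 0] by (simp add: cscale_def zero_fun_def)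

lemma A_sum: "(\<And>i. i \<in> I \<Longrightarrow> f i \<in> ell2e) \<Longrightarrow> A (\<Sum>i\<in>I. f i) = (\<Sum>i\<in>I. A (f i))"
  by (induction I rule: infinite_finite_induct) (auto simp: A_0 add ell2e_sum)

lemma qform_cscale: assumes "f \<in> ell2e" shows "qform A (cscale c f) = (cmod c)\<^sup>2 * qform A f"
proof -
  have "ip (A (cscale c f)) (cscale c f) = of_real ((cmod c)\<^sup>2) * ip (A f) f"
    unfolding complex_norm_square using assms by (simp add: scale ip_cscale_left ip_cscale_right)
  then show ?thesis by (simp only: qform_def Re_complex_of_real times_complex.sel Im_complex_of_real)
qed

lemma qform_add: 
  assumes "f \<in> ell2e" "g \<in> ell2e"
  shows "qform A (f + g) = qform A f + 2 * Re (ip (A f) g) + qform A g"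
proof -
  have "ip (A g) f = cnj (ip (A f) g)" using hermitian[of g f] assms by (simp add: ip_cnj)
  then show ?thesis
    using assms by (simp add: qform_def add ip_add_left ip_add_right maps ell2e_sqsum ell2e_add sqsum_add)
qed

text \<open>The direct method. The minimum is sought over the unit ball because the sphere is not
  weakly closed. Weak limits stay in the ball, even and orthogonal to the \<open>e i\<close>, and
  \<open>lsc\<close> shows that the infimum is attained.\<close>

lemma orthogonal_minimizer:
  assumes e: "\<And>i. i < k \<Longrightarrow> e i \<in> ell2e"
    and f0: "f0 \<in> ell2e" "\<And>i. i < k \<Longrightarrow> ip f0 (e i) = 0" "qform A f0 < 0"
  obtains f where "f \<in> ell2e" "\<And>i. i < k \<Longrightarrow> ip f (e i) = 0" "nsq f = 1" "qform A f < 0"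
    "\<And>g. g \<in> ell2e \<Longrightarrow> (\<And>i. i < k \<Longrightarrow> ip g (e i) = 0) \<Longrightarrow> qform A f * nsq g \<le> qform A g"
proof -
  define C where "C = {f \<in> ell2e. (\<forall>i<k. ip f (e i) = 0) \<and> nsq f \<le> 1}"
  define m where "m = (INF f\<in>C. qform A f)"
  have C0: "0 \<in> C" by (simp add: C_def ell2e_0) (simp add: nsq_def)
  have bdd: "bdd_below (qform A ` C)"
    using lower_bound by (intro bdd_belowI[of _ "- K"]) (auto simp: C_def)
  have normalized: "cscale (of_real (1 / sqrt (nsq g))) g \<in> C \<and>
      qform A g = nsq g * qform A (cscale (of_real (1 / sqrt (nsq g))) g)"
    if g: "g \<in> ell2e" "\<forall>i<k. ip g (e i) = 0" "g \<noteq> 0" for g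
  proof -
    have "nsq g > 0" using g nsq_eq_0[OF ell2e_sqsum[OF g(1)]] by (simp add: less_le)
    then show ?thesis using g
      by (simp add: C_def ell2e_cscale ip_cscale_left nsq_cscale qform_cscale norm_divide power_divide)
  qed
  have f00: "f0 \<noteq> 0" using f0(3) by (auto simp: qform_def)
  have "m \<le> qform A (cscale (of_real (1 / sqrt (nsq f0))) f0)"
    unfolding m_def by (rule cINF_lower[OF bdd]) (use normalized[of f0] f0 f00 in blast)
  moreover have "qform A (cscale (of_real (1 / sqrt (nsq f0))) f0) < 0"
    using normalized[of f0] f0 f00 nsq_nonneg[of f0] by (metis mult_nonneg_nonneg not_less)
  ultimately have m: "m < 0" by simp
  have "\<exists>f\<in>C. qform A f < m + 1 / real (Suc n)" for n
  proof -
    have "m < m + 1 / real (Suc n)" by simp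
    then show ?thesis unfolding m_def using cINF_less_iff[of C "qform A"] C0 bdd by blast
  qed
  then obtain u where u: "\<And>n. u n \<in> C" "\<And>n. qform A (u n) < m + 1 / real (Suc n)" by metis
  have u2: "u n \<in> ell2e" "nsq (u n) \<le> 1" "i < k \<Longrightarrow> ip (u n) (e i) = 0" for n i
    using u(1)[of n] by (auto simp: C_def)
  have "cmod (u n x) \<le> 1" for n x
    using order_trans[OF cmod_sq_le_nsq[OF ell2e_sqsum[OF u2(1)]] u2(2), of n x]
    by (simp add: power_le_one_iff)
  then obtain r f where r: "strict_mono r" and lim: "\<And>x. (\<lambda>n. u (r n) x) \<longlonglongrightarrow> f x"
    using bounded_pointwise_subsequence[of u 1] by blast
  note sub = ell2e_sqsum[OF u2(1)] u2(2) lim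
  have sq: "sqsum f" "nsq f \<le> 1"
    using sqsum_pointwise_limit[OF sub] nsq_pointwise_limit_le[OF sub] by auto
  have "f (- x) = f x" for x
    using LIMSEQ_unique[OF lim[of x]] lim[of "- x"] u2(1) by (auto simp: ell2e_iff even_fun_def)
  then have f: "f \<in> ell2e" using sq by (simp add: ell2e_iff even_fun_def)
  have orth: "ip f (e i) = 0" if "i < k" for i
  proof -
    have "(\<lambda>n. ip (u (r n)) (e i)) \<longlonglongrightarrow> ip f (e i)"
      by (rule ip_pointwise_limit[OF sub ell2e_sqsum[OF e[OF that]]])
    then show ?thesis using that by (simp add: u2(3) LIMSEQ_const_iff)
  qed
  have fC: "f \<in> C" using f orth sq by (simp add: C_def)
  have lb: "m \<le> qform A g" if "g \<in> C" for g unfolding m_def by (rule cINF_lower[OF bdd that])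
  have "(\<lambda>n. qform A (u n)) \<longlonglongrightarrow> m"
  proof (rule tendsto_sandwich[of "\<lambda>_. m" _ _ "\<lambda>n. m + 1 / real (Suc n)"])
    show "(\<lambda>n. m + 1 / real (Suc n)) \<longlonglongrightarrow> m"
      using tendsto_add[OF tendsto_const[of m] LIMSEQ_inverse_real_of_nat] by (simp add: inverse_eq_divide)
    show "eventually (\<lambda>n. qform A (u n) \<le> m + 1 / real (Suc n)) sequentially"
      using u(2) by (intro always_eventually allI less_imp_le)
    show "eventually (\<lambda>n. m \<le> qform A (u n)) sequentially"
      by (intro always_eventually allI lb u(1))
  qed simp
  then have "(\<lambda>n. qform A (u (r n))) \<longlonglongrightarrow> m"
    using LIMSEQ_subseq_LIMSEQ[OF _ r] by (simp add: o_def)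
  then have "qform A f \<le> m" by (rule lsc[OF u2(1) u2(2) f lim])
  with lb[OF fC] have qf: "qform A f = m" by simp
  have min: "m * nsq g \<le> qform A g" if g: "g \<in> ell2e" "\<And>i. i < k \<Longrightarrow> ip g (e i) = 0" for g
  proof (cases "g = 0")
    case True
    then show ?thesis by (simp add: qform_def nsq_def)
  next
    case False
    then have "m \<le> qform A (cscale (of_real (1 / sqrt (nsq g))) g)"
      "qform A g = nsq g * qform A (cscale (of_real (1 / sqrt (nsq g))) g)"
      using normalized[of g] lb g by blast+
    then show ?thesis by (metis mult.commute mult_left_mono nsq_nonneg)
  qed
  \<comment> \<open>Since \<open>m\<close> is negative, this forces \<open>nsq f \<ge> 1\<close>:
    the minimizer lies on the sphere.\<close>
  have "m * nsq f \<le> m * 1" using min[OF f orth] qf by simp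
  then have "nsq f = 1" using m sq(2) by (simp add: mult_le_cancel_left)
  then show ?thesis using that[of f] f orth qf m min by simp
qed

text \<open>The residual \<open>D = A f - m f\<close> is orthogonal to the \<open>e i\<close>,
  because these are eigenvectors orthogonal to \<open>f\<close>. So \<open>f + t D\<close> is an
  admissible variation, whose first-order term is \<open>2 * t * nsq D\<close> while the
  zeroth-order term vanishes; the discriminant criterion forces \<open>nsq D = 0\<close>.\<close>

lemma minimizer_is_eigenvector:
  assumes e: "\<And>i. i < k \<Longrightarrow> e i \<in> ell2e" "\<And>i. i < k \<Longrightarrow> A (e i) = cscale (of_real (l i)) (e i)"
    and f: "f \<in> ell2e" "\<And>i. i < k \<Longrightarrow> ip f (e i) = 0" "nsq f = 1"
    and min: "\<And>g. g \<in> ell2e \<Longrightarrow> (\<And>i. i < k \<Longrightarrow> ip g (e i) = 0) \<Longrightarrow> qform A f * nsq g \<le> qform A g"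
  shows "A f = cscale (of_real (qform A f)) f"
proof -
  define m where "m = qform A f"
  define c where "c = - complex_of_real m"
  define D where "D = A f + cscale c f"
  have D: "D \<in> ell2e" unfolding D_def by (intro ell2e_add ell2e_cscale maps f)
  have Dorth: "ip D (e i) = 0" if "i < k" for i
    using that f e hermitian[of f "e i"]
    by (simp add: D_def ip_add_left maps ell2e_sqsum sqsum_cscale ip_cscale_left ip_cscale_right)
  define b where "b = qform A D - m * nsq D"
  have sqs: "sqsum D" "sqsum f" "sqsum (A f)" using D f maps by (auto intro: ell2e_sqsum)
  have fD: "Re (ip (A f) D) - m * Re (ip f D) = nsq D"
  proof -
    have "ip (A f + cscale c f) D = ip (A f) D + c * ip f D"
      using sqs by (simp add: ip_add_left sqsum_cscale ip_cscale_left)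
    then have "ip D D = ip (A f) D + c * ip f D" unfolding D_def[symmetric] .
    then have "ip D D = ip (A f) D - of_real m * ip f D" by (simp add: c_def)
    then show ?thesis unfolding ip_self by (simp add: complex_eq_iff)
  qed
  have "0 \<le> 0 + 2 * t * nsq D + t\<^sup>2 * b" for t :: real
  proof -
    define g where "g = f + cscale (of_real t) D"
    have tD: "cscale (of_real t) D \<in> ell2e" by (rule ell2e_cscale[OF D])
    have g: "g \<in> ell2e" unfolding g_def by (intro ell2e_add f tD)
    have "ip g (e i) = 0" if "i < k" for i
      using that f(2) Dorth e sqs by (simp add: g_def ip_add_left sqsum_cscale ell2e_sqsum ip_cscale_left)
    then have "m * nsq g \<le> qform A g" unfolding m_def by (rule min[OF g])
    moreover have "nsq g = 1 + 2 * t * Re (ip f D) + t\<^sup>2 * nsq D"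
      unfolding g_def using sqs f by (simp add: nsq_add sqsum_cscale ip_cscale_right nsq_cscale)
    moreover have "qform A g = m + 2 * t * Re (ip (A f) D) + t\<^sup>2 * qform A D"
      unfolding g_def using f D tD by (simp add: qform_add qform_cscale ip_cscale_right m_def)
    ultimately have "0 \<le> 2 * t * (Re (ip (A f) D) - m * Re (ip f D)) + t\<^sup>2 * b"
      by (simp add: algebra_simps b_def)
    then show ?thesis unfolding fD by simp
  qed
  moreover have "0 \<le> b" using min[OF D Dorth] by (simp add: b_def m_def)
  ultimately have "(nsq D)\<^sup>2 \<le> 0 * b" by (rule power2_le_mult_if_quadratic_nonneg)
  then have "nsq D = 0" by simp
  then have "D = 0" using nsq_eq_0[OF sqs(1)] by simp
  show ?thesis
  proof
    fix x
    have "D x = 0" using \<open>D = 0\<close> by simp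
    then show "A f x = cscale (of_real (qform A f)) f x" by (simp add: D_def cscale_def m_def c_def)
  qed
qed

text \<open>Induction on the number of eigenvectors. While \<open>k < N\<close>, some nontrivial
  combination of the negative family is orthogonal to the \<open>k\<close> eigenvectors found; the
  form is negative there, so minimizing over their complement produces the next one.\<close>

lemma neg_family_imp_eigenvectors:
  assumes "neg_family A N"
  obtains e l where "neg_eigenvectors A N e l"
proof -
  obtain b where b: "\<And>i. i < N \<Longrightarrow> b i \<in> ell2e"
      "\<And>c. (\<exists>i<N. c i \<noteq> 0) \<Longrightarrow> qform A (\<Sum>i<N. cscale (c i) (b i)) < 0"
    using assms unfolding neg_family_def by auto
  have "k \<le> N \<Longrightarrow> \<exists>e l. neg_eigenvectors A k e l" for k
  proof (induction k)
    case 0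
    then show ?case by (simp add: neg_eigenvectors_def)
  next
    case (Suc k)
    then obtain e l where el: "neg_eigenvectors A k e l" by auto
    then have e: "\<And>i. i < k \<Longrightarrow> e i \<in> ell2e" "\<And>i. i < k \<Longrightarrow> A (e i) = cscale (of_real (l i)) (e i)"
      by (auto simp: neg_eigenvectors_def)
    obtain c where c: "\<exists>i<N. c i \<noteq> 0" "\<And>j. j < k \<Longrightarrow> (\<Sum>i<N. c i * ip (b i) (e j)) = 0"
      using underdetermined_system[of k N "\<lambda>j i. ip (b i) (e j)"] Suc.prems by auto
    define f0 where "f0 = (\<Sum>i<N. cscale (c i) (b i))"
    have f0: "f0 \<in> ell2e" unfolding f0_def by (intro ell2e_sum ell2e_cscale b) auto
    have "ip f0 (e j) = 0" if "j < k" for j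
    proof -
      have "ip f0 (e j) = (\<Sum>i<N. c i * ip (b i) (e j))"
        unfolding f0_def by (subst ip_sum_left) (use b e(1)[OF that] in \<open>simp_all add: ell2e_cscale ip_cscale_left\<close>)
      then show ?thesis using c(2)[OF that] by simp
    qed
    moreover have "qform A f0 < 0" unfolding f0_def by (rule b(2)[OF c(1)])
    ultimately obtain f where f: "f \<in> ell2e" "\<And>i. i < k \<Longrightarrow> ip f (e i) = 0" "nsq f = 1" "qform A f < 0"
      "\<And>g. g \<in> ell2e \<Longrightarrow> (\<And>i. i < k \<Longrightarrow> ip g (e i) = 0) \<Longrightarrow> qform A f * nsq g \<le> qform A g"
      using orthogonal_minimizer[where e = e and k = k and ?f0.0 = f0, OF e(1) f0] by blast
    have Af: "A f = cscale (of_real (qform A f)) f"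
      by (rule minimizer_is_eigenvector[where e = e and k = k and l = l, OF e f(1-3) f(5)])
    have f': "ip (e i) f = 0" if "i < k" for i using f(2)[OF that] ip_cnj[of f "e i"] by simp
    have "neg_eigenvectors A (Suc k) (e(k := f)) (l(k := qform A f))"
      using el f f' Af by (auto simp: neg_eigenvectors_def less_Suc_eq ip_self)
    then show ?case by blast
  qed
  then show ?thesis using that by blast
qed

text \<open>Sorting the orthonormal vectors by eigenvalue gives independent subsets of the
  eigenspaces, of total size \<open>N\<close>.\<close>

lemma eigenvectors_imp_count:
  assumes "neg_eigenvectors A N e l"
  shows "enat N \<le> eigenvalue_count A {..<0}"
proof -
  define F where "F = l ` {..<N}"
  define B where "B z = e ` {i. i < N \<and> l i = z}" for z
  have e: "e i \<in> ell2e" "A (e i) = cscale (of_real (l i)) (e i)" "l i < 0" if "i < N" for i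
    using assms that by (auto simp: neg_eigenvectors_def)
  have orth: "ip (e i) (e j) = (if i = j then 1 else 0)" if "i < N" "j < N" for i j
    using assms that by (auto simp: neg_eigenvectors_def)
  have inj: "inj_on e {..<N}"
    by (rule inj_onI) (metis lessThan_iff orth zero_neq_one)
  have ind: "cfun.independent (e ` I)" if I: "I \<subseteq> {..<N}" for I
    unfolding cfun.dependent_finite[OF finite_imageI[OF finite_subset[OF I finite_lessThan]]]
  proof (safe)
    fix u i assume u: "(\<Sum>v\<in>e ` I. cscale (u v) v) = 0" and i: "i \<in> I" "u (e i) \<noteq> 0"
    have fin: "finite I" using I finite_subset by blast
    have "(\<Sum>j\<in>I. cscale (u (e j)) (e j)) = 0"
      using u by (simp add: sum.reindex[OF inj_on_subset[OF inj I]])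
    then have "0 = ip (\<Sum>j\<in>I. cscale (u (e j)) (e j)) (e i)" by simp
    also have "\<dots> = (\<Sum>j\<in>I. u (e j) * ip (e j) (e i))"
      using I i e(1) by (subst ip_sum_left) (auto simp: ell2e_cscale ip_cscale_left subset_iff)
    also have "\<dots> = (\<Sum>j\<in>I. u (e j) * (if j = i then 1 else 0))"
    proof (rule sum.cong[OF refl])
      fix j assume "j \<in> I"
      then show "u (e j) * ip (e j) (e i) = u (e j) * (if j = i then 1 else 0)"
        using orth[of j i] subsetD[OF I, of j] subsetD[OF I, of i] i(1) by simp
    qed
    also have "\<dots> = u (e i)" using fin i by (simp add: if_distrib cong: if_cong)
    finally show False using i by simp
  qed
  have "enat (card (B z)) \<le> cdimension (eigenspace A z)" for z
    unfolding cdimension_def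
  proof (rule SUP_upper, safe)
    show "finite (B z)" by (simp add: B_def)
    show "x \<in> eigenspace A z" if "x \<in> B z" for x using that e by (auto simp: B_def eigenspace_def)
    assume "cfun.dependent (B z)"
    then show False using ind[of "{i. i < N \<and> l i = z}"] by (auto simp: B_def)
  qed
  then have "(\<Sum>z\<in>F. enat (card (B z))) \<le> (\<Sum>z\<in>F. cdimension (eigenspace A z))" by (rule sum_mono)
  moreover have "(\<Sum>z\<in>F. enat (card (B z))) = enat N"
  proof -
    have "card (B z) = card {i. i < N \<and> l i = z}" for z
      unfolding B_def by (rule card_image) (auto intro: inj_on_subset[OF inj])
    moreover have "(\<Sum>z\<in>F. card {i. i < N \<and> l i = z}) = N"
      using sum.group[of "{..<N}" F l "\<lambda>_. 1 :: nat"] by (simp add: F_def)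
    ultimately show ?thesis by (simp add: sum_enat)
  qed
  ultimately have "enat N \<le> (\<Sum>z\<in>F. cdimension (eigenspace A z))" by simp
  also have "\<dots> \<le> eigenvalue_count A {..<0}"
    unfolding eigenvalue_count_def by (rule SUP_upper) (use e in \<open>auto simp: F_def\<close>)
  finally show ?thesis .
qed

lemma eigenvectors_orthogonal:
  assumes "f \<in> eigenspace A z" "g \<in> eigenspace A z'" "z \<noteq> z'"
  shows "ip f g = 0"
proof -
  have "of_real z * ip f g = of_real z' * ip f g"
    using assms hermitian[of f g] by (simp add: eigenspace_def ip_cscale_left ip_cscale_right)
  then show ?thesis using assms(3) by (simp add: mult_cancel_right)
qed

lemma eigenspace_sum:
  assumes "\<And>i. i \<in> I \<Longrightarrow> f i \<in> eigenspace A z"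
  shows "(\<Sum>i\<in>I. cscale (c i) (f i)) \<in> eigenspace A z"
proof -
  have f: "f i \<in> ell2e" "A (f i) = cscale (of_real z) (f i)" if "i \<in> I" for i
    using assms that by (auto simp: eigenspace_def)
  have "A (\<Sum>i\<in>I. cscale (c i) (f i)) = (\<Sum>i\<in>I. cscale (of_real z) (cscale (c i) (f i)))"
    using f by (simp add: A_sum ell2e_cscale scale mult.commute)
  then show ?thesis
    using f by (auto simp: eigenspace_def ell2e_sum ell2e_cscale cfun.scale_sum_right)
qed

text \<open>Bases of finitely many eigenspaces are concatenated. Eigenspaces of different
  eigenvalues are orthogonal, so the form of a combination is the sum of
  \<open>z * nsq (g z)\<close> over its components \<open>g z\<close>, and some component is
  nonzero.\<close>

lemma count_imp_neg_family:
  assumes "enat N \<le> eigenvalue_count A {..<0}"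
  shows "neg_family A N"
proof (cases "N = 0")
  case True
  then show ?thesis by (simp add: neg_family_def)
next
  case False
  then obtain M where M: "N = Suc M" by (cases N) auto
  \<comment> \<open>A strict inequality below a supremum provides a witness, hence the passage from
    \<open>N\<close> to its predecessor.\<close>
  have "enat M < eigenvalue_count A {..<0}" using assms M by (simp add: Suc_ile_eq)
  then obtain F where F: "finite F" "F \<subseteq> {..<0}" "enat M < (\<Sum>z\<in>F. cdimension (eigenspace A z))"
    unfolding eigenvalue_count_def less_SUP_iff by auto
  \<comment> \<open>If one eigenspace is infinite-dimensional, it supplies all vectors alone;
    otherwise every supremum in \<open>cdimension\<close> is attained.\<close>
  have "\<exists>B. (\<forall>z\<in>F. B z \<subseteq> eigenspace A z \<and> finite (B z) \<and> cfun.independent (B z)) \<and> N \<le> (\<Sum>z\<in>F. card (B z))"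
  proof (cases "\<exists>z\<in>F. cdimension (eigenspace A z) = \<infinity>")
    case True
    then obtain z where z: "z \<in> F" "cdimension (eigenspace A z) = \<infinity>" by auto
    then have "enat M < cdimension (eigenspace A z)" by simp
    then obtain B where B: "B \<subseteq> eigenspace A z" "finite B" "cfun.independent B" "M < card B"
      unfolding cdimension_def less_SUP_iff by auto
    show ?thesis
    proof (intro exI[of _ "\<lambda>z'. if z' = z then B else {}"] conjI)
      show "N \<le> (\<Sum>z'\<in>F. card (if z' = z then B else {}))"
        using B(4) z(1) F(1) M by (simp add: if_distrib cong: if_cong)
    qed (use B in \<open>auto simp: cfun.independent_empty\<close>)
  next
    case False
    have "\<exists>B. B \<subseteq> eigenspace A z \<and> finite B \<and> cfun.independent B \<and> cdimension (eigenspace A z) = enat (card B)" if "z \<in> F" for z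
    proof -
      have "cdimension (eigenspace A z) \<noteq> \<infinity>" by (rule contrapos_nn[OF False]) (rule bexI[OF _ that])
      then obtain d where d: "cdimension (eigenspace A z) = enat d" unfolding not_infinity_eq by (elim exE)
      show ?thesis
      proof (cases d)
        case 0
        with d show ?thesis by (intro exI[of _ "{}"]) (auto simp: cfun.independent_empty zero_enat_def)
      next
        case (Suc d')
        then have "enat d' < cdimension (eigenspace A z)" using d by simp
        then obtain B where B: "B \<subseteq> eigenspace A z" "finite B" "cfun.independent B" "d' < card B"
          unfolding cdimension_def less_SUP_iff by auto
        have "enat (card B) \<le> cdimension (eigenspace A z)"
          unfolding cdimension_def by (rule SUP_upper) (use B in auto)
        then have "card B = d" using B(4) d Suc by simp
        with B d show ?thesis by auto
      qed
    qed
    then obtain B where B: "\<And>z. z \<in> F \<Longrightarrow> B z \<subseteq> eigenspace A z \<and> finite (B z) \<and> cfun.independent (B z) \<and>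
        cdimension (eigenspace A z) = enat (card (B z))" by metis
    have "(\<Sum>z\<in>F. cdimension (eigenspace A z)) = (\<Sum>z\<in>F. enat (card (B z)))" by (rule sum.cong) (use B in auto)
    also have "\<dots> = enat (\<Sum>z\<in>F. card (B z))" by (rule sum_enat)
    finally have "N \<le> (\<Sum>z\<in>F. card (B z))" using F(3) M by simp
    with B show ?thesis by blast
  qed
  then obtain B where B: "\<And>z. z \<in> F \<Longrightarrow> B z \<subseteq> eigenspace A z" "\<And>z. z \<in> F \<Longrightarrow> finite (B z)"
      "\<And>z. z \<in> F \<Longrightarrow> cfun.independent (B z)" "N \<le> (\<Sum>z\<in>F. card (B z))" by blast
  define S where "S = Sigma F B"
  have S: "finite S" "card S = (\<Sum>z\<in>F. card (B z))" unfolding S_def using F(1) B(2) by auto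
  obtain p where p: "bij_betw p {..<card S} S" using ex_bij_betw_nat_finite[OF S(1)] by (auto simp: atLeast0LessThan)
  have pS: "p i \<in> S" if "i < N" for i using bij_betwE[OF p] that B(4) S(2) by auto
  have eig: "snd (p i) \<in> eigenspace A (fst (p i))" "fst (p i) \<in> F" "snd (p i) \<in> B (fst (p i))" if "i < N" for i
    using pS[OF that] subsetD[OF B(1), of "fst (p i)" "snd (p i)"] by (auto simp: S_def)
  have pinj: "inj_on p {..<N}"
    using p B(4) S(2) by (auto simp: bij_betw_def intro: inj_on_subset)
  show ?thesis unfolding neg_family_def
  proof (intro exI[of _ "\<lambda>i. snd (p i)"] conjI allI impI)
    show "snd (p i) \<in> ell2e" if "i < N" for i using eig(1)[OF that] by (simp add: eigenspace_def)
    fix c :: "nat \<Rightarrow> complex" assume c: "\<exists>i<N. c i \<noteq> 0"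
    define I where "I z = {i. i < N \<and> fst (p i) = z}" for z
    define g where "g z = (\<Sum>i\<in>I z. cscale (c i) (snd (p i)))" for z
    have g: "g z \<in> eigenspace A z" for z
      unfolding g_def by (rule eigenspace_sum) (use eig in \<open>auto simp: I_def\<close>)
    have gl: "g z \<in> ell2e" "A (g z) = cscale (of_real z) (g z)" for z using g[of z] by (auto simp: eigenspace_def)
    have tot: "(\<Sum>i<N. cscale (c i) (snd (p i))) = (\<Sum>z\<in>F. g z)"
      unfolding g_def I_def
      using sum.group[of "{..<N}" F "\<lambda>i. fst (p i)" "\<lambda>i. cscale (c i) (snd (p i))"] F(1) eig(2)
      by (simp add: image_subset_iff)
    \<comment> \<open>The double sum collapses to its diagonal by orthogonality.\<close>
    have "ip (A (\<Sum>z\<in>F. g z)) (\<Sum>z\<in>F. g z) = (\<Sum>z\<in>F. \<Sum>z'\<in>F. ip (A (g z)) (g z'))"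
      unfolding A_sum[OF gl(1)]
      by (subst ip_sum_left, rule maps[OF gl(1)], rule ell2e_sum[OF gl(1)], rule sum.cong[OF refl])
        (rule ip_sum_right[OF gl(1) maps[OF gl(1)]])
    also have "\<dots> = (\<Sum>z\<in>F. \<Sum>z'\<in>F. if z' = z then of_real (z * nsq (g z)) else 0)"
      by (intro sum.cong refl) (use eigenvectors_orthogonal[OF g g] gl(2) in \<open>auto simp: ip_cscale_left ip_self\<close>)
    also have "\<dots> = of_real (\<Sum>z\<in>F. z * nsq (g z))" using F(1) by simp
    finally have q: "qform A (\<Sum>i<N. cscale (c i) (snd (p i))) = (\<Sum>z\<in>F. z * nsq (g z))"
      unfolding tot qform_def by simp
    obtain i where i: "i < N" "c i \<noteq> 0" using c by auto
    define z where "z = fst (p i)"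
    have "g z \<noteq> 0"
    proof
      assume g0: "g z = 0"
      have inj: "inj_on (\<lambda>i. snd (p i)) (I z)"
        using pinj by (auto simp: inj_on_def I_def prod_eq_iff)
      have fin: "finite ((\<lambda>i. snd (p i)) ` I z)" by (simp add: I_def)
      have "cfun.independent ((\<lambda>i. snd (p i)) ` I z)"
      proof (rule cfun.independent_mono[OF B(3)])
        show "z \<in> F" using eig(2)[OF i(1)] by (simp add: z_def)
        show "(\<lambda>i. snd (p i)) ` I z \<subseteq> B z"
          by (rule image_subsetI) (metis (mono_tags, lifting) I_def eig(3) mem_Collect_eq)
      qed
      moreover define u where "u v = c (the_inv_into (I z) (\<lambda>i. snd (p i)) v)" for v
      have u: "u (snd (p j)) = c j" if "j \<in> I z" for j
        unfolding u_def by (subst the_inv_into_f_f[OF inj that]) simp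
      have "(\<Sum>v\<in>(\<lambda>i. snd (p i)) ` I z. cscale (u v) v) = 0"
        using g0 u by (simp add: sum.reindex[OF inj] g_def)
      moreover have iz: "i \<in> I z" using i by (simp add: I_def z_def)
      moreover have "u (snd (p i)) \<noteq> 0" using u[OF iz] i(2) by simp
      ultimately have "cfun.dependent ((\<lambda>i. snd (p i)) ` I z)"
        unfolding cfun.dependent_finite[OF fin] by blast
      with \<open>cfun.independent _\<close> show False by contradiction
    qed
    then have "nsq (g z) > 0" using nsq_eq_0[OF ell2e_sqsum[OF gl(1)[of z]]] by (simp add: less_le)
    moreover have zF: "z \<in> F" "z < 0" using eig(2)[OF i(1)] F(2) by (auto simp: z_def)
    ultimately have "z * nsq (g z) < 0" by (simp add: mult_neg_pos)
    moreover have "z' * nsq (g z') \<le> 0" if "z' \<in> F" for z' using F(2) that by (auto intro!: mult_nonpos_nonneg)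
    ultimately have "(\<Sum>z\<in>F. z * nsq (g z)) < (\<Sum>z\<in>F. 0)"
      by (intro sum_strict_mono_ex1[OF F(1)]) (use zF in auto)
    then show "qform A (\<Sum>i<N. cscale (c i) (snd (p i))) < 0" unfolding q by simp
  qed
qed

theorem count_iff_neg_family: "enat N \<le> eigenvalue_count A {..<0} \<longleftrightarrow> neg_family A N"
  using neg_family_imp_eigenvectors eigenvectors_imp_count count_imp_neg_family by metis

end

text \<open>Brings both counts to the threshold 0: \<open>H\<close> is the shift of
  \<open>H'\<close> by the bottom of the spectrum, and the Birman-Schwinger operator is the
  reflection \<open>1 - B'\<close>.\<close>

lemma eigenvalue_count_affine:
  fixes A :: "(int ^ 'n \<Rightarrow> complex) \<Rightarrow> (int ^ 'n \<Rightarrow> complex)"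
  assumes "b \<noteq> 0"
  shows "eigenvalue_count (\<lambda>f. cscale (of_real a) f + cscale (of_real b) (A f)) ((\<lambda>z. a + b * z) ` S) = eigenvalue_count A S"
    (is "eigenvalue_count ?A' (?h ` S) = _")
proof -
  have inj: "inj ?h" using assms by (auto simp: inj_on_def)
  have eig: "eigenspace ?A' (?h z) = eigenspace A z" for z
  proof -
    have "?A' f = cscale (of_real (?h z)) f \<longleftrightarrow> A f = cscale (of_real z) f" for f
      using assms by (auto simp: fun_eq_iff cscale_def algebra_simps)
    then show ?thesis by (simp add: eigenspace_def)
  qed
  have "{F. finite F \<and> F \<subseteq> ?h ` S} = (`) ?h ` {F. finite F \<and> F \<subseteq> S}"
  proof (intro equalityI subsetI)
    fix G assume "G \<in> {F. finite F \<and> F \<subseteq> ?h ` S}"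
    then obtain F where "F \<subseteq> S" "finite F" "G = ?h ` F" using finite_subset_image[of G ?h S] by auto
    then show "G \<in> (`) ?h ` {F. finite F \<and> F \<subseteq> S}" by blast
  qed blast
  then show ?thesis
    unfolding eigenvalue_count_def
    by (simp add: image_image sum.reindex[OF inj_on_subset[OF inj subset_UNIV]] eig)
qed

section \<open>Uniqueness for convolution equations in the space of null sequences\<close>

lemma null_sequence_bounded:
  fixes h :: "'a \<Rightarrow> complex"
  assumes "(h \<longlongrightarrow> 0) cofinite"
  obtains M where "M > 0" and "\<And>x. cmod (h x) \<le> M"
proof -
  have "eventually (\<lambda>x. dist (h x) 0 < 1) cofinite" using assms by (rule tendstoD) simp
  then have fin: "finite {x. \<not> cmod (h x) < 1}" by (simp add: eventually_cofinite)
  define M where "M = 1 + (\<Sum>x | \<not> cmod (h x) < 1. cmod (h x))"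
  show thesis
  proof (rule that)
    show "M > 0" unfolding M_def by (intro add_pos_nonneg sum_nonneg) auto
    show "cmod (h x) \<le> M" for x
    proof (cases "cmod (h x) < 1")
      case True
      moreover have "1 \<le> M" unfolding M_def by (simp add: sum_nonneg)
      ultimately show ?thesis by simp
    next
      case False
      then have "cmod (h x) \<le> (\<Sum>x | \<not> cmod (h x) < 1. cmod (h x))"
        by (intro member_le_sum) (use fin in auto)
      then show ?thesis by (simp add: M_def)
    qed
  qed
qed

section \<open>Bounded test functions with prescribed support\<close>

text \<open>The bound \<open>c\<close> and the support \<open>P\<close> are carried together because
  modulation preserves both, and freezing a modulation on a small set only shrinks \<open>c\<close>.
  Square integrability of the test functions follows.\<close>

definition bdd_on :: "real \<Rightarrow> 'a set \<Rightarrow> ('a :: topological_space \<Rightarrow> complex) \<Rightarrow> bool" where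
  "bdd_on c P f \<longleftrightarrow> f \<in> borel_measurable borel \<and> (\<forall>p. cmod (f p) \<le> c * indicator P p)"

lemma bdd_on_integrable:
  fixes f :: "real ^ 'n::finite \<Rightarrow> complex"
  assumes "bdd_on c P f" and "0 \<le> c"
  shows "integrable haar f" "integrable haar (\<lambda>q. (cmod (f q))\<^sup>2)" "f \<in> borel_measurable borel"
    "sqsum (ft f)" "nsq (ft f) \<le> c\<^sup>2"
proof -
  show [measurable]: "f \<in> borel_measurable borel" using assms by (simp add: bdd_on_def)
  have "c * indicator P p \<le> c" for p using assms(2) by (simp add: indicator_def)
  then have le: "cmod (f p) \<le> c" for p using assms(1) unfolding bdd_on_def by (meson order_trans)
  show "integrable haar f" by (rule haar.integrable_const_bound[of _ c]) (use le in auto)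
  show sq: "integrable haar (\<lambda>q. (cmod (f q))\<^sup>2)"
    by (rule haar.integrable_const_bound[of _ "c\<^sup>2"]) (simp_all add: power_mono[OF le])
  show "sqsum (ft f)" unfolding sqsum_def by (rule integrable_ft_square[OF _ sq]) simp
  have "nsq (ft f) \<le> (\<integral>q. (cmod (f q))\<^sup>2 \<partial>haar)" unfolding nsq_def by (rule bessel_inequality[OF _ sq]) simp
  also have "\<dots> \<le> (\<integral>q. c\<^sup>2 \<partial>(haar :: (real ^ 'n) measure))"
    by (rule integral_mono) (use sq in \<open>simp_all add: power_mono[OF le]\<close>)
  finally show "nsq (ft f) \<le> c\<^sup>2" by simp
qed

lemma bdd_on_indicator: "P \<in> sets borel \<Longrightarrow> bdd_on 1 P (indicator P)"
  by (auto simp: bdd_on_def indicator_def)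

lemma bdd_on_cis: "bdd_on c P f \<Longrightarrow> bdd_on c P (\<lambda>q. cis (pairing q s) * f q)" for f :: "real ^ 'n \<Rightarrow> complex"
  unfolding bdd_on_def by (intro conjI; simp add: norm_mult borel_measurable_times)

lemma bdd_on_cmult: "bdd_on c P f \<Longrightarrow> cmod a \<le> d \<Longrightarrow> bdd_on (d * c) P (\<lambda>q. a * f q)"
  unfolding bdd_on_def by (auto simp: norm_mult mult.assoc intro!: mult_mono order_trans[OF norm_ge_zero])

lemma bdd_on_cis_diff:
  fixes f :: "real ^ 'n \<Rightarrow> complex"
  assumes f: "bdd_on 1 P f" and "\<And>p. p \<in> P \<Longrightarrow> cmod (cis (pairing p0 s) - cis (pairing p s)) \<le> \<kappa>" and "0 \<le> \<kappa>"
  shows "bdd_on \<kappa> P (\<lambda>q. cis (pairing p0 s) * f q - cis (pairing q s) * f q)"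
  unfolding bdd_on_def
proof (intro conjI allI)
  have [measurable]: "f \<in> borel_measurable borel" using f by (simp add: bdd_on_def)
  show "(\<lambda>q. cis (pairing p0 s) * f q - cis (pairing q s) * f q) \<in> borel_measurable borel" by measurable
  fix p
  have "cmod (cis (pairing p0 s) * f p - cis (pairing p s) * f p) = cmod (cis (pairing p0 s) - cis (pairing p s)) * cmod (f p)"
    by (simp add: norm_mult[symmetric] left_diff_distrib)
  also have "\<dots> \<le> \<kappa> * indicator P p"
  proof (cases "p \<in> P")
    case True
    then have "cmod (f p) \<le> 1" using f by (auto simp: bdd_on_def dest: spec[of _ p])
    then show ?thesis using assms(2)[OF True] True mult_mono[of _ \<kappa> "cmod (f p)" 1] assms(3) by simp
  next
    case False
    then have "f p = 0" using f by (auto simp: bdd_on_def dest: spec[of _ p])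
    then show ?thesis using False by simp
  qed
  finally show "cmod (cis (pairing p0 s) * f p - cis (pairing p s) * f p) \<le> \<kappa> * indicator P p" .
qed

lemma cmod_cis_diff_le: "cmod (cis a - cis b) \<le> \<bar>a - b\<bar>"
proof -
  have "cis a - cis b = cis b * (cis (a - b) - 1)" by (simp add: algebra_simps cis_mult)
  then have "cmod (cis a - cis b) = cmod (exp (\<i> * of_real (a - b)) - 1)"
    by (simp add: norm_mult cis_conv_exp)
  also have "\<dots> = 2 * \<bar>sin ((a - b) / 2)\<bar>" by (rule dist_exp_i_1)
  also have "\<dots> \<le> \<bar>a - b\<bar>" using abs_sin_x_le_abs_x[of "(a - b) / 2"] by simp
  finally show ?thesis .
qed

section \<open>Subdivision of the torus into a grid of boxes\<close>

definition box_index :: "nat \<Rightarrow> ('n \<Rightarrow> nat) set" where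
  "box_index N = {i. \<forall>j. i j < N}"

text \<open>Half-open boxes partition the torus exactly; the closed versions \<open>gcbox\<close>
  provide compactness.\<close>

definition gbox :: "nat \<Rightarrow> ('n \<Rightarrow> nat) \<Rightarrow> (real ^ 'n) set" where
  "gbox N i = {p. \<forall>j. - pi + 2 * pi * real (i j) / real N \<le> p $ j \<and> p $ j < - pi + 2 * pi * (real (i j) + 1) / real N}"

definition gcbox :: "nat \<Rightarrow> ('n \<Rightarrow> nat) \<Rightarrow> (real ^ 'n) set" where
  "gcbox N i = cbox (\<chi> j. - pi + 2 * pi * real (i j) / real N) (\<chi> j. - pi + 2 * pi * (real (i j) + 1) / real N)"

lemma box_index_PiE: "box_index N = (PiE UNIV (\<lambda>_ :: 'n::finite. {..<N}))"
  by (auto simp: box_index_def PiE_def Pi_def)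

lemma finite_box_index [simp]: "finite (box_index N :: ('n::finite \<Rightarrow> nat) set)"
  unfolding box_index_PiE by (rule finite_PiE) auto

lemma card_box_index: "card (box_index N :: ('n::finite \<Rightarrow> nat) set) = N ^ CARD('n)"
  unfolding box_index_PiE by (subst card_PiE) auto

lemma gbox_subset_gcbox: "gbox N i \<subseteq> gcbox N i"
  by (auto simp: gbox_def gcbox_def mem_box_cart less_imp_le)

lemma gbox_borel [measurable]: "(gbox N i :: (real ^ 'n::finite) set) \<in> sets borel"
proof -
  have "(gbox N i :: (real ^ 'n) set) = (\<Inter>j. {p. - pi + 2 * pi * real (i j) / real N \<le> p $ j} \<inter>
      {p. p $ j < - pi + 2 * pi * (real (i j) + 1) / real N})" by (auto simp: gbox_def)
  also have "\<dots> \<in> sets borel"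
    by (intro sets.countable_INT'') (auto intro!: borel_closed borel_open closed_Collect_le open_Collect_less continuous_intros)
  finally show ?thesis .
qed

lemma gbox_subset_torus:
  assumes "i \<in> box_index N" shows "gbox N i \<subseteq> torus"
proof
  fix p assume p: "p \<in> gbox N i"
  have "- pi \<le> p $ j \<and> p $ j < pi" for j
  proof
    have ij: "i j < N" using assms by (simp add: box_index_def)
    have "0 \<le> 2 * pi * real (i j) / real N" by simp
    then show "- pi \<le> p $ j" using p unfolding gbox_def by (smt (verit) mem_Collect_eq)
    have "2 * pi * ((real (i j) + 1) / real N) \<le> 2 * pi * 1"
      using ij by (intro mult_left_mono) (auto simp: divide_le_eq)
    then show "p $ j < pi" using p unfolding gbox_def by (smt (verit) mem_Collect_eq times_divide_eq_right)
  qed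
  then show "p \<in> torus" by (simp add: torus_def)
qed

lemma torus_gbox_unique:
  fixes p :: "real ^ 'n::finite"
  assumes p: "p \<in> torus" and N: "N > 0"
  shows "\<exists>i\<in>box_index N. \<forall>i'\<in>box_index N. p \<in> gbox N i' \<longleftrightarrow> i' = i"
proof -
  define x where "x j = (p $ j + pi) * real N / (2 * pi)" for j
  have x: "0 \<le> x j" "x j < real N" for j
  proof -
    have pj: "- pi \<le> p $ j" "p $ j < pi" using p by (auto simp: torus_def)
    show "0 \<le> x j" using pj by (simp add: x_def)
    have "(p $ j + pi) * real N < (2 * pi) * real N" using pj N by (intro mult_strict_right_mono) auto
    then show "x j < real N" using pi_gt_zero by (simp add: x_def divide_less_eq mult.commute)
  qed
  define i where "i j = nat \<lfloor>x j\<rfloor>" for j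
  have mem: "p \<in> gbox N i' \<longleftrightarrow> (\<forall>j. real (i' j) \<le> x j \<and> x j < real (i' j) + 1)" for i'
  proof -
    have "(- pi + 2 * pi * real (i' j) / real N \<le> p $ j) = (real (i' j) \<le> x j)"
      "(p $ j < - pi + 2 * pi * (real (i' j) + 1) / real N) = (x j < real (i' j) + 1)" for j
      using N pi_gt_zero by (simp_all add: x_def field_simps)
    then show ?thesis by (simp add: gbox_def)
  qed
  have "i \<in> box_index N"
    unfolding box_index_def i_def using x by (auto simp: nat_less_iff floor_less_iff)
  moreover have "p \<in> gbox N i' \<longleftrightarrow> i' = i" for i'
  proof
    assume "p \<in> gbox N i'"
    then have "\<lfloor>x j\<rfloor> = int (i' j)" for j unfolding mem by (auto simp: floor_eq_iff)
    then show "i' = i" by (auto simp: i_def)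
  next
    assume "i' = i"
    then show "p \<in> gbox N i'" unfolding mem i_def using x(1) by (auto simp: of_nat_nat)
  qed
  ultimately show ?thesis by blast
qed

lemma indicator_gbox_sum:
  assumes "P \<subseteq> torus" "N > 0"
  shows "(indicator P p :: complex) = (\<Sum>i\<in>box_index N. indicator (P \<inter> gbox N i) (p :: real ^ 'n::finite))"
proof (cases "p \<in> P")
  case True
  then obtain i where i: "i \<in> box_index N" "\<And>i'. i' \<in> box_index N \<Longrightarrow> p \<in> gbox N i' \<longleftrightarrow> i' = i"
    using torus_gbox_unique[of p N] assms by blast
  have "(\<Sum>i'\<in>box_index N. indicator (P \<inter> gbox N i') p :: complex) = (\<Sum>i'\<in>box_index N. if i' = i then 1 else 0)"
    by (rule sum.cong) (use True i in \<open>auto simp: indicator_def\<close>)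
  then show ?thesis using i True by simp
qed auto

lemma measure_haar_gbox:
  assumes "i \<in> box_index N" "N > 0"
  shows "measure haar (gbox N i :: (real ^ 'n::finite) set) \<le> 1 / real N ^ CARD('n)"
proof -
  let ?B = "gbox N i :: (real ^ 'n) set" and ?C = "gcbox N i :: (real ^ 'n) set"
  have le: "0 \<le> 2 * pi * (1 / real N)" by simp
  have "emeasure haar ?B = (\<integral>\<^sup>+p. ennreal (indicator torus p / (2 * pi) ^ CARD('n)) * indicator ?B p \<partial>lborel)"
    unfolding haar_def by (subst emeasure_density) auto
  also have "\<dots> \<le> (\<integral>\<^sup>+p. ennreal (1 / (2 * pi) ^ CARD('n)) * indicator ?C p \<partial>lborel)"
    by (rule nn_integral_mono)
      (use gbox_subset_gcbox[of N i] in \<open>auto simp: indicator_def intro!: ennreal_leI\<close>)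
  also have "\<dots> = ennreal (1 / (2 * pi) ^ CARD('n)) * emeasure lborel ?C"
    by (rule nn_integral_cmult_indicator) (simp add: gcbox_def)
  also have "emeasure lborel ?C = ennreal (measure lborel ?C)"
    unfolding gcbox_def by (rule emeasure_eq_ennreal_measure) (use emeasure_lborel_cbox_finite in \<open>metis less_irrefl infinity_ennreal_def\<close>)
  also have "measure lborel ?C = (2 * pi / real N) ^ CARD('n)"
  proof -
    have ne: "cbox (\<chi> j. - pi + 2 * pi * real (i j) / real N) (\<chi> j. - pi + 2 * pi * (real (i j) + 1) / real N) \<noteq> ({} :: (real ^ 'n) set)"
      by (simp add: interval_ne_empty_cart divide_right_mono)
    have eq: "(- pi + 2 * pi * (real (i j) + 1) / real N) - (- pi + 2 * pi * real (i j) / real N) = 2 * pi / real N" for j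
      by (simp add: add_divide_distrib distrib_left)
    show ?thesis unfolding gcbox_def content_cbox_cart[OF ne] by (simp only: vec_lambda_beta eq prod_constant)
  qed
  also have "ennreal (1 / (2 * pi) ^ CARD('n)) * ennreal ((2 * pi / real N) ^ CARD('n)) = ennreal (1 / real N ^ CARD('n))"
    using pi_gt_zero by (subst ennreal_mult[symmetric]) (auto simp: power_divide power_mult_distrib)
  finally have "emeasure haar ?B \<le> ennreal (1 / real N ^ CARD('n))" .
  then show ?thesis unfolding measure_def by (intro enn2real_leI) auto
qed

lemma card_nat_near: "card {m :: nat. \<bar>real m - c\<bar> \<le> 1} \<le> 3" "finite {m :: nat. \<bar>real m - c\<bar> \<le> 1}"
proof -
  have sub: "{m :: nat. \<bar>real m - c\<bar> \<le> 1} \<subseteq> nat ` {\<lceil>c - 1\<rceil>..\<lceil>c - 1\<rceil> + 2}"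
  proof
    fix m :: nat assume "m \<in> {m. \<bar>real m - c\<bar> \<le> 1}"
    then have "int m \<in> {\<lceil>c - 1\<rceil>..\<lceil>c - 1\<rceil> + 2}" by (auto simp: abs_le_iff) linarith+
    then show "m \<in> nat ` {\<lceil>c - 1\<rceil>..\<lceil>c - 1\<rceil> + 2}" by (metis image_eqI nat_int)
  qed
  then show "finite {m :: nat. \<bar>real m - c\<bar> \<le> 1}" by (rule finite_subset) auto
  have "card {m :: nat. \<bar>real m - c\<bar> \<le> 1} \<le> card (nat ` {\<lceil>c - 1\<rceil>..\<lceil>c - 1\<rceil> + 2})"
    by (rule card_mono[OF _ sub]) auto
  also have "\<dots> \<le> card {\<lceil>c - 1\<rceil>..\<lceil>c - 1\<rceil> + 2}" by (rule card_image_le) auto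
  finally show "card {m :: nat. \<bar>real m - c\<bar> \<le> 1} \<le> 3" by simp
qed

section \<open>The form attached to a null sequence annihilated by a convolution\<close>

text \<open>Formally \<open>h\<close> is the coefficient sequence of a pseudofunction
  \<open>u\<close> on the torus, and \<open>conv\<close> says that
  \<open>symbol * u = 0\<close>.\<close>

locale null_convolution =
  fixes b h :: "int ^ 'n::finite \<Rightarrow> complex"
  assumes b: "integrable counting b"
    and h: "(h \<longlongrightarrow> 0) cofinite"
    and conv: "\<And>x. (\<integral>s. b s * h (x - s) \<partial>counting) = 0"
begin

definition symbol :: "real ^ 'n \<Rightarrow> complex" where
  "symbol p = (\<integral>s. b s * cis (pairing p s) \<partial>counting)"

text \<open>Formally the double integral of \<open>u (p - q) * f p * cnj (g q)\<close>, where
  \<open>u\<close> is the series with coefficients \<open>h\<close>. The sum converges absolutely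
  since \<open>h\<close> is bounded and both transforms are square-summable.\<close>

definition T :: "(real ^ 'n \<Rightarrow> complex) \<Rightarrow> (real ^ 'n \<Rightarrow> complex) \<Rightarrow> complex" where
  "T f g = (\<integral>x. h x * (ft f x * cnj (ft g x)) \<partial>counting)"

definition bnd :: real where "bnd = (SOME M. M > 0 \<and> (\<forall>x. cmod (h x) \<le> M))"

lemma bnd: "bnd > 0" "cmod (h x) \<le> bnd"
proof -
  have "\<exists>M. M > 0 \<and> (\<forall>x. cmod (h x) \<le> M)" using null_sequence_bounded[OF h] by metis
  from someI_ex[OF this] show "bnd > 0" "cmod (h x) \<le> bnd" unfolding bnd_def by auto
qed

lemma T_integrable:
  assumes "sqsum F" "sqsum G"
  shows "integrable counting (\<lambda>x. h x * (F x * cnj (G x)))"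
proof (rule integrable_counting_bound)
  show "integrable counting (\<lambda>x. bnd *\<^sub>R (cmod (F x) * cmod (G x)))" using sqsum_mult(1)[OF assms] by simp
  show "norm (h x * (F x * cnj (G x))) \<le> norm (bnd *\<^sub>R (cmod (F x) * cmod (G x)))" for x
    using bnd by (simp add: norm_mult mult_right_mono)
qed

lemma norm_T_le:
  assumes "bdd_on c P f" "bdd_on d Q g" "0 \<le> c" "0 \<le> d"
  shows "cmod (T f g) \<le> bnd * (c\<^sup>2 + d\<^sup>2)"
proof -
  note f = bdd_on_integrable[OF assms(1,3)] and g = bdd_on_integrable[OF assms(2,4)]
  have i: "integrable counting (\<lambda>x. (cmod (ft f x))\<^sup>2)" "integrable counting (\<lambda>x. (cmod (ft g x))\<^sup>2)"
    using f(4) g(4) by (auto simp: sqsum_def)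
  have "cmod (T f g) \<le> (\<integral>x. cmod (h x * (ft f x * cnj (ft g x))) \<partial>counting)"
    unfolding T_def by (rule integral_norm_bound)
  also have "\<dots> \<le> (\<integral>x. bnd * ((cmod (ft f x))\<^sup>2 + (cmod (ft g x))\<^sup>2) \<partial>counting)"
  proof (rule integral_mono)
    show "integrable counting (\<lambda>x. cmod (h x * (ft f x * cnj (ft g x))))"
      using T_integrable[OF f(4) g(4)] by simp
    show "integrable counting (\<lambda>x. bnd * ((cmod (ft f x))\<^sup>2 + (cmod (ft g x))\<^sup>2))" using i by simp
    show "cmod (h x * (ft f x * cnj (ft g x))) \<le> bnd * ((cmod (ft f x))\<^sup>2 + (cmod (ft g x))\<^sup>2)" for x
      unfolding norm_mult complex_mod_cnj using bnd mult_le_sum_squares by (intro mult_mono) auto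
  qed
  also have "\<dots> = bnd * (nsq (ft f) + nsq (ft g))" using i by (simp add: nsq_def)
  also have "\<dots> \<le> bnd * (c\<^sup>2 + d\<^sup>2)" using f(5) g(5) bnd(1) by (intro mult_left_mono) auto
  finally show ?thesis .
qed

lemma T_diff_left: 
  assumes "bdd_on c P f" "bdd_on c' P' f'" "bdd_on d Q g" "0 \<le> c" "0 \<le> c'" "0 \<le> d"
  shows "T (\<lambda>q. f q - f' q) g = T f g - T f' g"
proof -
  note f = bdd_on_integrable[OF assms(1,4)] and f' = bdd_on_integrable[OF assms(2,5)]
    and g = bdd_on_integrable[OF assms(3,6)]
  have "ft (\<lambda>q. f q - f' q) x = ft f x - ft f' x" for x by (rule ft_diff) (use f f' in auto)
  then show ?thesis
    unfolding T_def
    by (simp add: left_diff_distrib right_diff_distrib T_integrable[OF f(4) g(4)] T_integrable[OF f'(4) g(4)])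
qed

lemma T_diff_right: 
  assumes "bdd_on c P f" "bdd_on c' P' f'" "bdd_on d Q g" "0 \<le> c" "0 \<le> c'" "0 \<le> d"
  shows "T g (\<lambda>q. f q - f' q) = T g f - T g f'"
proof -
  note f = bdd_on_integrable[OF assms(1,4)] and f' = bdd_on_integrable[OF assms(2,5)]
    and g = bdd_on_integrable[OF assms(3,6)]
  have "ft (\<lambda>q. f q - f' q) x = ft f x - ft f' x" for x by (rule ft_diff) (use f f' in auto)
  then show ?thesis
    unfolding T_def
    by (simp add: left_diff_distrib right_diff_distrib T_integrable[OF g(4) f(4)] T_integrable[OF g(4) f'(4)])
qed

lemma ft_cmult: "ft (\<lambda>q. a * f q) x = a * ft f x"
proof -
  have "ft (\<lambda>q. a * f q) x = (\<integral>q. a * (cis (pairing q x) * f q) \<partial>haar)" unfolding ft_def by (simp add: mult_ac)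
  then show ?thesis by (simp add: ft_def)
qed

lemma T_cmult: "T (\<lambda>q. a * f q) (\<lambda>q. a' * g q) = a * cnj a' * T f g"
proof -
  have "T (\<lambda>q. a * f q) (\<lambda>q. a' * g q) = (\<integral>x. (a * cnj a') * (h x * (ft f x * cnj (ft g x))) \<partial>counting)"
    unfolding T_def ft_cmult by (simp add: mult_ac)
  then show ?thesis by (simp add: T_def)
qed

lemma ft_sum: "(\<And>i. i \<in> I \<Longrightarrow> integrable haar (f i)) \<Longrightarrow> ft (\<lambda>q. \<Sum>i\<in>I. f i q) x = (\<Sum>i\<in>I. ft (f i) x)" for f :: "'i \<Rightarrow> real ^ 'n \<Rightarrow> complex"
  unfolding ft_def sum_distrib_left by (rule Bochner_Integration.integral_sum) (rule integrable_cis_mult)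

lemma T_sum:
  assumes "\<And>i. i \<in> I \<Longrightarrow> bdd_on 1 (P i) (f i)" "\<And>i. i \<in> J \<Longrightarrow> bdd_on 1 (Q i) (g i)"
  shows "T (\<lambda>q. \<Sum>i\<in>I. f i q) (\<lambda>q. \<Sum>i\<in>J. g i q) = (\<Sum>i\<in>I. \<Sum>j\<in>J. T (f i) (g j))"
proof -
  have f: "integrable haar (f i)" "sqsum (ft (f i))" if "i \<in> I" for i using bdd_on_integrable[OF assms(1)[OF that]] by auto
  have g: "integrable haar (g i)" "sqsum (ft (g i))" if "i \<in> J" for i using bdd_on_integrable[OF assms(2)[OF that]] by auto
  have int: "integrable counting (\<lambda>x. h x * (ft (f i) x * cnj (ft (g j) x)))" if "i \<in> I" "j \<in> J" for i j
    by (rule T_integrable[OF f(2)[OF that(1)] g(2)[OF that(2)]])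
  have "T (\<lambda>q. \<Sum>i\<in>I. f i q) (\<lambda>q. \<Sum>i\<in>J. g i q) = (\<integral>x. (\<Sum>i\<in>I. \<Sum>j\<in>J. h x * (ft (f i) x * cnj (ft (g j) x))) \<partial>counting)"
    unfolding T_def
  proof (rule Bochner_Integration.integral_cong[OF refl])
    fix x
    have "ft (\<lambda>q. \<Sum>i\<in>I. f i q) x = (\<Sum>i\<in>I. ft (f i) x)" "ft (\<lambda>q. \<Sum>i\<in>J. g i q) x = (\<Sum>i\<in>J. ft (g i) x)"
      by (rule ft_sum, erule f g)+
    then show "h x * (ft (\<lambda>q. \<Sum>i\<in>I. f i q) x * cnj (ft (\<lambda>q. \<Sum>i\<in>J. g i q) x))
        = (\<Sum>i\<in>I. \<Sum>j\<in>J. h x * (ft (f i) x * cnj (ft (g j) x)))"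
      by (simp only: cnj_sum sum_product) (simp only: sum_distrib_left)
  qed
  also have "\<dots> = (\<Sum>i\<in>I. \<integral>x. (\<Sum>j\<in>J. h x * (ft (f i) x * cnj (ft (g j) x))) \<partial>counting)"
    by (rule Bochner_Integration.integral_sum) (intro Bochner_Integration.integrable_sum int)
  also have "\<dots> = (\<Sum>i\<in>I. \<Sum>j\<in>J. T (f i) (g j))"
    unfolding T_def by (rule sum.cong[OF refl], rule Bochner_Integration.integral_sum) (rule int)
  finally show ?thesis .
qed

text \<open>Modulating both arguments by \<open>s\<close> translates both transforms by
  \<open>s\<close>, which is the same as translating \<open>h\<close>. Summation against
  \<open>b\<close> then produces the convolution of \<open>b\<close> with \<open>h\<close>, which
  vanishes.\<close>

lemma T_modulation_sum:
  assumes "bdd_on 1 P f" "bdd_on 1 Q g"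
  shows "(\<integral>s. b s * T (\<lambda>q. cis (pairing q s) * f q) (\<lambda>q. cis (pairing q s) * g q) \<partial>counting) = 0"
proof -
  define F where "F x = ft f x * cnj (ft g x)" for x
  have F: "integrable counting F" unfolding F_def
    by (rule sqsum_mult(3)) (use bdd_on_integrable[OF assms(1)] bdd_on_integrable[OF assms(2)] in auto)
  have Tb: "b s * T (\<lambda>q. cis (pairing q s) * f q) (\<lambda>q. cis (pairing q s) * g q) = (\<integral>x. b s * h (x - s) * F x \<partial>counting)" for s
  proof -
    have "T (\<lambda>q. cis (pairing q s) * f q) (\<lambda>q. cis (pairing q s) * g q) = (\<integral>x. h x * F (x + s) \<partial>counting)"
      unfolding T_def ft_cis_mult F_def ..
    also have "\<dots> = (\<integral>x. h (x - s) * F x \<partial>counting)"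
      using integral_counting_bij(1)[OF bij_add_const[of s], of "\<lambda>x. h (x - s) * F x"] by simp
    finally show ?thesis by (simp add: mult.assoc)
  qed
  have dom: "norm (b s * h (x - s) * F x) \<le> norm (b s) * bnd * norm (F x)" for s x
    using bnd by (simp add: norm_mult mult_mono)
  have int: "integrable counting (\<lambda>x. b s * h (x - s) * F x)" for s
  proof (rule integrable_counting_bound)
    show "integrable counting (\<lambda>x. (norm (b s) * bnd) *\<^sub>R F x)" using F by simp
    show "norm (b s * h (x - s) * F x) \<le> norm ((norm (b s) * bnd) *\<^sub>R F x)" for x
      using dom[of s x] bnd(1) by (simp add: abs_mult)
  qed
  have abs: "integrable counting (\<lambda>s. \<integral>x. norm (b s * h (x - s) * F x) \<partial>counting)"
  proof (rule integrable_counting_bound)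
    show "integrable counting (\<lambda>s. norm (b s) * (bnd * (\<integral>x. norm (F x) \<partial>counting)))" using b by simp
    fix s
    have "(\<integral>x. norm (b s * h (x - s) * F x) \<partial>counting) \<le> (\<integral>x. norm (b s) * bnd * norm (F x) \<partial>counting)"
      by (rule integral_mono) (use int F dom in auto)
    then show "norm (\<integral>x. norm (b s * h (x - s) * F x) \<partial>counting) \<le> norm (norm (b s) * (bnd * (\<integral>x. norm (F x) \<partial>counting)))"
      using bnd(1) by (simp add: mult.assoc)
  qed
  have "(\<integral>s. b s * T (\<lambda>q. cis (pairing q s) * f q) (\<lambda>q. cis (pairing q s) * g q) \<partial>counting)
      = (\<integral>x. \<integral>s. b s * h (x - s) * F x \<partial>counting \<partial>counting)"
    unfolding Tb by (rule integral_counting_swap[OF sigma_finite_measure_count_space int abs])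
  also have "\<dots> = 0" by (simp add: conv)
  finally show ?thesis .
qed

text \<open>Bounds the variation of the character of frequency \<open>s\<close> over points whose
  coordinates differ from a centre by at most \<open>\<rho>\<close>. The cap 2 keeps it dominated,
  so that its sum against \<open>b\<close> tends to 0 with \<open>\<rho>\<close> although
  \<open>b\<close> need not have a finite first moment.\<close>

definition osc :: "real \<Rightarrow> int ^ 'n \<Rightarrow> real" where
  "osc \<rho> s = min 2 (\<rho> * (\<Sum>j\<in>UNIV. \<bar>real_of_int (s $ j)\<bar>))"

lemma osc_bounds: "0 \<le> \<rho> \<Longrightarrow> 0 \<le> osc \<rho> s" "osc \<rho> s \<le> 2"
  by (auto simp: osc_def sum_nonneg)

lemma cmod_cis_pairing_diff:
  assumes "\<And>j. \<bar>p $ j - p0 $ j\<bar> \<le> \<rho>"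
  shows "cmod (cis (pairing p0 s) - cis (pairing p s)) \<le> osc \<rho> s"
proof -
  have "\<bar>pairing p0 s - pairing p s\<bar> = \<bar>\<Sum>j\<in>UNIV. (p0 $ j - p $ j) * real_of_int (s $ j)\<bar>"
    by (simp add: pairing_def sum_subtractf algebra_simps)
  also have "\<dots> \<le> (\<Sum>j\<in>UNIV. \<bar>(p0 $ j - p $ j) * real_of_int (s $ j)\<bar>)" by (rule sum_abs)
  also have "\<dots> \<le> (\<Sum>j\<in>UNIV. \<rho> * \<bar>real_of_int (s $ j)\<bar>)"
    using assms by (intro sum_mono) (auto simp: abs_mult abs_minus_commute intro!: mult_right_mono)
  finally have 1: "\<bar>pairing p0 s - pairing p s\<bar> \<le> \<rho> * (\<Sum>j\<in>UNIV. \<bar>real_of_int (s $ j)\<bar>)"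
    by (simp add: sum_distrib_left)
  have "cmod (cis (pairing p0 s) - cis (pairing p s)) \<le> cmod (cis (pairing p0 s)) + cmod (cis (pairing p s))"
    by (rule norm_triangle_ineq4)
  then have "cmod (cis (pairing p0 s) - cis (pairing p s)) \<le> 2" by simp
  then show ?thesis using order_trans[OF cmod_cis_diff_le 1] by (simp add: osc_def)
qed

lemma osc_small:
  assumes "0 < c"
  obtains \<rho> where "\<rho> > 0" "(\<integral>s. cmod (b s) * (2 * osc \<rho> s) \<partial>counting) < c"
proof -
  have "(\<lambda>n. \<integral>s. cmod (b s) * (2 * osc (1 / real (Suc n)) s) \<partial>counting) \<longlonglongrightarrow> (\<integral>s. 0 \<partial>(counting :: (int ^ 'n) measure))"
  proof (rule integral_dominated_convergence[where w = "\<lambda>s. cmod (b s) * 4"])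
    show "AE s in counting. (\<lambda>n. cmod (b s) * (2 * osc (1 / real (Suc n)) s)) \<longlonglongrightarrow> 0"
    proof (rule AE_I2)
      fix s
      have "(\<lambda>n. 1 / real (Suc n)) \<longlonglongrightarrow> 0" using LIMSEQ_inverse_real_of_nat by (simp add: inverse_eq_divide)
      then have "(\<lambda>n. cmod (b s) * (2 * osc (1 / real (Suc n)) s)) \<longlonglongrightarrow> cmod (b s) * (2 * min 2 (0 * (\<Sum>j\<in>UNIV. \<bar>real_of_int (s $ j)\<bar>)))"
        unfolding osc_def by (intro tendsto_intros)
      then show "(\<lambda>n. cmod (b s) * (2 * osc (1 / real (Suc n)) s)) \<longlonglongrightarrow> 0" by simp
    qed
    show "AE s in counting. norm (cmod (b s) * (2 * osc (1 / real (Suc n)) s)) \<le> cmod (b s) * 4" for n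
    proof (rule AE_I2)
      fix s
      have "cmod (b s) * (2 * osc (1 / real (Suc n)) s) \<le> cmod (b s) * 4"
        using osc_bounds(2)[of "1 / real (Suc n)" s] by (intro mult_left_mono) auto
      then show "norm (cmod (b s) * (2 * osc (1 / real (Suc n)) s)) \<le> cmod (b s) * 4"
        using osc_bounds(1)[of "1 / real (Suc n)" s] by (simp add: abs_mult)
    qed
  qed (use b in auto)
  then have "eventually (\<lambda>n. (\<integral>s. cmod (b s) * (2 * osc (1 / real (Suc n)) s) \<partial>counting) < c) sequentially"
    using order_tendstoD(2)[of _ 0 sequentially c] assms by simp
  then obtain n where "(\<integral>s. cmod (b s) * (2 * osc (1 / real (Suc n)) s) \<partial>counting) < c"
    by (meson eventually_happens sequentially_bot)
  then show thesis using that[of "1 / real (Suc n)"] by simp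
qed

text \<open>Freezing the modulations at \<open>p0\<close> and \<open>q0\<close> turns the modulation identity into
  \<open>symbol (p0 - q0) T = error\<close>, with an error bounded by a sufficiently small multiple of the supremum of \<open>T\<close>
  itself; so this supremum vanishes.\<close>

lemma T_local_zero:
  assumes P: "p0 \<in> P" "\<And>p j. p \<in> P \<Longrightarrow> \<bar>p $ j - p0 $ j\<bar> \<le> \<rho>"
    and Q: "q0 \<in> Q" "\<And>p j. p \<in> Q \<Longrightarrow> \<bar>p $ j - q0 $ j\<bar> \<le> \<rho>"
    and \<rho>: "\<rho> > 0" and small: "(\<integral>s. cmod (b s) * (2 * osc \<rho> s) \<partial>counting) < cmod (symbol (p0 - q0))"
    and f: "bdd_on 1 P f" and g: "bdd_on 1 Q g"
  shows "T f g = 0"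
proof -
  define X where "X = {cmod (T f g) | f g. bdd_on 1 P f \<and> bdd_on 1 Q g}"
  define t where "t = Sup X"
  define \<theta> where "\<theta> = (\<integral>s. cmod (b s) * (2 * osc \<rho> s) \<partial>counting)"
  have bddX: "bdd_above X"
    using norm_T_le by (intro bdd_aboveI[of _ "bnd * (1\<^sup>2 + 1\<^sup>2)"]) (fastforce simp: X_def)
  have le_t: "cmod (T f g) \<le> t" if "bdd_on 1 P f" "bdd_on 1 Q g" for f g
    unfolding t_def by (rule cSup_upper[OF _ bddX]) (use that in \<open>auto simp: X_def\<close>)
  have t0: "0 \<le> t" using le_t[OF f g] by (rule order_trans[OF norm_ge_zero])
  \<comment> \<open>Normalising both arguments upgrades the supremum over bounds 1 to a bound
    bilinear in \<open>c\<close> and \<open>d\<close>; \<open>norm_T_le\<close> alone gives only a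
    sum of squares.\<close>
  have scaled: "cmod (T f g) \<le> c * d * t" if f: "bdd_on c P f" and g: "bdd_on d Q g" and c: "0 \<le> c" "0 \<le> d" for f g c d
  proof (cases "c = 0 \<or> d = 0")
    case True
    then have "f = (\<lambda>_. 0) \<or> g = (\<lambda>_. 0)" using f g by (auto simp: bdd_on_def)
    then have "T f g = 0" by (auto simp: T_def ft_def)
    then show ?thesis using c t0 by simp
  next
    case False
    define f' where "f' q = of_real (1 / c) * f q" for q
    define g' where "g' q = of_real (1 / d) * g q" for q
    have "bdd_on (1 / c * c) P f'" "bdd_on (1 / d * d) Q g'"
      unfolding f'_def g'_def by (intro bdd_on_cmult f g; use c in \<open>simp add: norm_divide\<close>)+
    then have "bdd_on 1 P f'" "bdd_on 1 Q g'" using False by simp_all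
    then have "cmod (T f' g') \<le> t" by (rule le_t)
    moreover have "T f g = of_real c * cnj (of_real d) * T f' g'"
      unfolding T_cmult[symmetric] f'_def g'_def using False by simp
    ultimately show ?thesis using c by (simp add: norm_mult mult_left_mono)
  qed
  have main: "cmod (symbol (p0 - q0)) * cmod (T f g) \<le> \<theta> * t" if f: "bdd_on 1 P f" and g: "bdd_on 1 Q g" for f g
  proof -
    define S where "S s = T (\<lambda>q. cis (pairing q s) * f q) (\<lambda>q. cis (pairing q s) * g q)" for s
    have Sle: "cmod (S s) \<le> bnd * 2" for s
      using norm_T_le[OF bdd_on_cis[OF f, of s] bdd_on_cis[OF g, of s]] by (simp add: S_def)
    have iS: "integrable counting (\<lambda>s. b s * S s)"
    proof (rule integrable_counting_bound)
      show "integrable counting (\<lambda>s. (bnd * 2) *\<^sub>R b s)" using b by simp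
      show "norm (b s * S s) \<le> norm ((bnd * 2) *\<^sub>R b s)" for s
        using mult_right_mono[OF Sle[of s], of "cmod (b s)"] bnd(1) by (simp add: norm_mult mult.commute)
    qed
    have err: "cmod (cis (pairing (p0 - q0) s) * T f g - S s) \<le> 2 * osc \<rho> s * t" for s
    proof -
      let ?f0 = "\<lambda>q. cis (pairing p0 s) * f q" and ?g0 = "\<lambda>q. cis (pairing q0 s) * g q"
      let ?f1 = "\<lambda>q. cis (pairing q s) * f q" and ?g1 = "\<lambda>q. cis (pairing q s) * g q"
      have f0: "bdd_on 1 P ?f0" using bdd_on_cmult[OF f, of "cis (pairing p0 s)" 1] by simp
      have g0: "bdd_on 1 Q ?g0" using bdd_on_cmult[OF g, of "cis (pairing q0 s)" 1] by simp
      note f1 = bdd_on_cis[OF f, of s] and g1 = bdd_on_cis[OF g, of s]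
      have o: "0 \<le> osc \<rho> s" using osc_bounds \<rho> by simp
      have fd: "bdd_on (osc \<rho> s) P (\<lambda>q. ?f0 q - ?f1 q)"
        by (rule bdd_on_cis_diff[OF f _ o]) (rule cmod_cis_pairing_diff[OF P(2)])
      have gd: "bdd_on (osc \<rho> s) Q (\<lambda>q. ?g0 q - ?g1 q)"
        by (rule bdd_on_cis_diff[OF g _ o]) (rule cmod_cis_pairing_diff[OF Q(2)])
      have "cis (pairing (p0 - q0) s) = cis (pairing p0 s) * cnj (cis (pairing q0 s))"
        by (simp add: cis_cnj cis_mult)
      then have "cis (pairing (p0 - q0) s) * T f g = T ?f0 ?g0" unfolding T_cmult by simp
      \<comment> \<open>The characters are unfrozen one argument at a time. Each exchange costs
        \<open>osc \<rho> s * t\<close>, whence the factor 2 in the smallness condition.\<close>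
      then have "cis (pairing (p0 - q0) s) * T f g - S s = (T ?f0 ?g0 - T ?f1 ?g0) + (T ?f1 ?g0 - T ?f1 ?g1)"
        by (simp add: S_def)
      also have "\<dots> = T (\<lambda>q. ?f0 q - ?f1 q) ?g0 + T ?f1 (\<lambda>q. ?g0 q - ?g1 q)"
        using T_diff_left[OF f0 f1 g0] T_diff_right[OF g0 g1 f1] by simp
      finally have "cmod (cis (pairing (p0 - q0) s) * T f g - S s) = cmod (T (\<lambda>q. ?f0 q - ?f1 q) ?g0 + T ?f1 (\<lambda>q. ?g0 q - ?g1 q))"
        by (rule arg_cong)
      also have "\<dots> \<le> osc \<rho> s * 1 * t + 1 * osc \<rho> s * t"
        using scaled[OF fd g0 o zero_le_one] scaled[OF f1 gd zero_le_one o]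
        by (intro order_trans[OF norm_triangle_ineq] add_mono)
      finally show ?thesis by (simp add: mult_ac)
    qed
    have "symbol (p0 - q0) * T f g = (\<integral>s. b s * cis (pairing (p0 - q0) s) * T f g \<partial>counting)"
      by (simp add: symbol_def)
    also have "\<dots> = (\<integral>s. b s * cis (pairing (p0 - q0) s) * T f g \<partial>counting) - (\<integral>s. b s * S s \<partial>counting)"
      using T_modulation_sum[OF f g] by (simp add: S_def)
    also have "\<dots> = (\<integral>s. b s * cis (pairing (p0 - q0) s) * T f g - b s * S s \<partial>counting)"
      by (rule Bochner_Integration.integral_diff[symmetric])
        (intro integrable_mult_left integrable_mult_cis_counting b iS)+
    finally have "cmod (symbol (p0 - q0) * T f g) \<le> (\<integral>s. norm (b s * cis (pairing (p0 - q0) s) * T f g - b s * S s) \<partial>counting)"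
      using integral_norm_bound[of counting "\<lambda>s. b s * cis (pairing (p0 - q0) s) * T f g - b s * S s"] by simp
    also have "\<dots> \<le> (\<integral>s. cmod (b s) * (2 * osc \<rho> s) * t \<partial>counting)"
    proof (rule integral_mono)
      show "integrable counting (\<lambda>s. norm (b s * cis (pairing (p0 - q0) s) * T f g - b s * S s))"
        by (intro integrable_norm Bochner_Integration.integrable_diff integrable_mult_left integrable_mult_cis_counting b iS)
      show "integrable counting (\<lambda>s. cmod (b s) * (2 * osc \<rho> s) * t)"
      proof (rule integrable_mult_left, rule integrable_counting_bound)
        show "integrable counting (\<lambda>s. 4 *\<^sub>R b s)" using b by simp
        show "norm (cmod (b s) * (2 * osc \<rho> s)) \<le> norm (4 *\<^sub>R b s)" for s
          using osc_bounds[of \<rho> s] \<rho> mult_left_mono[of "2 * osc \<rho> s" 4 "cmod (b s)"] by (simp add: abs_mult mult.commute)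
      qed
      fix s
      have "norm (b s * cis (pairing (p0 - q0) s) * T f g - b s * S s) = cmod (b s) * cmod (cis (pairing (p0 - q0) s) * T f g - S s)"
        by (simp add: norm_mult[symmetric] right_diff_distrib mult.assoc)
      also have "\<dots> \<le> cmod (b s) * (2 * osc \<rho> s * t)" by (intro mult_left_mono err) simp
      finally show "norm (b s * cis (pairing (p0 - q0) s) * T f g - b s * S s) \<le> cmod (b s) * (2 * osc \<rho> s) * t"
        by (simp add: mult.assoc)
    qed
    also have "\<dots> = \<theta> * t" by (simp add: \<theta>_def)
    finally show ?thesis by (simp add: norm_mult)
  qed
  have w: "0 < cmod (symbol (p0 - q0))"
  proof -
    have "0 \<le> \<theta>" unfolding \<theta>_def using osc_bounds(1)[of \<rho>] \<rho> by (intro integral_nonneg_AE AE_I2) auto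
    then show ?thesis using small unfolding \<theta>_def by linarith
  qed
  have "t \<le> \<theta> * t / cmod (symbol (p0 - q0))"
    unfolding t_def
  proof (rule cSup_least)
    show "X \<noteq> {}" using f g by (auto simp: X_def)
    fix y assume "y \<in> X"
    then obtain f g where "y = cmod (T f g)" "bdd_on 1 P f" "bdd_on 1 Q g" by (auto simp: X_def)
    then show "y \<le> \<theta> * Sup X / cmod (symbol (p0 - q0))"
      using main[of f g] w by (simp add: t_def pos_le_divide_eq mult.commute)
  qed
  then have "cmod (symbol (p0 - q0)) * t \<le> \<theta> * t" using w by (simp add: pos_le_divide_eq mult.commute)
  then have "t \<le> 0" using small unfolding \<theta>_def[symmetric] by (metis mult_le_cancel_right not_le)
  then have "cmod (T f g) \<le> 0" using le_t[OF f g] by linarith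
  then show ?thesis by simp
qed

text \<open>The uniform lower bound \<open>c\<close> on the symbol lets one scale
  \<open>\<rho>\<close> serve everywhere; after cutting both sets by a grid finer than
  \<open>\<rho>\<close>, every pair of pieces falls under \<open>T_local_zero\<close>.\<close>

lemma T_separated_zero:
  assumes P: "P \<in> sets borel" "P \<subseteq> torus" and Q: "Q \<in> sets borel" "Q \<subseteq> torus"
    and c: "c > 0" "\<And>p q. p \<in> P \<Longrightarrow> q \<in> Q \<Longrightarrow> c \<le> cmod (symbol (p - q))"
  shows "T (indicator P) (indicator Q) = 0"
proof -
  obtain \<rho> where \<rho>: "\<rho> > 0" "(\<integral>s. cmod (b s) * (2 * osc \<rho> s) \<partial>counting) < c" by (rule osc_small[OF c(1)])
  obtain N :: nat where N: "2 * pi / \<rho> < real N" using reals_Archimedean2 by blast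
  have N0: "N > 0" using N \<rho> pi_gt_zero by (metis divide_pos_pos less_trans mult_pos_pos of_nat_0_less_iff zero_less_numeral)
  have diam: "\<bar>p $ j - p' $ j\<bar> \<le> \<rho>" if "p \<in> gbox N i" "p' \<in> gbox N i" for p p' :: "real ^ 'n" and i j
  proof -
    have "2 * pi / real N \<le> \<rho>" using N \<rho> N0 by (simp add: field_simps)
    moreover have "2 * pi * (real (i j) + 1) / real N = 2 * pi * real (i j) / real N + 2 * pi / real N"
      by (simp add: add_divide_distrib distrib_left)
    ultimately show ?thesis using that unfolding gbox_def by (auto dest!: spec[of _ j])
  qed
  have indicator_sum: "(\<lambda>q. \<Sum>i\<in>box_index N. indicator (P \<inter> gbox N i) q) = (indicator P :: real ^ 'n \<Rightarrow> complex)"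
    if "P \<subseteq> torus" for P by (rule ext) (rule indicator_gbox_sum[OF that N0, symmetric])
  have "T (indicator P) (indicator Q) = T (\<lambda>q. \<Sum>i\<in>box_index N. indicator (P \<inter> gbox N i) q) (\<lambda>q. \<Sum>i\<in>box_index N. indicator (Q \<inter> gbox N i) q)"
    by (simp only: indicator_sum[OF P(2)] indicator_sum[OF Q(2)])
  also have "\<dots> = (\<Sum>i\<in>box_index N. \<Sum>l\<in>box_index N. T (indicator (P \<inter> gbox N i)) (indicator (Q \<inter> gbox N l)))"
    by (rule T_sum) (rule bdd_on_indicator; use P Q in simp)+
  also have "\<dots> = 0"
  proof (intro sum.neutral ballI)
    fix i l
    show "T (indicator (P \<inter> gbox N i)) (indicator (Q \<inter> gbox N l)) = 0"
    proof (cases "P \<inter> gbox N i = {} \<or> Q \<inter> gbox N l = {}")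
      case True
      then show ?thesis by (auto simp: T_def ft_def)
    next
      case False
      then obtain p0 q0 where p0: "p0 \<in> P \<inter> gbox N i" and q0: "q0 \<in> Q \<inter> gbox N l" by blast
      show ?thesis
      proof (rule T_local_zero[OF p0 _ q0 _ \<rho>(1)])
        show "(\<integral>s. cmod (b s) * (2 * osc \<rho> s) \<partial>counting) < cmod (symbol (p0 - q0))"
          using \<rho>(2) c(2)[of p0 q0] p0 q0 by auto
      qed (use p0 q0 diam P Q in \<open>auto intro!: bdd_on_indicator\<close>)
    qed
  qed
  finally show ?thesis .
qed

lemma continuous_symbol: "continuous_on S symbol"
proof -
  have "symbol = (\<lambda>p. dft b (- p))" by (simp add: symbol_def dft_def fun_eq_iff)
  moreover have "continuous_on S (\<lambda>p. dft b (- p))"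
    by (rule continuous_on_compose2[OF continuous_on_dft[OF b, of UNIV]]) (auto intro!: continuous_intros)
  ultimately show ?thesis by simp
qed

text \<open>Closed boxes are used so that for boxes which are not near the symbol has, by
  compactness, a positive minimum over differences, as \<open>T_separated_zero\<close>
  requires.\<close>

definition near :: "nat \<Rightarrow> ('n \<Rightarrow> nat) \<Rightarrow> ('n \<Rightarrow> nat) \<Rightarrow> bool" where
  "near N i l \<longleftrightarrow> (\<exists>p\<in>gcbox N i. \<exists>q\<in>gcbox N l. symbol (p - q) = 0)"

lemma T_far_zero:
  assumes "i \<in> box_index N" "l \<in> box_index N" "\<not> near N i l"
  shows "T (indicator (gbox N i)) (indicator (gbox N l)) = 0"
proof (cases "gcbox N i \<times> gcbox N l = ({} :: ((real ^ 'n) \<times> (real ^ 'n)) set)")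
  case True
  then have "gbox N i = ({} :: (real ^ 'n) set) \<or> gbox N l = ({} :: (real ^ 'n) set)"
    using gbox_subset_gcbox[of N i] gbox_subset_gcbox[of N l] by auto
  then show ?thesis by (auto simp: T_def ft_def)
next
  case False
  have "compact (gcbox N i \<times> gcbox N l :: ((real ^ 'n) \<times> (real ^ 'n)) set)"
    by (intro compact_Times) (simp_all add: gcbox_def compact_cbox)
  moreover have "continuous_on (gcbox N i \<times> gcbox N l) (\<lambda>x. cmod (symbol (fst x - snd x)))"
    by (intro continuous_on_norm continuous_on_compose2[OF continuous_symbol[of UNIV]] continuous_intros) auto
  ultimately obtain x where x: "x \<in> gcbox N i \<times> gcbox N l"
    "\<And>y. y \<in> gcbox N i \<times> gcbox N l \<Longrightarrow> cmod (symbol (fst x - snd x)) \<le> cmod (symbol (fst y - snd y))"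
    using continuous_attains_inf[OF _ False] by blast
  show ?thesis
  proof (rule T_separated_zero)
    show "0 < cmod (symbol (fst x - snd x))" using x(1) assms(3) by (auto simp: near_def)
    show "cmod (symbol (fst x - snd x)) \<le> cmod (symbol (p - q))" if "p \<in> gbox N i" "q \<in> gbox N l" for p q
      using x(2)[of "(p, q)"] that gbox_subset_gcbox by auto
  qed (use assms gbox_subset_torus in auto)
qed

text \<open>If \<open>p - q = z\<close> with \<open>p\<close> in box \<open>i\<close> and
  \<open>q\<close> in box \<open>l\<close>, then each \<open>l j\<close> is within 1 of
  \<open>i j - N * z_j / (2 pi)\<close>, which leaves three values per coordinate for each zero
  \<open>z\<close>. Differences of torus points fill the box of half-width \<open>2 pi\<close>, so
  the zeros are counted there. The bound does not depend on \<open>N\<close>.\<close>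

lemma card_near:
  assumes N: "N > 0" and fin: "finite {z. (\<forall>j. \<bar>z $ j\<bar> \<le> 2 * pi) \<and> symbol z = 0}" and i: "i \<in> box_index N"
  shows "card {l \<in> box_index N. near N i l} \<le> card {z. (\<forall>j. \<bar>z $ j\<bar> \<le> 2 * pi) \<and> symbol z = 0} * 3 ^ CARD('n)"
proof -
  define Z where "Z = {z. (\<forall>j. \<bar>z $ j\<bar> \<le> 2 * pi) \<and> symbol z = 0}"
  define L where "L z = PiE UNIV (\<lambda>j. {m :: nat. \<bar>real m - (real (i j) - real N * z $ j / (2 * pi))\<bar> \<le> 1})" for z :: "real ^ 'n"
  have finL: "finite (L z)" for z unfolding L_def by (rule finite_PiE) (auto intro: card_nat_near)
  have cardL: "card (L z) \<le> 3 ^ CARD('n)" for z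
    unfolding L_def by (subst card_PiE) (auto intro!: prod_le_power card_nat_near)
  have "{l \<in> box_index N. near N i l} \<subseteq> (\<Union>z\<in>Z. L z)"
  proof (rule subsetI)
    fix l assume "l \<in> {l \<in> box_index N. near N i l}"
    then have l: "l \<in> box_index N" "near N i l" by auto
    then obtain p q where pq: "p \<in> gcbox N i" "q \<in> gcbox N l" "symbol (p - q) = 0" by (auto simp: near_def)
    define x where "x r j = (r $ j + pi) * real N / (2 * pi)" for r :: "real ^ 'n" and j
    have mem: "real (m j) \<le> x r j \<and> x r j \<le> real (m j) + 1" if "r \<in> gcbox N m" for r m and j :: 'n
    proof -
      have "- pi + 2 * pi * real (m j) / real N \<le> r $ j" "r $ j \<le> - pi + 2 * pi * (real (m j) + 1) / real N"
        using that by (auto simp: gcbox_def mem_box_cart)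
      then show ?thesis using N pi_gt_zero by (simp add: x_def field_simps)
    qed
    have rng: "- pi \<le> r $ j \<and> r $ j \<le> pi" if "r \<in> gcbox N m" "m \<in> box_index N" for r m and j :: 'n
    proof -
      have "0 \<le> x r j" "x r j \<le> real N" using mem[OF that(1), of j] that(2) by (auto simp: box_index_def dest!: spec[of _ j])
      then have "0 \<le> (r $ j + pi) * real N" "(r $ j + pi) * real N \<le> (2 * pi) * real N"
        using pi_gt_zero by (simp_all add: x_def zero_le_divide_iff pos_divide_le_eq mult.commute)
      then have "0 \<le> r $ j + pi" "r $ j + pi \<le> 2 * pi"
        using N by (auto simp: zero_le_mult_iff mult_le_cancel_right)
      then show ?thesis by simp
    qed
    have "\<bar>(p - q) $ j\<bar> \<le> 2 * pi" for j using rng[OF pq(1) i, of j] rng[OF pq(2) l(1), of j] by (simp add: abs_le_iff)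
    then have "p - q \<in> Z" using pq(3) by (simp add: Z_def)
    moreover have "l \<in> L (p - q)"
    proof -
      have "\<bar>real (l j) - (real (i j) - real N * (p - q) $ j / (2 * pi))\<bar> \<le> 1" for j
      proof -
        have "real N * (p - q) $ j / (2 * pi) = x p j - x q j" by (simp add: x_def diff_divide_distrib[symmetric] algebra_simps)
        then show ?thesis using mem[OF pq(1), of j] mem[OF pq(2), of j] by (simp add: abs_le_iff)
      qed
      then show ?thesis by (simp add: L_def PiE_def Pi_def)
    qed
    ultimately show "l \<in> (\<Union>z\<in>Z. L z)" by blast
  qed
  then have "card {l \<in> box_index N. near N i l} \<le> card (\<Union>z\<in>Z. L z)"
    by (rule card_mono[rotated]) (use fin finL in \<open>auto simp: Z_def\<close>)
  also have "\<dots> \<le> (\<Sum>z\<in>Z. card (L z))" by (rule card_UN_le) (use fin in \<open>simp add: Z_def\<close>)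
  also have "\<dots> \<le> (\<Sum>z\<in>Z. 3 ^ CARD('n))" by (rule sum_mono) (rule cardL)
  finally show ?thesis by (simp add: Z_def)
qed

text \<open>Cauchy-Schwarz, with \<open>h\<close> attached to one factor. By Bessel each transform
  has squared norm at most \<open>1 / n\<close>, where \<open>n\<close> is the number of boxes. On
  the finite set \<open>F\<close> the transform is pointwise at most \<open>1 / n\<close>, so the
  large values of \<open>h\<close> contribute only \<open>card F * bnd^2 / n^2\<close>; elsewhere
  \<open>h\<close> is at most \<open>e\<close>.\<close>

lemma T_box_bound:
  assumes N: "N > 0" "i \<in> box_index N" "l \<in> box_index N"
    and F: "finite F" "\<And>x. x \<notin> F \<Longrightarrow> cmod (h x) \<le> e" and e: "0 < e"
  shows "cmod (T (indicator (gbox N i)) (indicator (gbox N l)))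
     \<le> sqrt (real (card F) * bnd\<^sup>2 / real N ^ CARD('n) + e\<^sup>2) / real N ^ CARD('n)"
proof -
  define n where "n = real N ^ CARD('n)"
  have n: "n > 0" using N by (simp add: n_def)
  let ?f = "indicator (gbox N i) :: real ^ 'n \<Rightarrow> complex" and ?g = "indicator (gbox N l) :: real ^ 'n \<Rightarrow> complex"
  have bf: "bdd_on 1 (gbox N i) ?f" and bg: "bdd_on 1 (gbox N l) ?g" by (rule bdd_on_indicator; simp)+
  note f = bdd_on_integrable[OF bf zero_le_one] and g = bdd_on_integrable[OF bg zero_le_one]
  have sq_ind: "(\<integral>q. (cmod (indicator (gbox N m) q))\<^sup>2 \<partial>(haar :: (real ^ 'n) measure)) = measure haar (gbox N m :: (real ^ 'n) set)" for m
  proof -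
    have "(\<lambda>q. (cmod (indicator (gbox N m) q))\<^sup>2) = (indicator (gbox N m :: (real ^ 'n) set) :: _ \<Rightarrow> real)"
      by (auto simp: indicator_def)
    then show ?thesis by simp
  qed
  have nf: "nsq (ft ?f) \<le> 1 / n"
    unfolding nsq_def using bessel_inequality[OF f(3,2)] sq_ind[of i] measure_haar_gbox[OF N(2,1)] by (simp add: n_def)
  have ng: "nsq (ft ?g) \<le> 1 / n"
    unfolding nsq_def using bessel_inequality[OF g(3,2)] sq_ind[of l] measure_haar_gbox[OF N(3,1)] by (simp add: n_def)
  have fx: "cmod (ft ?f x) \<le> 1 / n" for x
  proof -
    have "cmod (ft ?f x) \<le> (\<integral>q. cmod (?f q) \<partial>haar)" by (rule norm_ft_le[OF f(1)])
    also have "(\<lambda>q. cmod (?f q)) = indicator (gbox N i)" by (auto simp: indicator_def)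
    also have "(\<integral>q. indicator (gbox N i) q \<partial>haar) = measure haar (gbox N i :: (real ^ 'n) set)" by simp
    finally show ?thesis using measure_haar_gbox[OF N(2,1)] by (simp add: n_def)
  qed
  define u where "u x = h x * ft ?f x" for x
  have su: "sqsum u"
  proof (rule sqsum_bound[OF sqsum_cscale[OF f(4), of "of_real bnd"]])
    show "cmod (u x) \<le> cmod (cscale (of_real bnd) (ft ?f) x)" for x
      using bnd by (simp add: u_def cscale_def norm_mult mult_right_mono)
  qed
  have "nsq u \<le> (\<integral>x. bnd\<^sup>2 / n\<^sup>2 * indicator F x + e\<^sup>2 * (cmod (ft ?f x))\<^sup>2 \<partial>counting)"
    unfolding nsq_def
  proof (rule integral_mono)
    show "integrable counting (\<lambda>x. bnd\<^sup>2 / n\<^sup>2 * indicator F x + e\<^sup>2 * (cmod (ft ?f x))\<^sup>2)"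
      using integral_counting_finite_support(1)[OF F(1), of "\<lambda>x. bnd\<^sup>2 / n\<^sup>2 * indicator F x"] f(4) by (simp add: sqsum_def)
    fix x
    show "(cmod (u x))\<^sup>2 \<le> bnd\<^sup>2 / n\<^sup>2 * indicator F x + e\<^sup>2 * (cmod (ft ?f x))\<^sup>2"
    proof (cases "x \<in> F")
      case True
      have "cmod (u x) \<le> bnd * (1 / n)" unfolding u_def norm_mult using bnd fx[of x] by (intro mult_mono) auto
      then have "(cmod (u x))\<^sup>2 \<le> (bnd * (1 / n))\<^sup>2" by (intro power_mono) auto
      then show ?thesis using True by (simp add: power_mult_distrib power_divide add_increasing2)
    next
      case False
      have "(cmod (u x))\<^sup>2 \<le> (e * cmod (ft ?f x))\<^sup>2"
        unfolding u_def norm_mult using F(2)[OF False] by (intro power_mono mult_right_mono) auto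
      then show ?thesis using False by (simp add: power_mult_distrib)
    qed
  qed (use su in \<open>simp add: sqsum_def\<close>)
  also have "\<dots> = bnd\<^sup>2 / n\<^sup>2 * real (card F) + e\<^sup>2 * nsq (ft ?f)"
    using integral_counting_finite_support[OF F(1), of "\<lambda>x. bnd\<^sup>2 / n\<^sup>2 * indicator F x"] f(4)
    by (simp add: sqsum_def nsq_def mult.commute)
  also have "\<dots> \<le> bnd\<^sup>2 / n\<^sup>2 * real (card F) + e\<^sup>2 * (1 / n)" using nf by (intro add_left_mono mult_left_mono) auto
  also have "\<dots> = (real (card F) * bnd\<^sup>2 / n + e\<^sup>2) * (1 / n)" using n by (simp add: field_simps power2_eq_square)
  finally have nu: "nsq u \<le> (real (card F) * bnd\<^sup>2 / n + e\<^sup>2) * (1 / n)" .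
  have "T ?f ?g = ip u (ft ?g)" by (simp add: T_def ip_def u_def mult.assoc)
  then have "(cmod (T ?f ?g))\<^sup>2 \<le> nsq u * nsq (ft ?g)" using ip_cauchy_schwarz[OF su g(4)] by simp
  also have "\<dots> \<le> ((real (card F) * bnd\<^sup>2 / n + e\<^sup>2) * (1 / n)) * (1 / n)"
    using nu ng n by (intro mult_mono) auto
  also have "\<dots> = (sqrt (real (card F) * bnd\<^sup>2 / n + e\<^sup>2) / n)\<^sup>2"
    using n by (simp add: power_divide power2_eq_square real_sqrt_mult_self)
  finally show ?thesis unfolding n_def[symmetric]
    by (rule power2_le_imp_le) (use n in simp)
qed

lemma T_torus: "T (indicator torus) (indicator torus) = h 0"
proof -
  have ft1: "ft (indicator torus) x = (if x = 0 then 1 else 0)" for x :: "int ^ 'n"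
  proof -
    have "ft (indicator torus) x = (\<integral>p. cis (pairing p x) \<partial>(haar :: (real ^ 'n) measure))"
      unfolding ft_def
      by (subst (1 2) integral_haar) (auto intro!: Bochner_Integration.integral_cong simp: indicator_def)
    then show ?thesis by (simp add: integral_haar_cis)
  qed
  have "T (indicator torus) (indicator torus) = (\<Sum>x\<in>{0}. h x * (ft (indicator torus) x * cnj (ft (indicator torus) x)))"
    unfolding T_def by (rule integral_counting_finite_support(2)) (auto simp: ft1)
  then show ?thesis by (simp add: ft1)
qed

text \<open>There are \<open>n\<close> boxes with at most \<open>K\<close> near partners each, and
  every pair contributes at most \<open>2 * e / n\<close>; so \<open>h 0\<close> is at most
  \<open>2 * K * e\<close> for every \<open>e > 0\<close>.\<close>

lemma value_at_0:
  assumes fin: "finite {z. (\<forall>j. \<bar>z $ j\<bar> \<le> 2 * pi) \<and> symbol z = 0}"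
  shows "h 0 = 0"
proof -
  define K where "K = card {z. (\<forall>j. \<bar>z $ j\<bar> \<le> 2 * pi) \<and> symbol z = 0} * 3 ^ CARD('n)"
  have le: "cmod (h 0) \<le> real K * (2 * e)" if e: "e > 0" for e
  proof -
    have "eventually (\<lambda>x. dist (h x) 0 < e) cofinite" using h e by (rule tendstoD)
    then have F: "finite {x. \<not> cmod (h x) < e}" by (simp add: eventually_cofinite)
    define F where "F = {x. \<not> cmod (h x) < e}"
    have F': "finite F" "\<And>x. x \<notin> F \<Longrightarrow> cmod (h x) \<le> e" using F by (auto simp: F_def)
    \<comment> \<open>A grid so fine that the finitely many large values of \<open>h\<close>
      contribute no more than \<open>e^2\<close> under the square root; \<open>n \<ge> N\<close>
      suffices for that.\<close>
    obtain N0 :: nat where N0: "real (card F) * bnd\<^sup>2 / e\<^sup>2 < real N0" using reals_Archimedean2 by blast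
    define N where "N = Suc N0"
    have N: "N > 0" "real (card F) * bnd\<^sup>2 / e\<^sup>2 < real N" using N0 by (auto simp: N_def)
    define n where "n = real N ^ CARD('n)"
    have nN: "real N \<le> n" unfolding n_def using N(1) by (intro self_le_power) auto
    then have n: "n > 0" using N(1) by (metis less_le_trans of_nat_0_less_iff)
    have "real (card F) * bnd\<^sup>2 / n \<le> e\<^sup>2"
    proof -
      have "real (card F) * bnd\<^sup>2 \<le> real N * e\<^sup>2" using N(2) e by (simp add: pos_divide_less_eq less_imp_le)
      also have "\<dots> \<le> e\<^sup>2 * n" using mult_right_mono[OF nN, of "e\<^sup>2"] by (simp add: mult.commute)
      finally show ?thesis using n by (simp add: pos_divide_le_eq)
    qed
    moreover have "(2 * e)\<^sup>2 = 4 * e\<^sup>2" by (simp add: power_mult_distrib)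
    ultimately have "real (card F) * bnd\<^sup>2 / n + e\<^sup>2 \<le> (2 * e)\<^sup>2" using zero_le_power2[of e] by linarith
    then have s: "sqrt (real (card F) * bnd\<^sup>2 / n + e\<^sup>2) \<le> 2 * e"
      using e by (intro real_le_lsqrt) simp_all
    have Tle: "cmod (T (indicator (gbox N i)) (indicator (gbox N l))) \<le> 2 * e / n"
      if "i \<in> box_index N" "l \<in> box_index N" for i l
    proof -
      have "cmod (T (indicator (gbox N i)) (indicator (gbox N l))) \<le> sqrt (real (card F) * bnd\<^sup>2 / n + e\<^sup>2) / n"
        unfolding n_def by (rule T_box_bound[OF N(1) that F'(1) _ e]) (rule F'(2))
      also have "\<dots> \<le> 2 * e / n" using s n by (intro divide_right_mono) auto
      finally show ?thesis .
    qed
    have indicator_sum: "(\<lambda>q. \<Sum>i\<in>box_index N. indicator (torus \<inter> gbox N i) q) = (indicator torus :: real ^ 'n \<Rightarrow> complex)"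
      by (rule ext) (rule indicator_gbox_sum[OF order_refl N(1), symmetric])
    have "h 0 = T (indicator torus) (indicator torus)" by (simp add: T_torus)
    also have "\<dots> = T (\<lambda>q. \<Sum>i\<in>box_index N. indicator (torus \<inter> gbox N i) q) (\<lambda>q. \<Sum>i\<in>box_index N. indicator (torus \<inter> gbox N i) q)"
      by (simp only: indicator_sum)
    also have "\<dots> = (\<Sum>i\<in>box_index N. \<Sum>l\<in>box_index N. T (indicator (torus \<inter> gbox N i)) (indicator (torus \<inter> gbox N l)))"
      by (rule T_sum) (rule bdd_on_indicator; simp)+
    also have "\<dots> = (\<Sum>i\<in>box_index N. \<Sum>l\<in>box_index N. T (indicator (gbox N i)) (indicator (gbox N l)))"
    proof (rule sum.cong[OF refl], rule sum.cong[OF refl])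
      fix i l :: "'n \<Rightarrow> nat" assume "i \<in> box_index N" "l \<in> box_index N"
      then have "torus \<inter> gbox N i = gbox N i" "torus \<inter> gbox N l = gbox N l" using gbox_subset_torus by blast+
      then show "T (indicator (torus \<inter> gbox N i)) (indicator (torus \<inter> gbox N l)) = T (indicator (gbox N i)) (indicator (gbox N l))"
        by simp
    qed
    finally have h0: "h 0 = (\<Sum>i\<in>box_index N. \<Sum>l\<in>box_index N. T (indicator (gbox N i)) (indicator (gbox N l)))" .
    have "(\<Sum>i\<in>box_index N. \<Sum>l\<in>box_index N. T (indicator (gbox N i)) (indicator (gbox N l)))
      = (\<Sum>i\<in>box_index N. \<Sum>l\<in>{l\<in>box_index N. near N i l}. T (indicator (gbox N i)) (indicator (gbox N l)))"
      by (rule sum.cong[OF refl], rule sum.mono_neutral_right) (use T_far_zero in auto)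
    with h0 have h0': "h 0 = (\<Sum>i\<in>box_index N. \<Sum>l\<in>{l\<in>box_index N. near N i l}. T (indicator (gbox N i)) (indicator (gbox N l)))"
      by (rule trans)
    have "cmod (h 0) \<le> (\<Sum>i\<in>(box_index N :: ('n \<Rightarrow> nat) set). real K * (2 * e / n))"
      unfolding h0'
    proof (rule sum_norm_le)
      fix i :: "'n \<Rightarrow> nat" assume i: "i \<in> box_index N"
      have "cmod (\<Sum>l\<in>{l\<in>box_index N. near N i l}. T (indicator (gbox N i)) (indicator (gbox N l)))
          \<le> (\<Sum>l\<in>{l\<in>box_index N. near N i l}. 2 * e / n)"
        by (rule sum_norm_le) (use Tle i in auto)
      also have "\<dots> = real (card {l\<in>box_index N. near N i l}) * (2 * e / n)" by simp
      also have "\<dots> \<le> real K * (2 * e / n)"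
        using card_near[OF N(1) fin i] e n by (intro mult_right_mono) (auto simp: K_def simp del: of_nat_mult)
      finally show "cmod (\<Sum>l\<in>{l\<in>box_index N. near N i l}. T (indicator (gbox N i)) (indicator (gbox N l))) \<le> real K * (2 * e / n)" .
    qed
    also have "\<dots> = real K * (2 * e)" using n by (simp add: card_box_index n_def)
    finally show ?thesis .
  qed
  have "cmod (h 0) \<le> 0"
  proof (rule field_le_epsilon)
    fix e :: real assume e: "0 < e"
    have "cmod (h 0) \<le> real K * (2 * (e / (2 * (real K + 1))))" by (rule le) (use e in simp)
    also have "\<dots> \<le> e" using e by (simp add: field_simps)
    finally show "cmod (h 0) \<le> 0 + e" by simp
  qed
  then show ?thesis by simp
qed

end

theorem null_convolution_unique:
  fixes b h :: "int ^ 'n::finite \<Rightarrow> complex"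
  assumes b: "integrable counting b" and h: "(h \<longlongrightarrow> 0) cofinite"
    and conv: "\<And>x. (\<integral>s. b s * h (x - s) \<partial>counting) = 0"
    and fin: "finite {z :: real ^ 'n. (\<forall>j. \<bar>z $ j\<bar> \<le> 2 * pi) \<and> (\<integral>s. b s * cis (pairing z s) \<partial>counting) = 0}"
  shows "h x = 0"
proof -
  \<comment> \<open>Hypotheses are translation invariant, so the value at 0 of the translate settles
    every \<open>x\<close>.\<close>
  interpret null_convolution b "\<lambda>y. h (y + x)"
  proof
    show "((\<lambda>y. h (y + x)) \<longlongrightarrow> 0) cofinite"
    proof (rule filterlim_compose[OF h])
      show "filterlim (\<lambda>y. y + x) cofinite cofinite"
        unfolding filterlim_iff eventually_cofinite
      proof (intro allI impI)
        fix P :: "int ^ 'n \<Rightarrow> bool" assume "finite {y. \<not> P y}"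
        from finite_vimageI[OF this, of "\<lambda>y. y + x"] show "finite {y. \<not> P (y + x)}"
          by (simp add: vimage_def inj_def)
      qed
    qed
    show "(\<integral>s. b s * h (y - s + x) \<partial>counting) = 0" for y
      using conv[of "y + x"] by (simp add: algebra_simps)
  qed (rule b)
  show ?thesis using value_at_0 fin by (simp add: symbol_def)
qed

section \<open>Nondegenerate minima and integrability of the free resolvent symbol\<close>

lemma linear_eq_sum_axis:
  fixes f :: "real ^ 'n::finite \<Rightarrow> real"
  assumes "linear f" shows "f u = (\<Sum>i\<in>UNIV. u $ i * f (axis i 1))"
proof -
  have "f u = f (\<Sum>i\<in>UNIV. u $ i *\<^sub>R axis i 1)"
    using basis_expansion[of u] by (simp add: scalar_mult_eq_scaleR)
  also have "\<dots> = (\<Sum>i\<in>UNIV. u $ i * f (axis i 1))"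
    by (simp add: linear_sum[OF assms] linear_scale[OF assms])
  finally show ?thesis .
qed

lemma has_derivative_partial_deriv:
  fixes f :: "real ^ 'n::finite \<Rightarrow> real"
  assumes "f differentiable (at p)"
  shows "(f has_derivative (\<lambda>u. \<Sum>i\<in>UNIV. u $ i * partial_deriv i f p)) (at p)"
proof -
  have D: "(f has_derivative frechet_derivative f (at p)) (at p)"
    using assms by (simp add: frechet_derivative_works[symmetric])
  have "frechet_derivative f (at p) u = (\<Sum>i\<in>UNIV. u $ i * partial_deriv i f p)" for u
    unfolding partial_deriv_def by (rule linear_eq_sum_axis[OF has_derivative_linear[OF D]])
  then have "frechet_derivative f (at p) = (\<lambda>u. \<Sum>i\<in>UNIV. u $ i * partial_deriv i f p)" by auto
  with D show ?thesis by simp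
qed

text \<open>A descent step along the gradient \<open>g\<close> lowers \<open>f\<close> by at least a multiple of \<open>norm g ^ 2\<close>, and
  near a nondegenerate critical point \<open>norm g\<close> is comparable to the distance. Hence no symmetry or
  positivity of the Hessian is needed.\<close>

lemma nondegenerate_minimum_quadratic_growth:
  fixes f :: "real ^ 'n::finite \<Rightarrow> real"
  assumes C: "Cm (Suc (Suc m)) f" and morse: "morse f" and min: "\<And>p. f z \<le> f p"
  obtains c \<delta> where "c > 0" "\<delta> > 0" "\<And>u. norm u < \<delta> \<Longrightarrow> c * (norm u)\<^sup>2 \<le> f (z + u) - f z"
proof -
  define G where "G p = (\<chi> j. partial_deriv j f p)" for p
  have diff: "f differentiable (at p)" "partial_deriv i f differentiable (at p)" for p i using C by auto
  have Df: "(f has_derivative (\<lambda>u. G p \<bullet> u)) (at p)" for p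
    using has_derivative_partial_deriv[OF diff(1)[of p]]
    by (simp add: G_def inner_vec_def mult.commute)
  have "(\<lambda>u. G z \<bullet> u) = (\<lambda>u. 0)"
    by (rule has_derivative_local_min[OF Df[of z]]) (use min in auto)
  then have "G z \<bullet> G z = 0" by metis
  then have Gz: "G z = 0" by simp
  \<comment> \<open>Row \<open>j\<close> of the derivative of the gradient holds the derivatives of
    its component \<open>j\<close>, whereas \<open>hessian\<close> stores them in column
    \<open>j\<close>.\<close>
  define A where "A = transpose (hessian f z)"
  have DG: "(G has_derivative (\<lambda>u. A *v u)) (at z)"
    unfolding has_derivative_componentwise_within[of G]
  proof
    fix b :: "real ^ 'n" assume "b \<in> Basis"
    then obtain j where b: "b = axis j 1" by (auto simp: Basis_vec_def)
    have "(A *v u) $ j = (\<Sum>i\<in>UNIV. u $ i * partial_deriv i (partial_deriv j f) z)" for u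
      by (simp add: matrix_vector_mult_def A_def transpose_def hessian_def mult.commute)
    then show "((\<lambda>x. G x \<bullet> b) has_derivative (\<lambda>x. (A *v x) \<bullet> b)) (at z)"
      using has_derivative_partial_deriv[OF diff(2)[of j z]] by (simp add: b inner_axis G_def)
  qed
  have "\<forall>i. partial_deriv i f z = 0" using Gz by (simp add: G_def vec_eq_iff)
  then have "det A \<noteq> 0" using morse by (simp add: morse_def A_def)
  then have "inj ((*v) A)" by (simp add: inj_matrix_vector_mult invertible_det_nz)
  then obtain c where c: "c > 0" "\<And>u. c * norm u \<le> norm (A *v u)"
    using linear_inj_bounded_below_pos[of "(*v) A"] by auto
  obtain K where K: "K > 0" "\<And>u. norm (A *v u) \<le> K * norm u"
    using linear_bounded_pos[of "(*v) A"] by (auto simp: mult.commute)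
  \<comment> \<open>\<open>\<tau>\<close> is the length of the descent step:
    \<open>\<tau> * K \<le> 1 / 8\<close> lets the linear part of the gradient change by at most
    \<open>norm g / 8\<close>. The linearisation error \<open>e\<close> is chosen so that
    \<open>e * norm u\<close> is at most \<open>norm g / 8\<close>.\<close>
  define \<tau> where "\<tau> = 1 / (8 * (K + 1))"
  define e where "e = min (c / 16) (1 / 4)"
  have \<tau>: "\<tau> > 0" "\<tau> * K \<le> 1 / 8" "\<tau> \<le> 1 / 8" using K by (auto simp: \<tau>_def field_simps)
  have e: "e > 0" "e \<le> c / 16" "e \<le> 1 / 4" using c by (auto simp: e_def)
  obtain d where d: "d > 0" "\<And>u. norm u < d \<Longrightarrow> norm (G (z + u) - A *v u) \<le> e * norm u"
  proof -
    obtain d where "d > 0" "\<And>y. norm (y - z) < d \<Longrightarrow> norm (G y - G z - A *v (y - z)) \<le> e * norm (y - z)"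
      using DG e(1) unfolding has_derivative_at_alt by blast
    then show thesis using that[of d] Gz by (metis add_diff_cancel_left' diff_zero)
  qed
  \<comment> \<open>A descent step from \<open>u\<close> reaches at most norm
    \<open>(K + 2) * norm u\<close>, so it stays where the linearisation of \<open>G\<close> is
    valid.\<close>
  define \<delta> where "\<delta> = d / (K + 2)"
  have \<delta>: "\<delta> > 0" "\<delta> * (K + 2) = d" using d K by (auto simp: \<delta>_def)
  show thesis
  proof (rule that[of "\<tau> / 2 * (c / 2)\<^sup>2" \<delta>])
    show "0 < \<tau> / 2 * (c / 2)\<^sup>2" using \<tau> c by simp
    show "\<delta> > 0" by fact
    fix u :: "real ^ 'n" assume u: "norm u < \<delta>"
    define g where "g = G (z + u)"
    have "\<delta> \<le> \<delta> * (K + 2)" using \<delta>(1) K(1) by simp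
    then have ud: "norm u < d" using u \<delta> by simp
    have g_ge: "c / 2 * norm u \<le> norm g"
    proof -
      have "c * norm u \<le> norm (A *v u)" by (rule c(2))
      also have "\<dots> \<le> norm g + e * norm u"
        using d(2)[OF ud] norm_triangle_sub[of "A *v u" g] by (simp add: g_def norm_minus_commute)
      finally have "c * norm u \<le> norm g + e * norm u" .
      moreover have "e * norm u \<le> c / 16 * norm u" by (intro mult_right_mono e(2)) simp
      moreover have "0 \<le> c * norm u" using c(1) by simp
      ultimately show ?thesis by (simp add: field_simps)
    qed
    have g_le: "norm g \<le> (K + 1) * norm u"
    proof -
      have "norm g \<le> norm (A *v u) + norm (g - A *v u)" by (rule norm_triangle_sub)
      also have "\<dots> \<le> K * norm u + e * norm u" using d(2)[OF ud] K(2)[of u] by (simp add: g_def)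
      also have "\<dots> \<le> K * norm u + 1 * norm u" using e(3) by (intro add_left_mono mult_right_mono) auto
      finally show ?thesis by (simp add: distrib_right)
    qed
    define \<phi> where "\<phi> t = f (z + u - (t * \<tau>) *\<^sub>R g)" for t
    have D\<phi>: "(\<phi> has_real_derivative (- \<tau> * (G (z + u - (t * \<tau>) *\<^sub>R g) \<bullet> g))) (at t)" for t
    proof -
      have "((\<lambda>t. z + u - (t * \<tau>) *\<^sub>R g) has_derivative (\<lambda>s. - (s * \<tau>) *\<^sub>R g)) (at t)"
        by (auto intro!: derivative_eq_intros)
      from has_derivative_compose[OF this Df] show ?thesis
        unfolding \<phi>_def has_field_derivative_def by (rule has_derivative_eq_rhs) (auto simp: mult_ac)
    qed
    obtain t where t: "0 < t" "t < 1" "\<phi> 1 - \<phi> 0 = (1 - 0) * (- \<tau> * (G (z + u - (t * \<tau>) *\<^sub>R g) \<bullet> g))"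
      using MVT2[of 0 1 \<phi> "\<lambda>t. - \<tau> * (G (z + u - (t * \<tau>) *\<^sub>R g) \<bullet> g)"] D\<phi> by auto
    define u' where "u' = u - (t * \<tau>) *\<^sub>R g"
    have step: "norm ((t * \<tau>) *\<^sub>R g) \<le> \<tau> * norm g" using t \<tau> by (simp add: mult_right_mono)
    have nu': "norm u' \<le> norm u + \<tau> * norm g" unfolding u'_def using norm_triangle_ineq4[of u "(t * \<tau>) *\<^sub>R g"] step by simp
    have "\<tau> * norm g \<le> 1 * ((K + 1) * norm u)" using g_le \<tau> by (intro mult_mono) auto
    then have "norm u' \<le> (K + 2) * norm u" using nu' by (simp add: algebra_simps)
    also have "\<dots> < (K + 2) * \<delta>" using u K by (intro mult_strict_left_mono) auto
    finally have u'd: "norm u' < d" using \<delta>(2) by (simp add: mult.commute)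
    have cu: "e * norm u \<le> norm g / 8"
    proof -
      have "e * norm u \<le> c / 16 * norm u" by (intro mult_right_mono e(2)) simp
      then show ?thesis using g_ge by simp
    qed
    \<comment> \<open>The gradient at the mean-value point differs from \<open>g\<close> by at most
      half of it, so its component along \<open>g\<close> still gives a decrease of order
      \<open>norm g ^ 2\<close>.\<close>
    have "norm (G (z + u') - g) \<le> norm g / 2"
    proof -
      have "G (z + u') - g = (G (z + u') - A *v u') - (G (z + u) - A *v u) - A *v ((t * \<tau>) *\<^sub>R g)"
        by (simp add: g_def u'_def matrix_vector_mult_diff_distrib)
      also have "norm \<dots> \<le> norm (G (z + u') - A *v u') + norm (G (z + u) - A *v u) + norm (A *v ((t * \<tau>) *\<^sub>R g))"
        by (intro order_trans[OF norm_triangle_ineq4] add_mono order_refl)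
      also have "\<dots> \<le> e * norm u' + e * norm u + K * (\<tau> * norm g)"
        using d(2)[OF u'd] d(2)[OF ud] K(2)[of "(t * \<tau>) *\<^sub>R g"] mult_left_mono[OF step, of K] K(1) by linarith
      also have "\<dots> \<le> (norm g / 8 + 1 / 4 * (1 / 8 * norm g)) + norm g / 8 + 1 / 8 * norm g"
      proof -
        have "e * norm u' \<le> e * norm u + e * (\<tau> * norm g)"
          using mult_left_mono[OF nu', of e] e(1) by (simp add: distrib_left)
        moreover have "e * (\<tau> * norm g) \<le> 1 / 4 * (1 / 8 * norm g)"
          using e \<tau> by (intro mult_mono) auto
        moreover have "K * (\<tau> * norm g) \<le> 1 / 8 * norm g"
          using mult_right_mono[OF \<tau>(2), of "norm g"] by (simp add: mult_ac)
        ultimately show ?thesis using cu by linarith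
      qed
      finally show ?thesis using norm_ge_zero[of g] by linarith
    qed
    then have "\<bar>(G (z + u') - g) \<bullet> g\<bar> \<le> norm g / 2 * norm g"
      using Cauchy_Schwarz_ineq2[of "G (z + u') - g" g] mult_right_mono[of "norm (G (z + u') - g)" "norm g / 2" "norm g"] by simp
    then have "g \<bullet> g - G (z + u') \<bullet> g \<le> norm g / 2 * norm g" unfolding inner_diff_left by linarith
    then have "(norm g)\<^sup>2 / 2 \<le> G (z + u') \<bullet> g"
      by (simp add: dot_square_norm power2_eq_square)
    then have "\<tau> * ((norm g)\<^sup>2 / 2) \<le> \<tau> * (G (z + u') \<bullet> g)" using \<tau>(1) by (intro mult_left_mono) auto
    moreover have "z + u - (t * \<tau>) *\<^sub>R g = z + u'" by (simp add: u'_def)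
    ultimately have "\<phi> 1 - \<phi> 0 \<le> - (\<tau> * ((norm g)\<^sup>2 / 2))" using t(3) by (simp only:) simp
    moreover have "f z \<le> \<phi> 1" "\<phi> 0 = f (z + u)" using min by (simp_all add: \<phi>_def)
    ultimately have "\<tau> / 2 * (norm g)\<^sup>2 \<le> f (z + u) - f z" by simp
    moreover have "\<tau> / 2 * (c / 2 * norm u)\<^sup>2 \<le> \<tau> / 2 * (norm g)\<^sup>2"
      using g_ge c \<tau> by (intro mult_left_mono power_mono) auto
    ultimately have "\<tau> / 2 * (c / 2 * norm u)\<^sup>2 \<le> f (z + u) - f z" by (rule order_trans[rotated])
    then show "\<tau> / 2 * (c / 2)\<^sup>2 * (norm u)\<^sup>2 \<le> f (z + u) - f z"
      by (simp only: power_mult_distrib mult.assoc)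
  qed
qed

lemma finite_if_isolated:
  fixes S :: "'a :: euclidean_space set"
  assumes "compact S" and iso: "\<And>z. z \<in> S \<Longrightarrow> \<exists>\<delta>>0. \<forall>x\<in>S. dist x z < \<delta> \<longrightarrow> x = z"
  shows "finite S"
proof (rule ccontr)
  assume "infinite S"
  then obtain z where z: "z \<in> S" "z islimpt S"
    using assms(1) unfolding compact_eq_Bolzano_Weierstrass by blast
  obtain \<delta> where "\<delta> > 0" "\<forall>x\<in>S. dist x z < \<delta> \<longrightarrow> x = z" using iso[OF z(1)] by blast
  then show False using z(2) unfolding islimpt_approachable by blast
qed

text \<open>Dyadic comparison: at distance between \<open>a (Suc n)\<close> and \<open>a n\<close>
  the integrand is at most \<open>(1 / a (Suc n)) ^ k\<close>, and the ball of radius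
  \<open>a n\<close> has volume of order \<open>a n ^ CARD('n)\<close>. The resulting series is
  geometric since \<open>k\<close> is below the dimension.\<close>

lemma nn_integral_inverse_norm_power_ball:
  fixes z :: "real ^ 'n::finite"
  assumes k: "k < CARD('n)" and \<delta>: "\<delta> > 0"
  shows "(\<integral>\<^sup>+x. ennreal (indicator (ball z \<delta>) x / norm (x - z) ^ k) \<partial>lborel) < \<infinity>"
proof -
  define a where "a n = \<delta> * (1 / 2) ^ n" for n :: nat
  have a: "a n > 0" for n using \<delta> by (simp add: a_def)
  have term_le: "g n \<le> suminf g" for g :: "nat \<Rightarrow> ennreal" and n
    using sum_le_suminf[of g "{n}"] by simp
  have "ennreal (indicator (ball z \<delta>) x / norm (x - z) ^ k) \<le> (\<Sum>n. ennreal ((1 / a (Suc n)) ^ k) * indicator (ball z (a n)) x)" for x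
  proof (cases "x \<in> ball z \<delta> \<and> x \<noteq> z")
    case True
    define r where "r = norm (x - z)"
    have r: "0 < r" "r < \<delta>" using True by (auto simp: r_def dist_norm norm_minus_commute)
    have ex: "\<exists>n. a (Suc n) \<le> r"
    proof -
      obtain n where "(1 / 2 :: real) ^ n < r / \<delta>" using real_arch_pow_inv[of "r / \<delta>" "1 / 2"] r \<delta> by auto
      moreover have "(1 / 2 :: real) ^ Suc n \<le> (1 / 2) ^ n" by simp
      ultimately have "\<delta> * (1 / 2) ^ Suc n \<le> r" using \<delta> r by (simp add: pos_less_divide_eq mult.commute)
      then show ?thesis unfolding a_def by blast
    qed
    define n where "n = (LEAST n. a (Suc n) \<le> r)"
    have n1: "a (Suc n) \<le> r" unfolding n_def by (rule LeastI_ex[OF ex])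
    have n2: "r < a n"
    proof (cases n)
      case 0
      then show ?thesis using r by (simp add: a_def)
    next
      case (Suc m)
      then have "\<not> a (Suc m) \<le> r" using not_less_Least[of m "\<lambda>n. a (Suc n) \<le> r"] by (simp add: n_def)
      then show ?thesis using Suc by simp
    qed
    have "indicator (ball z \<delta>) x / norm (x - z) ^ k = (1 / r) ^ k" using True by (simp add: r_def power_divide)
    also have "\<dots> \<le> (1 / a (Suc n)) ^ k" using n1 a[of "Suc n"] r by (intro power_mono) (auto simp: frac_le)
    finally have "ennreal (indicator (ball z \<delta>) x / norm (x - z) ^ k) \<le> ennreal ((1 / a (Suc n)) ^ k) * indicator (ball z (a n)) x"
      using n2 by (simp add: r_def dist_norm norm_minus_commute ennreal_leI)
    also have "\<dots> \<le> (\<Sum>n. ennreal ((1 / a (Suc n)) ^ k) * indicator (ball z (a n)) x)"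
      by (rule term_le)
    finally show ?thesis .
  next
    case False
    show ?thesis
    proof (cases "x = z")
      \<comment> \<open>At the centre the integrand is 0 by division by zero if \<open>k > 0\<close>
        and 1 if \<open>k = 0\<close>; the first term of the series dominates both.\<close>
      case True
      have "ennreal ((1 / a (Suc 0)) ^ k) * indicator (ball z (a 0)) x \<le> (\<Sum>n. ennreal ((1 / a (Suc n)) ^ k) * indicator (ball z (a n)) x)"
        by (rule term_le)
      moreover have "ennreal (indicator (ball z \<delta>) x / norm (x - z) ^ k) \<le> ennreal ((1 / a (Suc 0)) ^ k) * indicator (ball z (a 0)) x"
        using True \<delta> by (cases k) (auto simp: a_def)
      ultimately show ?thesis by (rule order_trans[rotated])
    qed (use False in auto)
  qed
  then have "(\<integral>\<^sup>+x. ennreal (indicator (ball z \<delta>) x / norm (x - z) ^ k) \<partial>lborel)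
     \<le> (\<integral>\<^sup>+x. (\<Sum>n. ennreal ((1 / a (Suc n)) ^ k) * indicator (ball z (a n)) x) \<partial>lborel)"
    by (intro nn_integral_mono)
  also have "\<dots> = (\<Sum>n. \<integral>\<^sup>+x. ennreal ((1 / a (Suc n)) ^ k) * indicator (ball z (a n)) x \<partial>lborel)"
  proof (rule nn_integral_suminf)
    fix n
    have [measurable]: "ball z (a n) \<in> sets borel" by simp
    show "(\<lambda>x. ennreal ((1 / a (Suc n)) ^ k) * indicator (ball z (a n)) x) \<in> borel_measurable lborel" by measurable
  qed
  also have "\<dots> = (\<Sum>n. ennreal ((1 / a (Suc n)) ^ k * (unit_ball_vol (real CARD('n)) * a n ^ CARD('n))))"
    using a by (simp add: nn_integral_cmult_indicator emeasure_ball less_imp_le ennreal_mult[symmetric] unit_ball_vol_nonneg)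
  also have "\<dots> < \<infinity>"
  proof -
    obtain d where d: "CARD('n) = k + Suc d" using k less_iff_Suc_add by auto
    define c where "c = (2 / \<delta>) ^ k * unit_ball_vol (real CARD('n)) * \<delta> ^ CARD('n)"
    have eq: "(1 / a (Suc n)) ^ k * (unit_ball_vol (real CARD('n)) * a n ^ CARD('n)) = c * ((1 / 2) ^ Suc d) ^ n" for n
    proof -
      have "1 / a (Suc n) = 2 / \<delta> * 2 ^ n" using \<delta> by (simp add: a_def field_simps)
      then have "(1 / a (Suc n)) ^ k * (unit_ball_vol (real CARD('n)) * a n ^ CARD('n))
         = c * ((2 ^ n) ^ k * ((1 / 2) ^ n) ^ CARD('n))"
        by (simp only: c_def a_def power_mult_distrib mult_ac)
      also have "(2 ^ n) ^ k * ((1 / 2 :: real) ^ n) ^ CARD('n) = (2 ^ n * (1 / 2) ^ n) ^ k * ((1 / 2) ^ n) ^ Suc d"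
        unfolding d power_add power_mult_distrib by (simp only: mult.assoc)
      also have "\<dots> = ((1 / 2) ^ Suc d) ^ n"
        by (simp add: power_one_over power_mult[symmetric] mult.commute flip: power_Suc)
      finally show ?thesis .
    qed
    have "summable (\<lambda>n. c * ((1 / 2 :: real) ^ Suc d) ^ n)"
      by (intro summable_mult summable_geometric) (simp add: power_less_one_iff power_Suc[symmetric] del: power_Suc)
    then have "(\<Sum>n. ennreal ((1 / a (Suc n)) ^ k * (unit_ball_vol (real CARD('n)) * a n ^ CARD('n)))) \<noteq> top"
      unfolding eq using \<delta> by (intro ennreal_suminf_neq_top) (auto simp: c_def unit_ball_vol_nonneg)
    then show ?thesis by (simp add: less_top)
  qed
  finally show ?thesis .
qed

text \<open>Quadratic growth isolates each minimizer, and a compact set of isolated points is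
  finite.\<close>

lemma finite_minimizers:
  fixes f :: "real ^ 'n::finite \<Rightarrow> real"
  assumes C: "Cm (Suc (Suc m)) f" and morse: "morse f" and min: "\<And>p. e \<le> f p" and S: "compact S"
  shows "finite {z \<in> S. f z = e}"
proof (rule finite_if_isolated)
  have cont: "continuous_on UNIV f"
    using C by (auto intro!: differentiable_imp_continuous_on simp: differentiable_on_def)
  have "closed (f -` {e})" using continuous_closed_preimage[OF cont closed_UNIV closed_singleton[of e]] by simp
  then have "compact (S \<inter> f -` {e})" using S by (intro compact_Int_closed) auto
  also have "S \<inter> f -` {e} = {z \<in> S. f z = e}" by auto
  finally show "compact {z \<in> S. f z = e}" .
  fix z assume "z \<in> {z \<in> S. f z = e}"
  then have z: "f z = e" by simp
  obtain c \<delta> where c: "c > 0" "\<delta> > 0" "\<And>u. norm u < \<delta> \<Longrightarrow> c * (norm u)\<^sup>2 \<le> f (z + u) - f z"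
    by (rule nondegenerate_minimum_quadratic_growth[OF C morse, of z]) (use min z in auto)
  have "x = z" if "f x = e" "dist x z < \<delta>" for x
  proof -
    have "c * (norm (x - z))\<^sup>2 \<le> 0" using c(3)[of "x - z"] that z by (simp add: dist_norm)
    then show ?thesis using c(1) by (simp add: mult_le_0_iff)
  qed
  then show "\<exists>\<delta>>0. \<forall>x\<in>{z \<in> S. f z = e}. dist x z < \<delta> \<longrightarrow> x = z" using c(2) by auto
qed

text \<open>Near a minimizer \<open>z\<close> quadratic growth bounds the integrand by a multiple of
  \<open>norm (p - z) ^ (- 2 k)\<close>, integrable for \<open>2 k\<close> below the dimension; on
  the compact rest \<open>f - e\<close> has a positive minimum. The cases used are
  \<open>k = 1\<close> for dimension at least 3 and \<open>k = 2\<close> for at least 5.\<close>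

lemma integrable_inverse_power_morse:
  fixes f :: "real ^ 'n::finite \<Rightarrow> real"
  assumes C: "Cm (Suc (Suc m)) f" and morse: "morse f" and min: "\<And>p. e \<le> f p" and k: "2 * k < CARD('n)"
  shows "integrable haar (\<lambda>p. (1 / (f p - e)) ^ k)"
proof -
  \<comment> \<open>The closed box replaces the half-open torus to gain compactness; minimizers on
    the added faces are included in \<open>Z\<close>.\<close>
  define S where "S = cbox (- vec pi) (vec pi :: real ^ 'n)"
  define Z where "Z = {z \<in> S. f z = e}"
  have finZ: "finite Z" unfolding Z_def S_def by (rule finite_minimizers[OF C morse min compact_cbox])
  have cont: "continuous_on UNIV f"
    using C by (auto intro!: differentiable_imp_continuous_on simp: differentiable_on_def)
  have [measurable]: "f \<in> borel_measurable borel" using cont by (rule borel_measurable_continuous_onI)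
  have "\<forall>z\<in>Z. \<exists>c \<delta>. c > 0 \<and> \<delta> > 0 \<and> (\<forall>u. norm u < \<delta> \<longrightarrow> c * (norm u)\<^sup>2 \<le> f (z + u) - f z)"
  proof
    fix z assume "z \<in> Z"
    then have z: "f z = e" by (simp add: Z_def)
    obtain c \<delta> where "c > 0" "\<delta> > 0" "\<And>u. norm u < \<delta> \<Longrightarrow> c * (norm u)\<^sup>2 \<le> f (z + u) - f z"
      by (rule nondegenerate_minimum_quadratic_growth[OF C morse, of z]) (use min z in auto)
    then show "\<exists>c \<delta>. c > 0 \<and> \<delta> > 0 \<and> (\<forall>u. norm u < \<delta> \<longrightarrow> c * (norm u)\<^sup>2 \<le> f (z + u) - f z)" by blast
  qed
  then obtain c \<delta> where c: "\<And>z. z \<in> Z \<Longrightarrow> c z > 0" "\<And>z. z \<in> Z \<Longrightarrow> \<delta> z > 0"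
      "\<And>z u. z \<in> Z \<Longrightarrow> norm u < \<delta> z \<Longrightarrow> c z * (norm u)\<^sup>2 \<le> f (z + u) - f z" by metis
  define R where "R = S - (\<Union>z\<in>Z. ball z (\<delta> z))"
  have "compact R" unfolding R_def S_def by (intro compact_diff compact_cbox open_UN) auto
  obtain a where a: "a > 0" "\<And>p. p \<in> R \<Longrightarrow> a \<le> f p - e"
  proof (cases "R = {}")
    case True
    then show ?thesis using that[of 1] by auto
  next
    case False
    then obtain x where x: "x \<in> R" "\<And>p. p \<in> R \<Longrightarrow> f x \<le> f p"
      using continuous_attains_inf[OF \<open>compact R\<close>, of f] continuous_on_subset[OF cont] by blast
    have "f x \<noteq> e" using x(1) c(2) by (auto simp: R_def Z_def)
    then show ?thesis using that[of "f x - e"] x(2) min[of x] by simp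
  qed
  define D where "D p = (1 / a) ^ k + (\<Sum>z\<in>Z. (1 / c z) ^ k * (indicator (ball z (\<delta> z)) p / norm (p - z) ^ (2 * k)))" for p
  have D_nonneg: "0 \<le> (\<Sum>z\<in>Z. (1 / c z) ^ k * (indicator (ball z (\<delta> z)) p / norm (p - z) ^ (2 * k)))" for p
    using c(1) by (intro sum_nonneg mult_nonneg_nonneg) (auto simp: less_imp_le)
  have le: "(1 / (f p - e)) ^ k \<le> D p" if p: "p \<in> S" for p
  proof (cases "p \<in> R")
    case True
    have "(1 / (f p - e)) ^ k \<le> (1 / a) ^ k" using a(2)[OF True] a(1) by (intro power_mono frac_le) auto
    then show ?thesis using D_nonneg[of p] by (simp add: D_def)
  next
    case False
    then obtain z where z: "z \<in> Z" "p \<in> ball z (\<delta> z)" using p by (auto simp: R_def)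
    have le1: "(1 / (f p - e)) ^ k \<le> (1 / c z) ^ k * (indicator (ball z (\<delta> z)) p / norm (p - z) ^ (2 * k))"
    proof (cases "p = z")
      case True
      then show ?thesis using z c(1)[OF z(1)] by (cases k) (auto simp: Z_def)
    next
      case False
      have "c z * (norm (p - z))\<^sup>2 \<le> f p - e"
        using c(3)[OF z(1), of "p - z"] z by (simp add: dist_norm norm_minus_commute Z_def)
      then have "(1 / (f p - e)) ^ k \<le> (1 / (c z * (norm (p - z))\<^sup>2)) ^ k"
        using c(1)[OF z(1)] False min[of p] by (intro power_mono frac_le) auto
      also have "\<dots> = (1 / c z) ^ k * (indicator (ball z (\<delta> z)) p / norm (p - z) ^ (2 * k))"
        using z(2) by (simp add: power_divide power_mult_distrib power_mult)
      finally show ?thesis .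
    qed
    also have "\<dots> \<le> (\<Sum>z\<in>Z. (1 / c z) ^ k * (indicator (ball z (\<delta> z)) p / norm (p - z) ^ (2 * k)))"
      by (rule member_le_sum[OF z(1)]) (use finZ c(1) in \<open>auto simp: less_imp_le\<close>)
    also have "\<dots> \<le> D p" using a by (simp add: D_def)
    finally show ?thesis .
  qed
  have intD: "integrable lborel (\<lambda>p. indicator S p * D p)"
  proof -
    have 1: "integrable lborel (\<lambda>p. indicator (ball z (\<delta> z)) p / norm (p - z) ^ (2 * k))" if "z \<in> Z" for z
    proof (rule integrableI_nonneg)
      show "(\<integral>\<^sup>+p. ennreal (indicator (ball z (\<delta> z)) p / norm (p - z) ^ (2 * k)) \<partial>lborel) < \<infinity>"
        by (rule nn_integral_inverse_norm_power_ball[OF k c(2)[OF that]])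
      have [measurable]: "ball z (\<delta> z) \<in> sets borel" by simp
      show "(\<lambda>p. indicator (ball z (\<delta> z)) p / norm (p - z) ^ (2 * k)) \<in> borel_measurable lborel" by measurable
    qed auto
    have 2: "integrable lborel (\<lambda>p. (1 / a) ^ k * indicator S p)"
    proof (intro integrable_mult_right integrable_real_indicator)
      show "emeasure lborel S < \<infinity>" unfolding S_def by (rule emeasure_lborel_cbox_finite)
    qed (simp add: S_def)
    have "integrable lborel (\<lambda>p. (1 / a) ^ k * indicator S p +
         (\<Sum>z\<in>Z. (1 / c z) ^ k * (indicator (ball z (\<delta> z)) p / norm (p - z) ^ (2 * k))))"
      by (intro Bochner_Integration.integrable_add 2 Bochner_Integration.integrable_sum integrable_mult_right 1)
    then show ?thesis
    proof (rule Bochner_Integration.integrable_bound)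
      have "D \<in> borel_measurable lborel" unfolding D_def
        by (intro borel_measurable_add borel_measurable_const borel_measurable_sum borel_measurable_times)
          (use borel_measurable_integrable[OF 1] in auto)
      moreover have "indicator S \<in> borel_measurable (lborel :: (real ^ 'n) measure)" by (simp add: S_def)
      ultimately show "(\<lambda>p. indicator S p * D p) \<in> borel_measurable lborel" by (intro borel_measurable_times)
      show "AE p in lborel. norm (indicator S p * D p) \<le> norm ((1 / a) ^ k * indicator S p +
         (\<Sum>z\<in>Z. (1 / c z) ^ k * (indicator (ball z (\<delta> z)) p / norm (p - z) ^ (2 * k))))"
        using D_nonneg a by (intro AE_I2) (auto simp: D_def indicator_def abs_of_nonneg)
    qed
  qed
  have "integrable lborel (\<lambda>p. (indicator torus p / (2 * pi) ^ CARD('n)) *\<^sub>R (1 / (f p - e)) ^ k)"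
  proof (rule Bochner_Integration.integrable_bound)
    show "integrable lborel (\<lambda>p. (1 / (2 * pi) ^ CARD('n)) *\<^sub>R (indicator S p * D p))" using intD by simp
    show "AE p in lborel. norm ((indicator torus p / (2 * pi) ^ CARD('n)) *\<^sub>R (1 / (f p - e)) ^ k)
        \<le> norm ((1 / (2 * pi) ^ CARD('n)) *\<^sub>R (indicator S p * D p))"
    proof (rule AE_I2)
      fix p :: "real ^ 'n"
      show "norm ((indicator torus p / (2 * pi) ^ CARD('n)) *\<^sub>R (1 / (f p - e)) ^ k)
        \<le> norm ((1 / (2 * pi) ^ CARD('n)) *\<^sub>R (indicator S p * D p))"
      proof (cases "p \<in> torus")
        case True
        then have "p \<in> S" by (auto simp: S_def torus_def mem_box_cart less_imp_le)
        then have "(1 / (f p - e)) ^ k \<le> D p" "0 \<le> (1 / (f p - e)) ^ k" using le min[of p] by auto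
        then show ?thesis using True \<open>p \<in> S\<close> by (simp add: abs_mult divide_right_mono)
      qed simp
    qed
  qed measurable
  then show ?thesis unfolding haar_def by (subst integrable_density) auto
qed

section \<open>The Birman--Schwinger principle at the threshold\<close>

lemma ell1_mult_bounded:
  fixes f g :: "'a \<Rightarrow> complex"
  assumes "integrable counting f" "\<And>x. cmod (g x) \<le> C"
  shows "integrable counting (\<lambda>x. f x * g x)"
proof (rule integrable_counting_bound)
  show "integrable counting (\<lambda>x. C *\<^sub>R f x)" using assms(1) by simp
  show "norm (f x * g x) \<le> norm (C *\<^sub>R f x)" for x
    using mult_left_mono[OF assms(2), of "cmod (f x)" x] order_trans[OF norm_ge_zero assms(2)[of x]]
    by (simp add: norm_mult mult.commute)
qed

lemma sqsum_cmod_le: assumes "sqsum f" shows "cmod (f x) \<le> sqrt (nsq f)"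
  using cmod_sq_le_nsq[OF assms, of x] by (simp add: real_le_rsqrt)

lemma even_fun_uminus: "even_fun f \<Longrightarrow> f (- x) = f x"
  by (simp add: even_fun_def)

lemma bij_uminus [simp]: "bij (uminus :: 'a :: group_add \<Rightarrow> 'a)"
  by (rule bij_betw_byWitness[where f' = uminus]) auto

lemma integral_counting_reflect: 
  fixes f :: "'a :: group_add \<Rightarrow> 'c :: {banach, second_countable_topology}"
  shows "(\<integral>s. f (- s) \<partial>counting) = (\<integral>s. f s \<partial>counting)"
  by (rule integral_counting_bij(1)[OF bij_uminus])

lemma ft_one: "ft (\<lambda>_. 1 :: complex) x = (if x = (0 :: int ^ 'n::finite) then 1 else 0)"
  by (simp add: ft_def integral_haar_cis)

text \<open>Convolution with the transform of the constant 1, a unit mass at 0, reproduces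
  \<open>g\<close>.\<close>

lemma ft_dft:
  fixes g :: "int ^ 'n::finite \<Rightarrow> complex"
  assumes "integrable counting g" shows "ft (dft g) x = g x"
proof -
  have "(\<integral>y. ft (\<lambda>_. 1) (x - y) * g y \<partial>counting) = ft (\<lambda>q. 1 * dft g q) x"
    by (rule ft_convolution[OF haar.integrable_const assms])
  also have "(\<integral>y. ft (\<lambda>_. 1) (x - y) * g y \<partial>counting) = (\<Sum>y\<in>{x}. ft (\<lambda>_. 1) (x - y) * g y)"
    by (rule integral_counting_finite_support(2)) (auto simp: ft_one)
  finally show ?thesis by (simp add: ft_one)
qed

lemma ft_cong_AE: "\<phi> \<in> borel_measurable borel \<Longrightarrow> \<psi> \<in> borel_measurable borel \<Longrightarrow> AE q in haar. \<phi> q = \<psi> q \<Longrightarrow> ft \<phi> x = ft \<psi> x"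
  for \<phi> \<psi> :: "real ^ 'n::finite \<Rightarrow> complex"
  unfolding ft_def by (rule integral_cong_AE) auto

lemma integrable_haar_bounded_mult:
  fixes \<phi> \<psi> :: "real ^ 'n::finite \<Rightarrow> complex"
  assumes "integrable haar \<phi>" "\<psi> \<in> borel_measurable borel" "\<And>q. cmod (\<psi> q) \<le> C"
  shows "integrable haar (\<lambda>q. \<phi> q * \<psi> q)"
proof (rule Bochner_Integration.integrable_bound)
  have [measurable]: "\<phi> \<in> borel_measurable borel" "\<psi> \<in> borel_measurable borel"
    using borel_measurable_integrable[OF assms(1)] assms(2) by auto
  show "integrable haar (\<lambda>q. C *\<^sub>R \<phi> q)" using assms(1) by simp
  show "(\<lambda>q. \<phi> q * \<psi> q) \<in> borel_measurable haar" by measurable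
  show "AE q in haar. norm (\<phi> q * \<psi> q) \<le> norm (C *\<^sub>R \<phi> q)"
  proof (rule AE_I2)
    fix q
    show "norm (\<phi> q * \<psi> q) \<le> norm (C *\<^sub>R \<phi> q)"
      using mult_left_mono[OF assms(3), of "cmod (\<phi> q)" q] order_trans[OF norm_ge_zero assms(3)[of q]]
      by (simp add: norm_mult mult.commute)
  qed
qed

lemma integrable_haar_dft: "integrable counting g \<Longrightarrow> integrable haar (dft g)" for g :: "int ^ 'n::finite \<Rightarrow> complex"
  by (rule haar.integrable_const_bound[OF AE_I2[OF norm_dft_le]]) simp

definition exhaustion :: "nat \<Rightarrow> ('a :: countable) set" where
  "exhaustion n = {x. to_nat x \<le> n}"

lemma finite_exhaustion: "finite (exhaustion n :: 'a :: countable set)"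
proof -
  have "(exhaustion n :: 'a set) = to_nat -` {..n}" by (auto simp: exhaustion_def)
  then show ?thesis by (simp only:) (rule finite_vimageI[OF finite_atMost inj_to_nat])
qed

text \<open>Finitely supported approximants: identities that need summable functions are proved for
  them and carried to square-summable ones by dominated convergence.\<close>

definition trunc :: "nat \<Rightarrow> ('a :: countable \<Rightarrow> complex) \<Rightarrow> 'a \<Rightarrow> complex" where
  "trunc n f x = (if x \<in> exhaustion n then f x else 0)"

lemma trunc_tendsto: "(\<lambda>n. trunc n f x) \<longlonglongrightarrow> f x"
  by (rule tendsto_eventually, rule eventually_sequentiallyI[of "to_nat x"]) (simp add: trunc_def exhaustion_def)

lemma trunc_le: "cmod (trunc n f x) \<le> cmod (f x)"
  by (simp add: trunc_def)

lemma trunc_ell1: "integrable counting (trunc n f)"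
  by (rule integral_counting_finite_support(1)[OF finite_exhaustion[of n]]) (simp add: trunc_def)

section \<open>The shifted operators, the threshold resolvent and the form of
  \<open>1 - B\<close>\<close>

text \<open>Abstracts the dispersion relation to the coefficients \<open>b\<close> of the shifted
  symbol \<open>w\<close>. The Morse property and the dimension are represented by
  \<open>zeros\<close> and \<open>winv\<close>.\<close>

locale threshold =
  fixes b :: "int ^ 'n::finite \<Rightarrow> real" and w :: "real ^ 'n \<Rightarrow> real" and v :: "int ^ 'n \<Rightarrow> real" and \<mu> :: real
  assumes b: "integrable counting b" and b_even: "\<And>x. b (- x) = b x"
    and w: "\<And>p. of_real (w p) = dft (\<lambda>x. of_real (b x)) p"
    and w_nonneg: "\<And>p. 0 \<le> w p"
    and zeros: "finite {z. (\<forall>j. \<bar>z $ j\<bar> \<le> 2 * pi) \<and> w z = 0}"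
    and winv: "integrable haar (\<lambda>p. 1 / w p)"
    and v: "integrable counting v" and v_even: "\<And>x. v (- x) = v x" and v_nonpos: "\<And>x. v x \<le> 0"
    and \<mu>: "\<mu> > 0"
begin

definition bc :: "int ^ 'n \<Rightarrow> complex" where "bc x = of_real (b x)"

definition W :: "(int ^ 'n \<Rightarrow> complex) \<Rightarrow> int ^ 'n \<Rightarrow> complex" where
  "W f x = (\<integral>s. bc (x - s) * f s \<partial>counting)"

definition res :: "real ^ 'n \<Rightarrow> complex" where "res q = of_real (1 / w q)"

definition Rop :: "(int ^ 'n \<Rightarrow> complex) \<Rightarrow> int ^ 'n \<Rightarrow> complex" where
  "Rop g x = (\<integral>y. ft res (x - y) * g y \<partial>counting)"

definition rv :: "int ^ 'n \<Rightarrow> real" where "rv x = sqrt (\<mu> * \<bar>v x\<bar>)"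

definition S :: "(int ^ 'n \<Rightarrow> complex) \<Rightarrow> int ^ 'n \<Rightarrow> complex" where "S f x = of_real (rv x) * f x"

definition H' :: "(int ^ 'n \<Rightarrow> complex) \<Rightarrow> int ^ 'n \<Rightarrow> complex" where
  "H' f x = W f x + of_real (\<mu> * v x) * f x"

definition B :: "(int ^ 'n \<Rightarrow> complex) \<Rightarrow> int ^ 'n \<Rightarrow> complex" where "B f = S (Rop (S f))"

definition B' :: "(int ^ 'n \<Rightarrow> complex) \<Rightarrow> int ^ 'n \<Rightarrow> complex" where "B' f x = f x - B f x"

lemma bc: "integrable counting bc"
  unfolding bc_def[abs_def] using b by (rule integrable_of_real)

lemma w_dft: "of_real (w p) = dft bc p"
  using w by (simp add: bc_def[abs_def])

lemma w_measurable [measurable]: "w \<in> borel_measurable borel"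
proof -
  have "w = (\<lambda>p. Re (dft bc p))" by (metis Re_complex_of_real w_dft ext)
  moreover have "(\<lambda>p. Re (dft bc p)) \<in> borel_measurable borel" using measurable_dft[OF bc] by measurable
  ultimately show ?thesis by simp
qed

lemma w_uminus: "w (- p) = w p"
proof -
  have "dft bc (- p) = (\<integral>s. bc (- s) * cis (- pairing (- p) (- s)) \<partial>counting)"
    unfolding dft_def by (rule integral_counting_reflect[symmetric])
  then have "complex_of_real (w (- p)) = of_real (w p)" unfolding w_dft by (simp add: bc_def b_even dft_def)
  then show ?thesis by simp
qed

lemma w_nonzero_AE: "AE q in haar. w q \<noteq> 0"
proof -
  let ?Z = "{z :: real ^ 'n. (\<forall>j. \<bar>z $ j\<bar> \<le> 2 * pi) \<and> w z = 0}"
  have "AE q in lborel. q \<notin> ?Z"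
    by (rule AE_not_in) (rule finite_imp_null_set_lborel[OF zeros])
  then have "AE q in lborel. q \<in> torus \<longrightarrow> w q \<noteq> 0"
  proof eventually_elim
    case (elim q)
    show ?case
    proof
      assume q: "q \<in> torus"
      have "\<bar>q $ j\<bar> \<le> 2 * pi" for j
      proof -
        have "- pi \<le> q $ j" "q $ j < pi" using q by (auto simp: torus_def)
        then show ?thesis using pi_gt_zero by linarith
      qed
      then show "w q \<noteq> 0" using elim by auto
    qed
  qed
  then show ?thesis unfolding haar_def
    by (subst AE_density) (auto simp: indicator_def elim!: eventually_mono split: if_splits)
qed

lemma res_integrable: "integrable haar res"
  unfolding res_def[abs_def] using winv by (rule integrable_of_real)

lemma res_measurable [measurable]: "res \<in> borel_measurable borel"
  unfolding res_def[abs_def] by measurable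

lemma W_ft: "integrable haar \<phi> \<Longrightarrow> W (ft \<phi>) x = ft (\<lambda>q. \<phi> q * of_real (w q)) x"
  unfolding W_def w_dft by (rule ft_convolution'[OF _ bc])

lemma W_integrable: "(\<And>x. cmod (f x) \<le> C) \<Longrightarrow> integrable counting (\<lambda>s. bc (x - s) * f s)"
  by (rule ell1_mult_bounded) (simp_all add: integral_counting_bij(2)[OF bij_minus_const] bc)

lemma W_diff: "(\<And>x. cmod (f x) \<le> C) \<Longrightarrow> (\<And>x. cmod (g x) \<le> D) \<Longrightarrow> W (\<lambda>x. f x - g x) x = W f x - W g x"
  unfolding W_def right_diff_distrib by (rule Bochner_Integration.integral_diff) (rule W_integrable; assumption)+

lemma W_add: "(\<And>x. cmod (f x) \<le> C) \<Longrightarrow> (\<And>x. cmod (g x) \<le> D) \<Longrightarrow> W (f + g) x = W f x + W g x"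
  unfolding W_def plus_fun_def distrib_left by (rule Bochner_Integration.integral_add) (rule W_integrable; assumption)+

lemma W_cscale: "W (cscale c f) x = c * W f x"
proof -
  have "W (cscale c f) x = (\<integral>s. c * (bc (x - s) * f s) \<partial>counting)"
    by (simp add: W_def cscale_def mult_ac)
  then show ?thesis by (simp add: W_def)
qed

lemma W_reflect: "W (\<lambda>y. f (- y)) x = W f (- x)"
proof -
  have "W (\<lambda>y. f (- y)) x = (\<integral>s. bc (x - (- s)) * f (- (- s)) \<partial>counting)"
    unfolding W_def by (rule integral_counting_reflect[symmetric])
  also have "\<dots> = W f (- x)"
    unfolding W_def by (rule Bochner_Integration.integral_cong[OF refl]) (use b_even[of "- x - _"] in \<open>simp add: bc_def add.commute\<close>)
  finally show ?thesis .
qed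

lemma W_unique:
  assumes h: "(h \<longlongrightarrow> 0) cofinite" and 0: "\<And>x. W h x = 0"
  shows "h x = 0"
proof (rule null_convolution_unique[OF bc h])
  show "(\<integral>s. bc s * h (y - s) \<partial>counting) = 0" for y
    using integral_counting_bij(1)[OF bij_minus_const[of y], of "\<lambda>s. bc s * h (y - s)"] 0[of y] by (simp add: W_def)
  have "(\<integral>s. bc s * cis (pairing z s) \<partial>counting) = of_real (w z)" for z
    using w_dft[of "- z"] by (simp add: dft_def w_uminus)
  then show "finite {z. (\<forall>j. \<bar>z $ j\<bar> \<le> 2 * pi) \<and> (\<integral>s. bc s * cis (pairing z s) \<partial>counting) = 0}"
    using zeros by simp
qed

lemma W_inj:
  assumes "(f \<longlongrightarrow> 0) cofinite" "(g \<longlongrightarrow> 0) cofinite" "\<And>x. W f x = W g x"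
  shows "f = g"
proof
  fix x
  obtain C D where "\<And>x. cmod (f x) \<le> C" "\<And>x. cmod (g x) \<le> D"
    using null_sequence_bounded[OF assms(1)] null_sequence_bounded[OF assms(2)] by metis
  then have "W (\<lambda>x. f x - g x) y = 0" for y using W_diff[of f C g D y] assms(3) by simp
  then have "f x - g x = 0" using tendsto_diff[OF assms(1,2)] by (intro W_unique[of "\<lambda>x. f x - g x"]) auto
  then show "f x = g x" by simp
qed

lemma Rop_ft: "integrable counting g \<Longrightarrow> Rop g x = ft (\<lambda>q. res q * dft g q) x"
  unfolding Rop_def by (rule ft_convolution[OF res_integrable])

lemma Rop_null: "integrable counting g \<Longrightarrow> (Rop g \<longlongrightarrow> 0) cofinite"
proof -
  assume g: "integrable counting g"
  have "Rop g = ft (\<lambda>q. res q * dft g q)" using Rop_ft[OF g] by auto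
  then show ?thesis using riemann_lebesgue[OF integrable_mult_dft[OF res_integrable g]] by simp
qed

text \<open>In momentum space \<open>res\<close> and \<open>w\<close> cancel off the finite zero set
  of \<open>w\<close>, which is null. Together with uniqueness this inverts \<open>W\<close> between
  summable functions and null sequences.\<close>

lemma W_Rop:
  assumes g: "integrable counting g" shows "W (Rop g) x = g x"
proof -
  have m [measurable]: "dft g \<in> borel_measurable borel" by (rule measurable_dft[OF g])
  have "Rop g = ft (\<lambda>q. res q * dft g q)" using Rop_ft[OF g] by auto
  then have "W (Rop g) x = ft (\<lambda>q. res q * dft g q * of_real (w q)) x"
    using W_ft[OF integrable_mult_dft[OF res_integrable g]] by simp
  also have "\<dots> = ft (dft g) x"
  proof (rule ft_cong_AE)
    show "AE q in haar. res q * dft g q * of_real (w q) = dft g q"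
      using w_nonzero_AE by eventually_elim (simp add: res_def)
  qed measurable
  finally show ?thesis by (simp add: ft_dft[OF g])
qed

text \<open>The reflection of \<open>Rop g\<close> is a null sequence solving the same equation, so
  uniqueness identifies the two.\<close>

lemma Rop_even:
  assumes g: "integrable counting g" and ev: "even_fun g" shows "even_fun (Rop g)"
proof -
  have "(\<lambda>x. Rop g (- x)) = Rop g"
  proof (rule W_inj)
    have "filterlim uminus cofinite (cofinite :: (int ^ 'n) filter)"
      unfolding filterlim_iff eventually_cofinite
    proof (intro allI impI)
      fix P :: "int ^ 'n \<Rightarrow> bool" assume "finite {y. \<not> P y}"
      from finite_vimageI[OF this, of uminus] show "finite {y. \<not> P (- y)}" by (simp add: vimage_def inj_def)
    qed
    then show "((\<lambda>x. Rop g (- x)) \<longlongrightarrow> 0) cofinite" by (rule filterlim_compose[OF Rop_null[OF g]])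
    show "W (\<lambda>x. Rop g (- x)) x = W (Rop g) x" for x
      using ev by (simp add: W_reflect W_Rop[OF g] even_fun_uminus)
  qed (rule Rop_null[OF g])
  then show ?thesis unfolding even_fun_def by metis
qed

lemma Rop_unique:
  assumes "(f \<longlongrightarrow> 0) cofinite" "integrable counting g" "\<And>x. W f x = g x"
  shows "f = Rop g"
  by (rule W_inj) (simp_all add: assms Rop_null W_Rop)

lemma rv: "0 \<le> rv x" "(rv x)\<^sup>2 = \<mu> * \<bar>v x\<bar>" "(rv x)\<^sup>2 = - (\<mu> * v x)"
proof -
  have "\<mu> * v x \<le> 0" using \<mu> v_nonpos[of x] by (simp add: mult_nonneg_nonpos)
  then show "0 \<le> rv x" "(rv x)\<^sup>2 = \<mu> * \<bar>v x\<bar>" "(rv x)\<^sup>2 = - (\<mu> * v x)"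
    using \<mu> v_nonpos[of x] by (simp_all add: rv_def)
qed

lemma rv_even: "rv (- x) = rv x" by (simp add: rv_def v_even)

lemma rv_sq_integrable: "integrable counting (\<lambda>x. (rv x)\<^sup>2)"
  unfolding rv(3) using v by simp

definition V1 :: real where "V1 = (\<integral>x. (rv x)\<^sup>2 \<partial>counting)"

lemma rv_sq_le: "(rv x)\<^sup>2 \<le> V1"
  using sum_le_integral_counting[OF rv_sq_integrable, of "{x}"] by (simp add: V1_def)

lemma V1_nonneg: "0 \<le> V1" by (rule order_trans[OF zero_le_power2 rv_sq_le])

text \<open>The weights \<open>rv\<close> are square-summable. Hence \<open>S\<close> takes bounded
  functions to square-summable ones, and by \<open>S_ell1\<close> the latter to summable ones, which
  is the domain where \<open>Rop\<close> is controlled.\<close>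

lemma S_sqsum: "(\<And>x. cmod (f x) \<le> C) \<Longrightarrow> sqsum (S f)"
  unfolding sqsum_def
proof (rule integrable_counting_bound)
  assume C: "\<And>x. cmod (f x) \<le> C"
  show "integrable counting (\<lambda>x. C\<^sup>2 * (rv x)\<^sup>2)" using rv_sq_integrable by simp
  show "norm ((cmod (S f x))\<^sup>2) \<le> norm (C\<^sup>2 * (rv x)\<^sup>2)" for x
    using power_mono[OF C, of x 2] mult_right_mono[OF power_mono[OF C, of x 2], of "(rv x)\<^sup>2"]
    by (simp add: S_def norm_mult power_mult_distrib mult.commute)
qed

lemma S_ell1: assumes f: "sqsum f" shows "integrable counting (S f)" "integrable counting (\<lambda>x. rv x * cmod (f x))"
proof -
  show 1: "integrable counting (\<lambda>x. rv x * cmod (f x))"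
    by (rule integrable_sq_mult[OF rv_sq_integrable]) (use f in \<open>simp add: sqsum_def\<close>)
  show "integrable counting (S f)"
    by (rule integrable_counting_bound[OF 1]) (simp add: S_def norm_mult rv)
qed

lemma S_ell1_norm: assumes f: "sqsum f" shows "(\<integral>x. cmod (S f x) \<partial>counting)\<^sup>2 \<le> V1 * nsq f"
proof -
  let ?r = "\<lambda>x. complex_of_real (rv x)" and ?f = "\<lambda>x. complex_of_real (cmod (f x))"
  have r: "sqsum ?r" "nsq ?r = V1" using rv_sq_integrable by (simp_all add: sqsum_def nsq_def V1_def)
  have f': "sqsum ?f" "nsq ?f = nsq f" using f by (simp_all add: sqsum_def nsq_def)
  have "ip ?r ?f = (\<integral>x. complex_of_real (cmod (S f x)) \<partial>counting)"
    unfolding ip_def by (rule Bochner_Integration.integral_cong[OF refl]) (simp add: S_def norm_mult rv)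
  then have "ip ?r ?f = complex_of_real (\<integral>x. cmod (S f x) \<partial>counting)" by simp
  then show ?thesis using ip_cauchy_schwarz[OF r(1) f'(1)] r(2) f'(2) by simp
qed

lemma S_bounded_sqsum: "sqsum f \<Longrightarrow> sqsum (S f)"
  using S_sqsum[of f "sqrt (nsq f)"] sqsum_cmod_le[of f] by blast

lemma S_even: "even_fun f \<Longrightarrow> even_fun (S f)"
  by (simp add: even_fun_def S_def rv_even)

lemma S_ell2e: "f \<in> ell2e \<Longrightarrow> S f \<in> ell2e"
  by (simp add: ell2e_iff S_bounded_sqsum S_even)

lemma S_add: "S (f + g) = S f + S g"
  by (simp add: S_def fun_eq_iff distrib_left)

lemma S_cscale: "S (cscale c f) = cscale c (S f)"
  by (simp add: S_def fun_eq_iff cscale_def mult_ac)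

lemma S_sum: "S (\<Sum>i\<in>I. cscale (c i) (f i)) = (\<Sum>i\<in>I. cscale (c i) (S (f i)))"
  by (rule ext) (simp add: S_def sum_fun_apply cscale_def sum_distrib_left mult_ac)

lemma ip_S: "ip (S f) g = ip f (S g)"
  unfolding ip_def by (rule Bochner_Integration.integral_cong[OF refl]) (simp add: S_def)

lemma Rop_add: "integrable counting f \<Longrightarrow> integrable counting g \<Longrightarrow> Rop (f + g) = Rop f + Rop g"
  by (rule ext) (simp add: Rop_def plus_fun_def distrib_left integrable_ft_mult[OF res_integrable])

lemma Rop_cscale: "Rop (cscale c f) = cscale c (Rop f)"
proof
  fix x
  have "Rop (cscale c f) x = (\<integral>y. c * (ft res (x - y) * f y) \<partial>counting)" by (simp add: Rop_def cscale_def mult_ac)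
  then show "Rop (cscale c f) x = cscale c (Rop f) x" by (simp add: Rop_def cscale_def)
qed

text \<open>\<open>Rop (S f)\<close> is only known to be a null sequence, hence bounded; the outer
  factor \<open>S\<close> restores square summability.\<close>

lemma B_ell2e: assumes f: "f \<in> ell2e" shows "B f \<in> ell2e"
proof -
  have g: "integrable counting (S f)" "even_fun (S f)" using f S_ell1 S_even by (auto simp: ell2e_iff)
  obtain C where C: "\<And>x. cmod (Rop (S f) x) \<le> C" using null_sequence_bounded[OF Rop_null[OF g(1)]] by metis
  show ?thesis unfolding B_def by (simp add: ell2e_iff S_sqsum[OF C] S_even Rop_even g)
qed

text \<open>The quadratic form of the threshold resolvent in momentum space. It is finite on
  summable \<open>g\<close> even where \<open>Rop g\<close> fails to be square-summable.\<close>

definition formR :: "(int ^ 'n \<Rightarrow> complex) \<Rightarrow> real" where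
  "formR g = (\<integral>q. (cmod (dft g q))\<^sup>2 / w q \<partial>haar)"

lemma dft_sq_le: "(cmod (dft g q))\<^sup>2 \<le> (\<integral>y. cmod (g y) \<partial>counting)\<^sup>2"
  by (intro power_mono norm_dft_le) simp

lemma formR_integrable: assumes g: "integrable counting g" shows "integrable haar (\<lambda>q. (cmod (dft g q))\<^sup>2 / w q)"
proof (rule Bochner_Integration.integrable_bound)
  let ?C = "(\<integral>y. cmod (g y) \<partial>counting)"
  show "integrable haar (\<lambda>q. ?C\<^sup>2 * (1 / w q))" using winv by (rule integrable_mult_right)
  have [measurable]: "dft g \<in> borel_measurable borel" by (rule measurable_dft[OF g])
  show "(\<lambda>q. (cmod (dft g q))\<^sup>2 / w q) \<in> borel_measurable haar" by measurable
  show "AE q in haar. norm ((cmod (dft g q))\<^sup>2 / w q) \<le> norm (?C\<^sup>2 * (1 / w q))"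
    using w_nonneg dft_sq_le[of g] by (intro AE_I2) (simp add: divide_right_mono)
qed

lemma formR_le: assumes g: "integrable counting g" shows "formR g \<le> (\<integral>y. cmod (g y) \<partial>counting)\<^sup>2 * (\<integral>q. 1 / w q \<partial>haar)"
proof -
  have "formR g \<le> (\<integral>q. (\<integral>y. cmod (g y) \<partial>counting)\<^sup>2 * (1 / w q) \<partial>haar)"
    unfolding formR_def
  proof (rule integral_mono[OF formR_integrable[OF g] integrable_mult_right[OF winv]])
    show "(cmod (dft g q))\<^sup>2 / w q \<le> (\<integral>y. cmod (g y) \<partial>counting)\<^sup>2 * (1 / w q)" for q
      using divide_right_mono[OF dft_sq_le w_nonneg] by simp
  qed
  then show ?thesis by (simp only: integral_mult_right_zero)
qed

lemma ip_Rop: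
  assumes f: "integrable counting f" and g: "integrable counting g"
  shows "ip (Rop f) g = (\<integral>q. res q * dft f q * cnj (dft g q) \<partial>haar)"
proof -
  have "Rop f = ft (\<lambda>q. res q * dft f q)" using Rop_ft[OF f] by auto
  then show ?thesis unfolding ip_def using integral_ft_mult_cnj[OF integrable_mult_dft[OF res_integrable f] g] by simp
qed

lemma ip_Rop_self: "integrable counting g \<Longrightarrow> ip (Rop g) g = of_real (formR g)"
proof -
  assume g: "integrable counting g"
  have "res q * dft g q * cnj (dft g q) = complex_of_real ((cmod (dft g q))\<^sup>2 / w q)" for q
    unfolding mult.assoc complex_norm_square[symmetric] by (simp add: res_def)
  then show ?thesis unfolding ip_Rop[OF g g] formR_def by (simp only: integral_complex_of_real)
qed

lemma qform_B': assumes f: "f \<in> ell2e" shows "qform B' f = nsq f - formR (S f)"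
proof -
  have s: "sqsum f" "sqsum (B f)" using f B_ell2e[OF f] by (auto intro: ell2e_sqsum)
  have "B' f = f + cscale (-1) (B f)" by (simp add: fun_eq_iff B'_def cscale_def)
  then have "ip (B' f) f = ip f f + - 1 * ip (B f) f"
    using s by (simp only: ip_add_left ip_cscale_left sqsum_cscale)
  also have "ip (B f) f = of_real (formR (S f))"
    unfolding B_def ip_S using s by (simp add: ip_Rop_self S_ell1)
  finally show ?thesis by (simp add: qform_def ip_self)
qed

text \<open>For semicontinuity, weak convergence of \<open>u n\<close> makes \<open>S (u n)\<close>
  converge in \<open>l1\<close>, so the transforms converge pointwise with common bound
  \<open>V1\<close>; dominated convergence with majorant \<open>V1 / w\<close> shows that the
  resolvent part is weakly continuous. The remaining part is the squared norm.\<close>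

lemma B'_form: "semibounded_form B' (V1 * (\<integral>q. 1 / w q \<partial>haar))"
proof
  have eq: "B' f = f + cscale (-1) (B f)" for f by (simp add: fun_eq_iff B'_def cscale_def)
  show "B' f \<in> ell2e" if "f \<in> ell2e" for f
    unfolding eq by (intro ell2e_add ell2e_cscale B_ell2e that)
  show "B' (f + g) = B' f + B' g" if "f \<in> ell2e" "g \<in> ell2e" for f g
    using that S_ell1(1)[OF ell2e_sqsum] by (simp add: fun_eq_iff B'_def B_def S_add Rop_add)
  show "B' (cscale c f) = cscale c (B' f)" for c f
    by (rule ext, simp only: B'_def B_def S_cscale Rop_cscale) (simp add: cscale_def B'_def B_def right_diff_distrib)
  show "ip (B' f) g = ip f (B' g)" if f: "f \<in> ell2e" and g: "g \<in> ell2e" for f g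
  proof -
    have s: "sqsum f" "sqsum g" "sqsum (B f)" "sqsum (B g)" using f g B_ell2e by (auto intro: ell2e_sqsum)
    have "ip (B f) g = ip (Rop (S f)) (S g)" unfolding B_def by (rule ip_S)
    also have "\<dots> = cnj (ip (Rop (S g)) (S f))"
      unfolding ip_Rop[OF S_ell1(1)[OF s(1)] S_ell1(1)[OF s(2)]] ip_Rop[OF S_ell1(1)[OF s(2)] S_ell1(1)[OF s(1)]]
      by (subst Bochner_Integration.integral_cnj[symmetric]) (simp add: res_def mult_ac)
    also have "\<dots> = ip f (B g)" unfolding ip_cnj B_def by (rule ip_S)
    finally show ?thesis
      unfolding eq using s by (simp only: ip_add_left ip_add_right sqsum_cscale ip_cscale_left ip_cscale_right) simp
  qed
  show "- (V1 * (\<integral>q. 1 / w q \<partial>haar)) \<le> qform B' f" if f: "f \<in> ell2e" "nsq f \<le> 1" for f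
  proof -
    have i: "0 \<le> (\<integral>q. 1 / w q \<partial>haar)" by (rule integral_nonneg_AE) (use w_nonneg in auto)
    have "formR (S f) \<le> (\<integral>y. cmod (S f y) \<partial>counting)\<^sup>2 * (\<integral>q. 1 / w q \<partial>haar)"
      by (rule formR_le[OF S_ell1(1)[OF ell2e_sqsum[OF f(1)]]])
    also have "\<dots> \<le> (V1 * 1) * (\<integral>q. 1 / w q \<partial>haar)"
      using S_ell1_norm[OF ell2e_sqsum[OF f(1)]] mult_left_mono[OF f(2) V1_nonneg] i by (intro mult_right_mono) auto
    finally show ?thesis unfolding qform_B'[OF f(1)] using nsq_nonneg[of f] by linarith
  qed
  fix u :: "nat \<Rightarrow> int ^ 'n \<Rightarrow> complex" and f r
  assume u: "\<And>n. u n \<in> ell2e" "\<And>n. nsq (u n) \<le> 1" and f: "f \<in> ell2e" and lim: "\<And>x. (\<lambda>n. u n x) \<longlonglongrightarrow> f x"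
    and r: "(\<lambda>n. qform B' (u n)) \<longlonglongrightarrow> r"
  note us = ell2e_sqsum[OF u(1)] and fs = ell2e_sqsum[OF f]
  have Su: "integrable counting (S (u n))" for n by (rule S_ell1(1)[OF us])
  have Sf: "integrable counting (S f)" by (rule S_ell1(1)[OF fs])
  have [measurable]: "dft (S (u n)) \<in> borel_measurable borel" "dft (S f) \<in> borel_measurable borel" for n
    by (rule measurable_dft, rule Su Sf)+
  have l1: "(\<lambda>n. \<integral>x. cmod (u n x - f x) * rv x \<partial>counting) \<longlonglongrightarrow> 0"
    by (rule weighted_l1_pointwise_limit[OF us u(2) lim rv(1) rv_sq_integrable])
  have dl: "(\<lambda>n. dft (S (u n)) q) \<longlonglongrightarrow> dft (S f) q" for q
  proof -
    have "norm (dft (S (u n)) q - dft (S f) q) \<le> (\<integral>x. cmod (u n x - f x) * rv x \<partial>counting)" for n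
    proof -
      have "dft (S (u n)) q - dft (S f) q = dft (\<lambda>x. S (u n) x - S f x) q" using dft_diff[OF Su Sf] by simp
      also have "norm \<dots> \<le> (\<integral>x. cmod (S (u n) x - S f x) \<partial>counting)" by (rule norm_dft_le)
      also have "(\<lambda>x. cmod (S (u n) x - S f x)) = (\<lambda>x. cmod (u n x - f x) * rv x)"
      proof
        fix x
        have "S (u n) x - S f x = of_real (rv x) * (u n x - f x)" by (simp add: S_def right_diff_distrib)
        then show "cmod (S (u n) x - S f x) = cmod (u n x - f x) * rv x" by (simp add: norm_mult rv)
      qed
      finally show ?thesis .
    qed
    then have "(\<lambda>n. dft (S (u n)) q - dft (S f) q) \<longlonglongrightarrow> 0"
      by (intro Lim_null_comparison[OF always_eventually[OF allI] l1])
    then show ?thesis by (simp add: LIM_zero_iff)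
  qed
  have "(\<lambda>n. formR (S (u n))) \<longlonglongrightarrow> formR (S f)"
    unfolding formR_def
  proof (rule integral_dominated_convergence[where w = "\<lambda>q. V1 * (1 / w q)"])
    show "AE q in haar. (\<lambda>n. (cmod (dft (S (u n)) q))\<^sup>2 / w q) \<longlonglongrightarrow> (cmod (dft (S f) q))\<^sup>2 / w q"
      using w_nonzero_AE by eventually_elim (intro tendsto_intros dl)
    show "AE q in haar. norm ((cmod (dft (S (u n)) q))\<^sup>2 / w q) \<le> V1 * (1 / w q)" for n
    proof (rule AE_I2)
      fix q
      have "(cmod (dft (S (u n)) q))\<^sup>2 \<le> (\<integral>y. cmod (S (u n) y) \<partial>counting)\<^sup>2" by (intro power_mono norm_dft_le) simp
      also have "\<dots> \<le> V1 * 1" using S_ell1_norm[OF us, of n] mult_left_mono[OF u(2) V1_nonneg, of n] by linarith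
      finally show "norm ((cmod (dft (S (u n)) q))\<^sup>2 / w q) \<le> V1 * (1 / w q)"
        using w_nonneg[of q] by (simp add: divide_right_mono)
    qed
    show "integrable haar (\<lambda>q. V1 * (1 / w q))" using winv by (rule integrable_mult_right)
  qed measurable
  moreover have "(\<lambda>n. Re (ip (u n) f)) \<longlonglongrightarrow> Re (ip f f)"
    by (intro tendsto_Re ip_pointwise_limit[OF us u(2) lim fs])
  ultimately have "(\<lambda>n. 2 * Re (ip (u n) f) - nsq f - formR (S (u n))) \<longlonglongrightarrow> 2 * Re (ip f f) - nsq f - formR (S f)"
    by (intro tendsto_diff tendsto_mult tendsto_const)
  \<comment> \<open>Semicontinuity of the norm: a convex functional lies above its tangent at
    \<open>f\<close>, which is weakly continuous.\<close>
  moreover have "2 * Re (ip (u n) f) - nsq f - formR (S (u n)) \<le> qform B' (u n)" for n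
  proof -
    have "0 \<le> nsq (u n + cscale (-1) f)" by simp
    also have "\<dots> = nsq (u n) - 2 * Re (ip (u n) f) + nsq f"
      unfolding nsq_add[OF us sqsum_cscale[OF fs]] ip_cscale_right nsq_cscale by simp
    finally show ?thesis by (simp add: qform_B'[OF u(1)])
  qed
  ultimately have "2 * Re (ip f f) - nsq f - formR (S f) \<le> r"
    using r by (intro LIMSEQ_le[of _ _ "\<lambda>n. qform B' (u n)"]) auto
  then show "qform B' f \<le> r" by (simp add: qform_B'[OF f] ip_self)
qed

end

section \<open>The quadratic form of the shifted Hamiltonian on square-summable functions\<close>

context threshold begin

lemma W_bounded_ell1: "sqsum f \<Longrightarrow> integrable counting (\<lambda>s. bc (x - s) * f s)"
  by (rule W_integrable[OF sqsum_cmod_le])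

definition absW :: "(int ^ 'n \<Rightarrow> complex) \<Rightarrow> int ^ 'n \<Rightarrow> real" where
  "absW f x = (\<integral>s. cmod (bc (x - s) * f s) \<partial>counting)"

lemma absW_nonneg: "0 \<le> absW f x" by (simp add: absW_def)

lemma W_le_absW: "cmod (W f x) \<le> absW f x"
  unfolding W_def absW_def by (rule integral_norm_bound)

text \<open>Young's inequality: by Cauchy--Schwarz for the weight \<open>|b (x - s)|\<close>,
  \<open>(absW f x)\<^sup>2\<close> is bounded by the \<open>\<ell>\<^sup>1\<close> norm of \<open>b\<close> times \<open>\<Sum>s. |b (x - s)| |f s|\<^sup>2\<close>.\<close>

lemma absW_sq_integrable:
  assumes f: "sqsum f" shows "integrable counting (\<lambda>x. (absW f x)\<^sup>2)"
proof -
  define C where "C = (\<integral>s. \<bar>b s\<bar> \<partial>counting)"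
  define F where "F s x = \<bar>b (x - s)\<bar> * (cmod (f s))\<^sup>2" for s x
  have babs: "integrable counting (\<lambda>s. \<bar>b s\<bar>)" using b by simp
  have F1: "integrable counting (F s)" for s
    unfolding F_def using babs integral_counting_bij(2)[OF bij_diff_const[of s], of "\<lambda>y. \<bar>b y\<bar>"] by simp
  have F2: "(\<integral>x. norm (F s x) \<partial>counting) = C * (cmod (f s))\<^sup>2" for s
    using integral_counting_bij(1)[OF bij_diff_const[of s], of "\<lambda>y. \<bar>b y\<bar>"] by (simp add: F_def abs_mult C_def)
  have F3: "integrable counting (\<lambda>s. \<integral>x. norm (F s x) \<partial>counting)"
    unfolding F2 using f by (simp add: sqsum_def)
  have G: "integrable counting (\<lambda>x. \<integral>s. F s x \<partial>counting)"
    by (rule integrable_integral_counting[OF sigma_finite_measure_count_space F1 F3])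
  have le: "(absW f x)\<^sup>2 \<le> C * (\<integral>s. F s x \<partial>counting)" for x
  proof -
    let ?p = "\<lambda>s. complex_of_real (sqrt \<bar>b (x - s)\<bar>)" and ?q = "\<lambda>s. complex_of_real (sqrt \<bar>b (x - s)\<bar> * cmod (f s))"
    have bx: "integrable counting (\<lambda>s. \<bar>b (x - s)\<bar>)" "(\<integral>s. \<bar>b (x - s)\<bar> \<partial>counting) = C"
      using babs integral_counting_bij[OF bij_minus_const[of x], of "\<lambda>y. \<bar>b y\<bar>"] by (simp_all add: C_def)
    have p: "sqsum ?p" "nsq ?p = C" using bx by (simp_all add: sqsum_def nsq_def)
    have qsq: "(cmod (?q s))\<^sup>2 = F s x" for s by (simp add: F_def norm_mult power_mult_distrib)
    have "integrable counting (\<lambda>s. F s x)"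
    proof (rule integrable_counting_bound)
      show "integrable counting (\<lambda>s. nsq f * \<bar>b (x - s)\<bar>)" using bx(1) by (rule integrable_mult_right)
      show "norm (F s x) \<le> norm (nsq f * \<bar>b (x - s)\<bar>)" for s
        using mult_left_mono[OF cmod_sq_le_nsq[OF f, of s], of "\<bar>b (x - s)\<bar>"] by (simp add: F_def abs_mult mult.commute)
    qed
    then have q: "sqsum ?q" "nsq ?q = (\<integral>s. F s x \<partial>counting)" unfolding sqsum_def nsq_def qsq by auto
    have "ip ?p ?q = (\<integral>s. complex_of_real (cmod (bc (x - s) * f s)) \<partial>counting)"
      unfolding ip_def
    proof (rule Bochner_Integration.integral_cong[OF refl])
      fix s
      have "sqrt \<bar>b (x - s)\<bar> * (sqrt \<bar>b (x - s)\<bar> * cmod (f s)) = cmod (bc (x - s) * f s)"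
        by (simp add: bc_def norm_mult mult.assoc[symmetric])
      then show "?p s * cnj (?q s) = complex_of_real (cmod (bc (x - s) * f s))"
        unfolding complex_cnj_complex_of_real of_real_mult[symmetric] by (rule arg_cong)
    qed
    then have "ip ?p ?q = complex_of_real (absW f x)" by (simp only: integral_complex_of_real absW_def)
    then show ?thesis using ip_cauchy_schwarz[OF p(1) q(1)] p(2) q(2) by (simp add: absW_nonneg)
  qed
  show ?thesis
  proof (rule integrable_counting_bound)
    show "integrable counting (\<lambda>x. C * (\<integral>s. F s x \<partial>counting))" using G by (rule integrable_mult_right)
    show "norm ((absW f x)\<^sup>2) \<le> norm (C * (\<integral>s. F s x \<partial>counting))" for x
      using le[of x] order_trans[OF zero_le_power2 le[of x]] by simp
  qed
qed

lemma absW_mult_integrable: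
  assumes "sqsum f" "sqsum g" shows "integrable counting (\<lambda>x. absW f x * cmod (g x))"
  by (rule integrable_sq_mult[OF absW_sq_integrable[OF assms(1)]]) (use assms(2) in \<open>simp add: sqsum_def\<close>)

lemma W_sqsum: assumes "sqsum f" shows "sqsum (W f)"
  unfolding sqsum_def
proof (rule integrable_counting_bound[OF absW_sq_integrable[OF assms]])
  show "norm ((cmod (W f x))\<^sup>2) \<le> norm ((absW f x)\<^sup>2)" for x
    using W_le_absW[of f x] by (simp add: power_mono)
qed

lemma W_ell2e: "f \<in> ell2e \<Longrightarrow> W f \<in> ell2e"
proof -
  assume f: "f \<in> ell2e"
  then have "(\<lambda>y. f (- y)) = f" by (auto simp: ell2e_iff even_fun_def)
  then have "W f (- x) = W f x" for x using W_reflect[of f x] by simp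
  then show ?thesis using f W_sqsum by (simp add: ell2e_iff even_fun_def)
qed

text \<open>Fubini, with \<open>absW\<close> as majorant; the kernel is real and even, hence
  hermitian.\<close>

lemma W_hermitian:
  assumes f: "sqsum f" and g: "sqsum g" shows "ip (W f) g = ip f (W g)"
proof -
  define F where "F x s = bc (x - s) * f s * cnj (g x)" for x s
  have F1: "integrable counting (F x)" for x
    unfolding F_def by (rule integrable_mult_left[OF W_bounded_ell1[OF f]])
  have "(\<integral>s. norm (F x s) \<partial>counting) = absW f x * cmod (g x)" for x
    unfolding F_def absW_def norm_mult[of "_ * _" "cnj _"] by simp
  then have F2: "integrable counting (\<lambda>x. \<integral>s. norm (F x s) \<partial>counting)"
    using absW_mult_integrable[OF f g] by simp
  have "ip (W f) g = (\<integral>x. \<integral>s. F x s \<partial>counting \<partial>counting)"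
    by (simp add: ip_def W_def F_def)
  also have "\<dots> = (\<integral>s. \<integral>x. F x s \<partial>counting \<partial>counting)"
    by (rule integral_counting_swap[OF sigma_finite_measure_count_space F1 F2])
  also have "\<dots> = ip f (W g)"
    unfolding ip_def
  proof (rule Bochner_Integration.integral_cong[OF refl])
    fix s
    have "F x s = f s * cnj (bc (s - x) * g x)" for x
      using b_even[of "s - x"] by (simp add: F_def bc_def)
    then show "(\<integral>x. F x s \<partial>counting) = f s * cnj (W g s)"
      unfolding W_def by (simp only: integral_mult_right_zero Bochner_Integration.integral_cnj)
  qed
  finally show ?thesis .
qed

lemma W_ft_w: "integrable counting f \<Longrightarrow> W f x = ft (\<lambda>q. of_real (w q) * dft f q) x"
proof -
  assume f: "integrable counting f"
  have "W f x = (\<integral>s. ft (dft bc) (x - s) * f s \<partial>counting)" unfolding W_def by (simp add: ft_dft[OF bc])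
  then show ?thesis using ft_convolution[OF integrable_haar_dft[OF bc] f, of x] by (simp add: w_dft)
qed

lemma measurable_cnj_dft: "integrable counting f \<Longrightarrow> (\<lambda>q. cnj (dft f q)) \<in> borel_measurable borel"
  for f :: "int ^ 'n \<Rightarrow> complex"
  by (rule borel_measurable_continuous_onI, rule continuous_on_cnj, rule continuous_on_dft)

lemma form_W_ell1:
  assumes f: "integrable counting f"
  shows "ip (W f) f = of_real (\<integral>q. w q * (cmod (dft f q))\<^sup>2 \<partial>haar)" "integrable haar (\<lambda>q. w q * (cmod (dft f q))\<^sup>2)"
proof -
  have wi: "integrable haar (\<lambda>q. complex_of_real (w q))" using integrable_haar_dft[OF bc] by (simp add: w_dft)
  have "W f = ft (\<lambda>q. of_real (w q) * dft f q)" using W_ft_w[OF f] by auto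
  then have "ip (W f) f = (\<integral>q. of_real (w q) * dft f q * cnj (dft f q) \<partial>haar)"
    unfolding ip_def using integral_ft_mult_cnj[OF integrable_mult_dft[OF wi f] f] by simp
  also have "(\<lambda>q. of_real (w q) * dft f q * cnj (dft f q)) = (\<lambda>q. complex_of_real (w q * (cmod (dft f q))\<^sup>2))"
    unfolding mult.assoc complex_norm_square[symmetric] of_real_mult ..
  finally show "ip (W f) f = of_real (\<integral>q. w q * (cmod (dft f q))\<^sup>2 \<partial>haar)" by (simp only: integral_complex_of_real)
  have "integrable haar (\<lambda>q. of_real (w q) * dft f q * cnj (dft f q))"
    by (rule integrable_haar_bounded_mult[OF integrable_mult_dft[OF wi f]]) (use measurable_cnj_dft[OF f] norm_dft_le[of f] in auto)
  then have "integrable haar (\<lambda>q. complex_of_real (w q * (cmod (dft f q))\<^sup>2))"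
    unfolding mult.assoc complex_norm_square[symmetric] of_real_mult .
  then have "integrable haar (\<lambda>q. Re (complex_of_real (w q * (cmod (dft f q))\<^sup>2)))" by (rule integrable_Re)
  then show "integrable haar (\<lambda>q. w q * (cmod (dft f q))\<^sup>2)" by simp
qed

text \<open>Cauchy-Schwarz in momentum space after splitting the integrand into factors weighted by
  \<open>w\<close> to the powers -1/2 and 1/2.\<close>

lemma ip_res_le_ell1:
  assumes f: "integrable counting f" and g: "integrable counting g"
  shows "(Re (ip g f))\<^sup>2 \<le> formR g * Re (ip (W f) f)"
proof (rule power2_le_mult_if_quadratic_nonneg)
  show "0 \<le> Re (ip (W f) f)" unfolding form_W_ell1[OF f]
    by (simp add: integral_nonneg_AE w_nonneg)
  have gf: "ip g f = (\<integral>q. dft g q * cnj (dft f q) \<partial>haar)"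
  proof -
    have "g = ft (dft g)" using ft_dft[OF g] by auto
    then show ?thesis unfolding ip_def using integral_ft_mult_cnj[OF integrable_haar_dft[OF g] f] by simp
  qed
  have igf: "integrable haar (\<lambda>q. dft g q * cnj (dft f q))"
    by (rule integrable_haar_bounded_mult[OF integrable_haar_dft[OF g]]) (use measurable_cnj_dft[OF f] norm_dft_le[of f] in auto)
  have igf': "integrable haar (\<lambda>q. Re (dft g q * cnj (dft f q)))" using igf by (rule integrable_Re)
  fix t :: real
  have "0 \<le> (\<integral>q. (cmod (dft g q))\<^sup>2 / w q + (2 * t) * Re (dft g q * cnj (dft f q)) + t\<^sup>2 * (w q * (cmod (dft f q))\<^sup>2) \<partial>haar)"
  proof (rule integral_nonneg_AE)
    show "AE q in haar. 0 \<le> (cmod (dft g q))\<^sup>2 / w q + (2 * t) * Re (dft g q * cnj (dft f q)) + t\<^sup>2 * (w q * (cmod (dft f q))\<^sup>2)"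
      using w_nonzero_AE
    proof eventually_elim
      case (elim q)
      define x where "x = cmod (dft g q)"
      define y where "y = cmod (dft f q)"
      have wq: "w q > 0" using elim w_nonneg[of q] by simp
      have "\<bar>Re (dft g q * cnj (dft f q))\<bar> \<le> x * y"
        using abs_Re_le_cmod[of "dft g q * cnj (dft f q)"] by (simp add: norm_mult x_def y_def)
      then have "\<bar>(2 * t) * Re (dft g q * cnj (dft f q))\<bar> \<le> 2 * \<bar>t\<bar> * (x * y)"
        unfolding abs_mult by (intro mult_mono) auto
      moreover have "0 \<le> (x - \<bar>t\<bar> * w q * y)\<^sup>2 / w q" using wq by simp
      \<comment> \<open>Completing the square shows that the quadratic polynomial in
        \<open>t\<close> is nonnegative at each \<open>q\<close>, so the discriminant criterion
        applies to the integrals.\<close>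
      moreover have "(x - \<bar>t\<bar> * w q * y)\<^sup>2 / w q = x\<^sup>2 / w q - 2 * \<bar>t\<bar> * (x * y) + t\<^sup>2 * (w q * y\<^sup>2)"
        using wq by (simp add: power2_diff power_mult_distrib field_simps power2_eq_square)
      ultimately show ?case unfolding x_def[symmetric] y_def[symmetric] by linarith
    qed
  qed
  also have "\<dots> = formR g + (2 * t) * (\<integral>q. Re (dft g q * cnj (dft f q)) \<partial>haar) + t\<^sup>2 * (\<integral>q. w q * (cmod (dft f q))\<^sup>2 \<partial>haar)"
    unfolding formR_def using formR_integrable[OF g] igf' form_W_ell1(2)[OF f]
    by (simp only: Bochner_Integration.integral_add integrable_mult_right Bochner_Integration.integrable_add integral_mult_right_zero)
  also have "(\<integral>q. Re (dft g q * cnj (dft f q)) \<partial>haar) = Re (ip g f)"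
    unfolding gf by (rule integral_Re[OF igf])
  also have "(\<integral>q. w q * (cmod (dft f q))\<^sup>2 \<partial>haar) = Re (ip (W f) f)" unfolding form_W_ell1(1)[OF f] by simp
  finally show "0 \<le> formR g + 2 * t * Re (ip g f) + t\<^sup>2 * Re (ip (W f) f)" .
qed

text \<open>Carries positivity of the form, and \<open>ip_res_le_ell1\<close>, to square-summable
  functions, whose transforms are not defined by an absolutely convergent series. Young's inequality
  makes \<open>absW f * cmod f\<close> a summable majorant.\<close>

lemma form_W_trunc:
  assumes f: "sqsum f" shows "(\<lambda>n. ip (W (trunc n f)) (trunc n f)) \<longlonglongrightarrow> ip (W f) f"
  unfolding ip_def
proof (rule integral_dominated_convergence[where w = "\<lambda>x. absW f x * cmod (f x)"])
  show "integrable counting (\<lambda>x. absW f x * cmod (f x))" by (rule absW_mult_integrable[OF f f])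
  show "AE x in counting. (\<lambda>n. W (trunc n f) x * cnj (trunc n f x)) \<longlonglongrightarrow> W f x * cnj (f x)"
  proof (rule AE_I2, intro tendsto_mult tendsto_cnj trunc_tendsto)
    fix x
    show "(\<lambda>n. W (trunc n f) x) \<longlonglongrightarrow> W f x"
      unfolding W_def
    proof (rule integral_dominated_convergence[where w = "\<lambda>s. cmod (bc (x - s) * f s)"])
      show "integrable counting (\<lambda>s. cmod (bc (x - s) * f s))" using W_bounded_ell1[OF f] by (rule integrable_norm)
      show "AE s in counting. (\<lambda>n. bc (x - s) * trunc n f s) \<longlonglongrightarrow> bc (x - s) * f s"
        by (rule AE_I2) (intro tendsto_mult tendsto_const trunc_tendsto)
      show "AE s in counting. norm (bc (x - s) * trunc n f s) \<le> cmod (bc (x - s) * f s)" for n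
        by (rule AE_I2) (simp add: norm_mult mult_left_mono trunc_le)
    qed auto
  qed
  show "AE x in counting. norm (W (trunc n f) x * cnj (trunc n f x)) \<le> absW f x * cmod (f x)" for n
  proof (rule AE_I2)
    fix x
    have tf: "sqsum (trunc n f)" by (rule sqsum_bound[OF f]) (rule trunc_le)
    have "cmod (W (trunc n f) x) \<le> absW (trunc n f) x" by (rule W_le_absW)
    also have "\<dots> \<le> absW f x" unfolding absW_def
    proof (rule integral_mono)
      show "integrable counting (\<lambda>s. cmod (bc (x - s) * trunc n f s))" using W_bounded_ell1[OF tf] by (rule integrable_norm)
      show "integrable counting (\<lambda>s. cmod (bc (x - s) * f s))" using W_bounded_ell1[OF f] by (rule integrable_norm)
      show "cmod (bc (x - s) * trunc n f s) \<le> cmod (bc (x - s) * f s)" for s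
        by (simp add: norm_mult mult_left_mono trunc_le)
    qed
    finally show "norm (W (trunc n f) x * cnj (trunc n f x)) \<le> absW f x * cmod (f x)"
      unfolding norm_mult complex_mod_cnj using trunc_le[of n f x] absW_nonneg[of f x] by (intro mult_mono) auto
  qed
qed auto

lemma form_W_nonneg: assumes f: "sqsum f" shows "0 \<le> Re (ip (W f) f)"
proof (rule LIMSEQ_le_const[OF tendsto_Re[OF form_W_trunc[OF f]]])
  have "0 \<le> Re (ip (W (trunc n f)) (trunc n f))" for n
    unfolding form_W_ell1[OF trunc_ell1] by (simp add: integral_nonneg_AE w_nonneg)
  then show "\<exists>N. \<forall>n\<ge>N. 0 \<le> Re (ip (W (trunc n f)) (trunc n f))" by blast
qed

lemma ip_res_le:
  assumes f: "sqsum f" and g: "integrable counting g"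
  shows "(Re (ip g f))\<^sup>2 \<le> formR g * Re (ip (W f) f)"
proof (rule LIMSEQ_le)
  show "(\<lambda>n. formR g * Re (ip (W (trunc n f)) (trunc n f))) \<longlonglongrightarrow> formR g * Re (ip (W f) f)"
    by (intro tendsto_mult tendsto_const tendsto_Re form_W_trunc f)
  have "(\<lambda>n. ip g (trunc n f)) \<longlonglongrightarrow> ip g f"
    unfolding ip_def
  proof (rule integral_dominated_convergence[where w = "\<lambda>x. cmod (g x * cnj (f x))"])
    show "integrable counting (\<lambda>x. cmod (g x * cnj (f x)))"
      by (rule integrable_norm, rule ell1_mult_bounded[OF g, of _ "sqrt (nsq f)"]) (simp add: sqsum_cmod_le[OF f])
    show "AE x in counting. (\<lambda>n. g x * cnj (trunc n f x)) \<longlonglongrightarrow> g x * cnj (f x)"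
      by (rule AE_I2) (intro tendsto_mult tendsto_const tendsto_cnj trunc_tendsto)
    show "AE x in counting. norm (g x * cnj (trunc n f x)) \<le> cmod (g x * cnj (f x))" for n
      by (rule AE_I2) (simp add: norm_mult mult_left_mono trunc_le)
  qed auto
  then show "(\<lambda>n. (Re (ip g (trunc n f)))\<^sup>2) \<longlonglongrightarrow> (Re (ip g f))\<^sup>2" by (intro tendsto_power tendsto_Re)
  show "\<exists>N. \<forall>n\<ge>N. (Re (ip g (trunc n f)))\<^sup>2 \<le> formR g * Re (ip (W (trunc n f)) (trunc n f))"
    using ip_res_le_ell1[OF trunc_ell1 g] by blast
qed

lemma W_add_sq: "sqsum f \<Longrightarrow> sqsum g \<Longrightarrow> W (f + g) = W f + W g"
proof
  assume f: "sqsum f" and g: "sqsum g"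
  show "W (f + g) x = (W f + W g) x" for x
    using W_add[OF sqsum_cmod_le[OF f] sqsum_cmod_le[OF g]] by simp
qed

lemma W_cscale': "W (cscale c f) = cscale c (W f)"
  by (rule ext) (simp add: W_cscale, simp add: cscale_def)

definition V :: "(int ^ 'n \<Rightarrow> complex) \<Rightarrow> int ^ 'n \<Rightarrow> complex" where "V f = S (S f)"

lemma H'_eq: "H' f = W f + cscale (-1) (V f)"
proof
  fix x
  have "complex_of_real (rv x) * (complex_of_real (rv x) * f x) = complex_of_real (- (\<mu> * v x)) * f x"
    unfolding rv(3)[of x, symmetric] by (simp add: power2_eq_square)
  then show "H' f x = (W f + cscale (-1) (V f)) x" by (simp add: H'_def V_def S_def cscale_def)
qed

lemma qform_H': assumes f: "f \<in> ell2e" shows "qform H' f = Re (ip (W f) f) - nsq (S f)"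
proof -
  have s: "sqsum (W f)" "sqsum (V f)" "sqsum f" using f W_ell2e S_ell2e by (auto intro: ell2e_sqsum simp: V_def)
  have "ip (H' f) f = ip (W f) f + - 1 * ip (V f) f"
    unfolding H'_eq using s by (simp only: ip_add_left ip_cscale_left sqsum_cscale)
  also have "ip (V f) f = of_real (nsq (S f))" unfolding V_def by (simp only: ip_S[of "S f" f] ip_self)
  finally show ?thesis by (simp add: qform_def)
qed

lemma nsq_S_le: assumes f: "sqsum f" shows "nsq (S f) \<le> V1 * nsq f"
proof -
  have "nsq (S f) \<le> (\<integral>x. nsq f * (rv x)\<^sup>2 \<partial>counting)"
    unfolding nsq_def[of "S f"]
  proof (rule integral_mono)
    show "integrable counting (\<lambda>x. (cmod (S f x))\<^sup>2)" using S_bounded_sqsum[OF f] by (simp add: sqsum_def)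
    show "integrable counting (\<lambda>x. nsq f * (rv x)\<^sup>2)" using rv_sq_integrable by (rule integrable_mult_right)
    show "(cmod (S f x))\<^sup>2 \<le> nsq f * (rv x)\<^sup>2" for x
      using mult_right_mono[OF cmod_sq_le_nsq[OF f, of x], of "(rv x)\<^sup>2"] by (simp add: S_def norm_mult power_mult_distrib mult.commute)
  qed
  then show ?thesis by (simp add: V1_def mult.commute)
qed

text \<open>The kinetic part is a nonnegative form, so it lies above its tangent at the limit; the
  potential part is weakly continuous by dominated convergence with majorant
  \<open>(rv x)^2\<close>.\<close>

lemma H'_form: "semibounded_form H' V1"
proof
  show "H' f \<in> ell2e" if "f \<in> ell2e" for f
    unfolding H'_eq V_def by (intro ell2e_add ell2e_cscale W_ell2e S_ell2e that)
  show "H' (f + g) = H' f + H' g" if "f \<in> ell2e" "g \<in> ell2e" for f g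
    using that by (simp add: fun_eq_iff H'_def W_add_sq ell2e_sqsum distrib_left)
  show "H' (cscale c f) = cscale c (H' f)" for c f
    by (rule ext, simp only: H'_def W_cscale) (simp add: cscale_def H'_def distrib_left)
  show "ip (H' f) g = ip f (H' g)" if f: "f \<in> ell2e" and g: "g \<in> ell2e" for f g
  proof -
    have s: "sqsum f" "sqsum g" "sqsum (W f)" "sqsum (W g)" "sqsum (V f)" "sqsum (V g)"
      unfolding V_def by (intro ell2e_sqsum W_ell2e S_ell2e f g)+
    have "ip (V f) g = ip f (V g)" unfolding V_def by (rule trans[OF ip_S ip_S])
    moreover have "ip (W f + cscale (-1) (V f)) g = ip (W f) g + - 1 * ip (V f) g"
      using s by (simp only: ip_add_left sqsum_cscale ip_cscale_left)
    moreover have "ip f (W g + cscale (-1) (V g)) = ip f (W g) + cnj (- 1) * ip f (V g)"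
      using s by (simp only: ip_add_right sqsum_cscale ip_cscale_right)
    ultimately show ?thesis
      unfolding H'_eq by (simp only: W_hermitian[OF s(1,2)] complex_cnj_minus complex_cnj_one)
  qed
  show "- V1 \<le> qform H' f" if f: "f \<in> ell2e" "nsq f \<le> 1" for f
    using nsq_S_le[OF ell2e_sqsum[OF f(1)]] mult_left_mono[OF f(2) V1_nonneg] form_W_nonneg[OF ell2e_sqsum[OF f(1)]]
    unfolding qform_H'[OF f(1)] by linarith
  fix u :: "nat \<Rightarrow> int ^ 'n \<Rightarrow> complex" and f r
  assume u: "\<And>n. u n \<in> ell2e" "\<And>n. nsq (u n) \<le> 1" and f: "f \<in> ell2e" and lim: "\<And>x. (\<lambda>n. u n x) \<longlonglongrightarrow> f x"
    and r: "(\<lambda>n. qform H' (u n)) \<longlonglongrightarrow> r"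
  note us = ell2e_sqsum[OF u(1)] and fs = ell2e_sqsum[OF f]
  have "(\<lambda>n. nsq (S (u n))) \<longlonglongrightarrow> nsq (S f)"
    unfolding nsq_def
  proof (rule integral_dominated_convergence[where w = "\<lambda>x. (rv x)\<^sup>2"])
    show "AE x in counting. (\<lambda>n. (cmod (S (u n) x))\<^sup>2) \<longlonglongrightarrow> (cmod (S f x))\<^sup>2"
      unfolding S_def by (rule AE_I2) (intro tendsto_intros lim)
    show "AE x in counting. norm ((cmod (S (u n) x))\<^sup>2) \<le> (rv x)\<^sup>2" for n
    proof (rule AE_I2)
      fix x
      have "(cmod (u n x))\<^sup>2 \<le> 1" using cmod_sq_le_nsq[OF us] u(2) by (rule order_trans)
      then show "norm ((cmod (S (u n) x))\<^sup>2) \<le> (rv x)\<^sup>2"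
        using mult_left_mono[of "(cmod (u n x))\<^sup>2" 1 "(rv x)\<^sup>2"] by (simp add: S_def norm_mult power_mult_distrib)
    qed
  qed (simp_all add: rv_sq_integrable)
  moreover have "(\<lambda>n. Re (ip (u n) (W f))) \<longlonglongrightarrow> Re (ip f (W f))"
    by (intro tendsto_Re ip_pointwise_limit[OF us u(2) lim W_sqsum[OF fs]])
  ultimately have "(\<lambda>n. 2 * Re (ip (u n) (W f)) - Re (ip (W f) f) - nsq (S (u n))) \<longlonglongrightarrow>
      2 * Re (ip f (W f)) - Re (ip (W f) f) - nsq (S f)"
    by (intro tendsto_diff tendsto_mult tendsto_const)
  moreover have "2 * Re (ip (u n) (W f)) - Re (ip (W f) f) - nsq (S (u n)) \<le> qform H' (u n)" for n
  proof -
    define m where "m = cscale (-1) f"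
    have m: "sqsum m" "W m = cscale (-1) (W f)" unfolding m_def by (rule sqsum_cscale[OF fs], rule W_cscale')
    \<comment> \<open>Positivity of the form at \<open>u n - f\<close> is the tangent
      inequality.\<close>
    have "0 \<le> Re (ip (W (u n + m)) (u n + m))" by (rule form_W_nonneg[OF sqsum_add[OF us m(1)]])
    also have "ip (W (u n + m)) (u n + m) = ip (W (u n)) (u n) + ip (W (u n)) m + (ip (W m) (u n) + ip (W m) m)"
      using us m(1) W_sqsum by (simp only: W_add_sq ip_add_left ip_add_right sqsum_add add_ac)
    also have "ip (W (u n)) m = - ip (u n) (W f)"
      unfolding W_hermitian[OF us m(1)] m(2) ip_cscale_right by simp
    also have "ip (W m) (u n) = - cnj (ip (u n) (W f))" unfolding m(2) ip_cscale_left ip_cnj by simp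
    also have "ip (W m) m = ip (W f) f" unfolding m(2) unfolding m_def ip_cscale_left ip_cscale_right by simp
    finally show ?thesis by (simp add: qform_H'[OF u(1)])
  qed
  ultimately have "2 * Re (ip f (W f)) - Re (ip (W f) f) - nsq (S f) \<le> r"
    using r by (intro LIMSEQ_le[of _ _ "\<lambda>n. qform H' (u n)"]) auto
  then show "qform H' f \<le> r" by (simp add: qform_H'[OF f] W_hermitian[OF fs fs])
qed

end

section \<open>Transfer of negative subspaces between the two forms\<close>

lemma ip_orthonormal_sums:
  fixes e :: "nat \<Rightarrow> int ^ 'n::finite \<Rightarrow> complex"
  assumes e: "\<And>i. i < N \<Longrightarrow> e i \<in> ell2e"
    and on: "\<And>i j. i < N \<Longrightarrow> j < N \<Longrightarrow> ip (e i) (e j) = (if i = j then 1 else 0)"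
  shows "ip (\<Sum>i<N. cscale (a i) (e i)) (\<Sum>j<N. cscale (c j) (e j)) = (\<Sum>i<N. a i * cnj (c i))"
proof -
  have ce: "cscale (x i) (e i) \<in> ell2e" if "i \<in> {..<N}" for x i using e that by (auto intro: ell2e_cscale)
  have "ip (\<Sum>i<N. cscale (a i) (e i)) (\<Sum>j<N. cscale (c j) (e j))
      = (\<Sum>i<N. ip (cscale (a i) (e i)) (\<Sum>j<N. cscale (c j) (e j)))"
    by (rule ip_sum_left[OF ce ell2e_sum[OF ce]])
  also have "\<dots> = (\<Sum>i<N. a i * cnj (c i))"
  proof (rule sum.cong[OF refl])
    fix i assume i: "i \<in> {..<N}"
    have "ip (cscale (a i) (e i)) (\<Sum>j<N. cscale (c j) (e j)) = (\<Sum>j<N. ip (cscale (a i) (e i)) (cscale (c j) (e j)))"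
      by (rule ip_sum_right[OF ce ce[OF i]])
    also have "\<dots> = (\<Sum>j<N. if j = i then a i * cnj (c i) else 0)"
    proof (rule sum.cong[OF refl])
      fix j assume "j \<in> {..<N}"
      then show "ip (cscale (a i) (e i)) (cscale (c j) (e j)) = (if j = i then a i * cnj (c i) else 0)"
        using on[of i j] i by (simp add: ip_cscale_left ip_cscale_right)
    qed
    also have "\<dots> = a i * cnj (c i)" using i by simp
    finally show "ip (cscale (a i) (e i)) (\<Sum>j<N. cscale (c j) (e j)) = a i * cnj (c i)" .
  qed
  finally show ?thesis .
qed

lemma enat_eqI:
  assumes "\<And>N. enat N \<le> x \<longleftrightarrow> enat N \<le> y" shows "x = y"
proof -
  have le: "x \<le> y" if xy: "\<And>N. enat N \<le> x \<Longrightarrow> enat N \<le> y" for x y :: enat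
  proof (cases y)
    case (enat m)
    have "\<not> enat (Suc m) \<le> x" using xy[of "Suc m"] enat by auto
    then show ?thesis using enat by (simp add: Suc_ile_eq not_less)
  qed simp
  show ?thesis by (rule antisym) (rule le, simp add: assms)+
qed

context threshold begin

text \<open>For \<open>f\<close> in the negative space put \<open>n = nsq (S f)\<close>,
  \<open>P\<close> the form of \<open>W\<close> at \<open>f\<close> and \<open>R\<close> the
  resolvent form at \<open>S (S f)\<close>. Then \<open>P < n\<close>, and the weighted
  Cauchy-Schwarz inequality gives \<open>n^2 \<le> R * P\<close>. Hence \<open>R > n\<close>, which
  says that the form of \<open>1 - B\<close> is negative at \<open>S f\<close>.\<close>

lemma neg_family_H_imp_B:
  assumes "neg_family H' N" shows "neg_family B' N"
proof -
  obtain e where e: "\<And>i. i < N \<Longrightarrow> e i \<in> ell2e"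
    "\<And>c. (\<exists>i<N. c i \<noteq> 0) \<Longrightarrow> qform H' (\<Sum>i<N. cscale (c i) (e i)) < 0"
    using assms unfolding neg_family_def by auto
  show ?thesis unfolding neg_family_def
  proof (intro exI[of _ "\<lambda>i. S (e i)"] conjI allI impI)
    show "S (e i) \<in> ell2e" if "i < N" for i by (rule S_ell2e[OF e(1)[OF that]])
    fix c :: "nat \<Rightarrow> complex" assume c: "\<exists>i<N. c i \<noteq> 0"
    define f where "f = (\<Sum>i<N. cscale (c i) (e i))"
    have f: "f \<in> ell2e" unfolding f_def by (intro ell2e_sum ell2e_cscale e(1)) simp
    note fs = ell2e_sqsum[OF f]
    have sf: "sqsum (S f)" by (rule S_bounded_sqsum[OF fs])
    define n where "n = nsq (S f)"
    define P where "P = Re (ip (W f) f)"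
    define R where "R = formR (S (S f))"
    have lt: "P < n" using e(2)[OF c] qform_H'[OF f] by (simp add: f_def[symmetric] P_def n_def)
    have P0: "0 \<le> P" unfolding P_def by (rule form_W_nonneg[OF fs])
    have "ip (S (S f)) f = of_real n" by (simp only: ip_S[of "S f" f] ip_self n_def)
    then have "n\<^sup>2 \<le> R * P"
      using ip_res_le[OF fs S_ell1(1)[OF sf]] by (simp add: R_def P_def)
    moreover have "R * P < n\<^sup>2" if "R \<le> n"
    proof -
      have "R * P \<le> n * P" using that P0 by (rule mult_right_mono)
      also have "\<dots> < n * n" using lt P0 by (intro mult_strict_left_mono) auto
      finally show ?thesis by (simp add: power2_eq_square)
    qed
    ultimately have "n < R" by fastforce
    moreover have "qform B' (S f) = n - R" by (simp add: qform_B'[OF S_ell2e[OF f]] n_def R_def)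
    ultimately show "qform B' (\<Sum>i<N. cscale (c i) (S (e i))) < 0"
      unfolding S_sum[symmetric] f_def[symmetric] by simp
  qed
qed

definition regres :: "real \<Rightarrow> real ^ 'n \<Rightarrow> complex" where "regres d q = of_real (1 / (w q + d))"

text \<open>The resolvent \<open>(W + d)^-1\<close>, written as a convolution.\<close>

definition Top :: "real \<Rightarrow> (int ^ 'n \<Rightarrow> complex) \<Rightarrow> int ^ 'n \<Rightarrow> complex" where
  "Top d g x = (\<integral>y. ft (regres d) (x - y) * g y \<partial>counting)"

lemma regres_le: "0 < d \<Longrightarrow> cmod (regres d q) \<le> 1 / d"
proof -
  assume d: "0 < d"
  have "1 / (w q + d) \<le> 1 / d" using w_nonneg[of q] d by (intro frac_le) auto
  moreover have "0 \<le> 1 / (w q + d)" using w_nonneg[of q] d by simp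
  ultimately show ?thesis unfolding regres_def norm_of_real by linarith
qed

lemma regres_measurable [measurable]: "regres d \<in> borel_measurable borel"
  unfolding regres_def[abs_def] by measurable

lemma regres_integrable: "0 < d \<Longrightarrow> integrable haar (regres d)"
  by (rule haar.integrable_const_bound[OF AE_I2[OF regres_le]]) auto

lemma Top_ft: "0 < d \<Longrightarrow> integrable counting g \<Longrightarrow> Top d g = ft (\<lambda>q. regres d q * dft g q)"
  by (rule ext) (simp add: Top_def ft_convolution[OF regres_integrable])

lemma Top_sum:
  assumes d: "0 < d" and g: "\<And>i. i \<in> I \<Longrightarrow> integrable counting (g i)"
  shows "Top d (\<Sum>i\<in>I. cscale (c i) (g i)) = (\<Sum>i\<in>I. cscale (c i) (Top d (g i)))"
proof
  fix x
  have "Top d (\<Sum>i\<in>I. cscale (c i) (g i)) x = (\<integral>y. (\<Sum>i\<in>I. c i * (ft (regres d) (x - y) * g i y)) \<partial>counting)"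
    unfolding Top_def by (rule Bochner_Integration.integral_cong[OF refl])
      (simp add: sum_fun_apply cscale_def sum_distrib_left mult_ac)
  also have "\<dots> = (\<Sum>i\<in>I. \<integral>y. c i * (ft (regres d) (x - y) * g i y) \<partial>counting)"
    by (rule Bochner_Integration.integral_sum)
      (rule integrable_mult_right, rule integrable_ft_mult[OF regres_integrable[OF d] g])
  finally show "Top d (\<Sum>i\<in>I. cscale (c i) (g i)) x = (\<Sum>i\<in>I. cscale (c i) (Top d (g i))) x"
    by (simp add: sum_fun_apply cscale_def Top_def)
qed

definition regform :: "real \<Rightarrow> (int ^ 'n \<Rightarrow> complex) \<Rightarrow> real" where
  "regform d g = (\<integral>q. (cmod (dft g q))\<^sup>2 / (w q + d) \<partial>haar)"

lemma regform_integrable: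
  assumes d: "0 < d" and g: "integrable counting g"
  shows "integrable haar (\<lambda>q. (cmod (dft g q))\<^sup>2 / (w q + d))"
proof (rule haar.integrable_const_bound)
  have [measurable]: "dft g \<in> borel_measurable borel" by (rule measurable_dft[OF g])
  show "(\<lambda>q. (cmod (dft g q))\<^sup>2 / (w q + d)) \<in> borel_measurable haar" by measurable
  show "AE q in haar. norm ((cmod (dft g q))\<^sup>2 / (w q + d)) \<le> (\<integral>y. cmod (g y) \<partial>counting)\<^sup>2 / d"
  proof (rule AE_I2)
    fix q
    have "(cmod (dft g q))\<^sup>2 / (w q + d) \<le> (\<integral>y. cmod (g y) \<partial>counting)\<^sup>2 / d"
      using dft_sq_le[of g q] w_nonneg[of q] d by (intro frac_le) auto
    then show "norm ((cmod (dft g q))\<^sup>2 / (w q + d)) \<le> (\<integral>y. cmod (g y) \<partial>counting)\<^sup>2 / d"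
      using w_nonneg[of q] d by simp
  qed
qed

lemma Top_props:
  assumes d: "0 < d" and g: "integrable counting g"
  shows "sqsum (Top d g)" "W (Top d g) x = g x - of_real d * Top d g x" "ip (Top d g) g = of_real (regform d g)"
proof -
  have gm [measurable]: "dft g \<in> borel_measurable borel" by (rule measurable_dft[OF g])
  define \<phi> where "\<phi> q = regres d q * dft g q" for q
  have \<phi>m [measurable]: "\<phi> \<in> borel_measurable borel" unfolding \<phi>_def[abs_def] by measurable
  have \<phi>: "integrable haar \<phi>" unfolding \<phi>_def[abs_def] by (rule integrable_mult_dft[OF regres_integrable[OF d] g])
  have eq: "Top d g = ft \<phi>" using Top_ft[OF d g] by (simp add: \<phi>_def[abs_def])
  have "cmod (\<phi> q) \<le> 1 / d * (\<integral>y. cmod (g y) \<partial>counting)" for q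
    unfolding \<phi>_def norm_mult by (intro mult_mono regres_le norm_dft_le d) (use d in auto)
  then have "integrable haar (\<lambda>q. (cmod (\<phi> q))\<^sup>2)"
    by (intro haar.integrable_const_bound[of _ "(1 / d * (\<integral>y. cmod (g y) \<partial>counting))\<^sup>2"]) (auto intro!: AE_I2 power_mono)
  then show "sqsum (Top d g)" unfolding eq sqsum_def by (rule integrable_ft_square[OF \<phi>m])
  have "W (Top d g) x = ft (\<lambda>q. \<phi> q * of_real (w q)) x" unfolding eq by (rule W_ft[OF \<phi>])
  also have "(\<lambda>q. \<phi> q * of_real (w q)) = (\<lambda>q. dft g q - of_real d * \<phi> q)"
  proof
    fix q
    have "w q + d \<noteq> 0" using w_nonneg[of q] d by simp
    then have "1 / (w q + d) * w q = 1 - d * (1 / (w q + d))" by (simp add: field_simps)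
    then have "regres d q * of_real (w q) = 1 - of_real d * regres d q"
      unfolding regres_def of_real_mult[symmetric] by (simp only: of_real_diff of_real_1 of_real_mult)
    then have "regres d q * of_real (w q) * dft g q = (1 - of_real d * regres d q) * dft g q" by (rule arg_cong)
    then show "\<phi> q * of_real (w q) = dft g q - of_real d * \<phi> q" by (simp add: \<phi>_def algebra_simps)
  qed
  also have "ft (\<lambda>q. dft g q - of_real d * \<phi> q) x = ft (dft g) x - ft (\<lambda>q. of_real d * \<phi> q) x"
    by (rule ft_diff) (use \<phi> integrable_haar_dft[OF g] in auto)
  also have "ft (\<lambda>q. of_real d * \<phi> q) x = of_real d * ft \<phi> x"
  proof -
    have "ft (\<lambda>q. of_real d * \<phi> q) x = (\<integral>q. of_real d * (cis (pairing q x) * \<phi> q) \<partial>haar)"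
      unfolding ft_def by (simp only: mult_ac)
    then show ?thesis by (simp only: integral_mult_right_zero ft_def)
  qed
  finally show "W (Top d g) x = g x - of_real d * Top d g x" by (simp add: eq ft_dft[OF g])
  have "ip (Top d g) g = (\<integral>q. \<phi> q * cnj (dft g q) \<partial>haar)"
    unfolding eq ip_def by (rule integral_ft_mult_cnj[OF \<phi> g])
  also have "(\<lambda>q. \<phi> q * cnj (dft g q)) = (\<lambda>q. complex_of_real ((cmod (dft g q))\<^sup>2 / (w q + d)))"
    unfolding \<phi>_def mult.assoc complex_norm_square[symmetric] regres_def of_real_mult[symmetric] by simp
  finally show "ip (Top d g) g = of_real (regform d g)" by (simp only: integral_complex_of_real regform_def)
qed

text \<open>The difference between \<open>Top d g\<close> and its reflection satisfies
  \<open>W u = - d u\<close>; as the form of \<open>W\<close> is nonnegative, it vanishes.\<close>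

lemma Top_even:
  assumes d: "0 < d" and g: "integrable counting g" and ev: "even_fun g"
  shows "even_fun (Top d g)"
proof -
  define f where "f = Top d g"
  define h where "h = (\<lambda>x. f (- x))"
  define m where "m = cscale (-1) h"
  have f: "sqsum f" unfolding f_def by (rule Top_props(1)[OF d g])
  then have h: "sqsum h"
    unfolding sqsum_def h_def using integral_counting_bij(2)[OF bij_uminus, of "\<lambda>x. (cmod (f x))\<^sup>2"] by simp
  have m: "sqsum m" unfolding m_def by (rule sqsum_cscale[OF h])
  have "W (f + m) = cscale (of_real (- d)) (f + m)"
  proof
    fix x
    have Wh: "W h x = g x - of_real d * h x"
      unfolding h_def W_reflect using Top_props(2)[OF d g, of "- x"] ev by (simp add: f_def even_fun_uminus)
    have Wf: "W f x = g x - of_real d * f x" unfolding f_def by (rule Top_props(2)[OF d g])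
    have Wfm: "W (f + m) x = W f x + W m x" using W_add_sq[OF f m] by simp
    have Wm: "W m x = - W h x" unfolding m_def W_cscale by simp
    have "W (f + m) x = of_real (- d) * (f x - h x)"
      unfolding Wfm Wm Wf Wh by (simp add: algebra_simps)
    moreover have "(f + m) x = f x - h x" by (simp add: m_def cscale_def)
    ultimately show "W (f + m) x = cscale (of_real (- d)) (f + m) x" by (simp only: cscale_def)
  qed
  then have "Re (ip (W (f + m)) (f + m)) = - d * nsq (f + m)"
    by (simp only: ip_cscale_left ip_self of_real_mult[symmetric] Re_complex_of_real)
  moreover have "0 \<le> Re (ip (W (f + m)) (f + m))" by (rule form_W_nonneg[OF sqsum_add[OF f m]])
  ultimately have "nsq (f + m) = 0" using d nsq_nonneg[of "f + m"] by (simp add: mult_le_0_iff)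
  then have "f + m = 0" using nsq_eq_0[OF sqsum_add[OF f m]] by simp
  have "f (- x) = f x" for x
  proof -
    have "(f + m) x = 0" using \<open>f + m = 0\<close> by simp
    then show ?thesis by (simp add: m_def h_def cscale_def)
  qed
  then show ?thesis by (simp add: even_fun_def f_def)
qed

text \<open>Dominated convergence with majorant \<open>1 / w\<close>. The factor \<open>V1\<close>
  anticipates that the squared transform of \<open>S \<psi>\<close> is at most
  \<open>V1 * nsq \<psi>\<close>.\<close>

lemma regularization_error:
  assumes "0 < \<gamma>"
  obtains d where "0 < d" "V1 * (\<integral>q. 1 / w q - 1 / (w q + d) \<partial>haar) < \<gamma>" "integrable haar (\<lambda>q. 1 / w q - 1 / (w q + d))"
proof -
  have bnd: "0 \<le> 1 / w q - 1 / (w q + d) \<and> 1 / w q - 1 / (w q + d) \<le> 1 / w q" if "d > 0" "w q \<noteq> 0" for q d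
  proof -
    have "w q > 0" using that w_nonneg[of q] by simp
    then show ?thesis using that by (simp add: frac_le)
  qed
  have lim: "(\<lambda>n. \<integral>q. 1 / w q - 1 / (w q + 1 / real (Suc n)) \<partial>haar) \<longlonglongrightarrow> (\<integral>q. 0 \<partial>(haar :: (real ^ 'n) measure))"
  proof (rule integral_dominated_convergence[where w = "\<lambda>q. 1 / w q"])
    show "AE q in haar. (\<lambda>n. 1 / w q - 1 / (w q + 1 / real (Suc n))) \<longlonglongrightarrow> 0"
      using w_nonzero_AE
    proof eventually_elim
      case (elim q)
      have "(\<lambda>n. 1 / real (Suc n)) \<longlonglongrightarrow> 0" using LIMSEQ_inverse_real_of_nat by (simp add: inverse_eq_divide)
      then have "(\<lambda>n. 1 / w q - 1 / (w q + 1 / real (Suc n))) \<longlonglongrightarrow> 1 / w q - 1 / (w q + 0)"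
        using elim by (intro tendsto_diff tendsto_const tendsto_divide tendsto_add) auto
      then show ?case by simp
    qed
    show "AE q in haar. norm (1 / w q - 1 / (w q + 1 / real (Suc n))) \<le> 1 / w q" for n
      using w_nonzero_AE by eventually_elim (use bnd[of "1 / real (Suc n)"] in auto)
  qed (use winv in measurable)
  then have "(\<lambda>n. V1 * (\<integral>q. 1 / w q - 1 / (w q + 1 / real (Suc n)) \<partial>haar)) \<longlonglongrightarrow> V1 * 0"
    by (intro tendsto_mult tendsto_const) simp
  then have "eventually (\<lambda>n. V1 * (\<integral>q. 1 / w q - 1 / (w q + 1 / real (Suc n)) \<partial>haar) < \<gamma>) sequentially"
    using assms by (intro order_tendstoD(2)) auto
  then obtain n where n: "V1 * (\<integral>q. 1 / w q - 1 / (w q + 1 / real (Suc n)) \<partial>haar) < \<gamma>"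
    by (meson eventually_happens sequentially_bot)
  show thesis
  proof (rule that[OF _ n])
    show "integrable haar (\<lambda>q. 1 / w q - 1 / (w q + 1 / real (Suc n)))"
    proof (rule Bochner_Integration.integrable_bound[OF winv])
      show "AE q in haar. norm (1 / w q - 1 / (w q + 1 / real (Suc n))) \<le> norm (1 / w q)"
        using w_nonzero_AE by eventually_elim (use bnd[of "1 / real (Suc n)"] w_nonneg in auto)
    qed measurable
  qed simp
qed

text \<open>On the span of finitely many eigenvectors of \<open>B\<close> with eigenvalues above 1 there is a uniform
  gap, which survives replacing the threshold resolvent by \<open>(W + d)\<^sup>-\<^sup>1\<close> for small \<open>d\<close>; unlike the
  threshold resolvent itself, the latter maps into the square-summable functions.\<close>

lemma eigenvectors_B_imp_neg_family_H:
  assumes el: "neg_eigenvectors B' N e l" shows "neg_family H' N"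
proof (cases "N = 0")
  case True
  then show ?thesis by (simp add: neg_family_def)
next
  case False
  interpret B': semibounded_form B' "V1 * (\<integral>q. 1 / w q \<partial>haar)" by (rule B'_form)
  have e: "e i \<in> ell2e" "B' (e i) = cscale (of_real (l i)) (e i)" "l i < 0" if "i < N" for i
    using el that by (auto simp: neg_eigenvectors_def)
  have on: "ip (e i) (e j) = (if i = j then 1 else 0)" if "i < N" "j < N" for i j
    using el that by (auto simp: neg_eigenvectors_def)
  \<comment> \<open>The gap: every eigenvalue of \<open>B\<close> involved is at least
    \<open>1 + \<gamma>\<close>.\<close>
  define \<gamma> where "\<gamma> = Min ((\<lambda>i. - l i) ` {..<N})"
  have \<gamma>: "\<gamma> > 0" unfolding \<gamma>_def using False e(3) by (subst Min_gr_iff) auto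
  have l\<gamma>: "l i \<le> - \<gamma>" if "i < N" for i
  proof -
    have "\<gamma> \<le> - l i" unfolding \<gamma>_def by (rule Min_le) (use that in auto)
    then show ?thesis by linarith
  qed
  obtain d where d: "0 < d" "V1 * (\<integral>q. 1 / w q - 1 / (w q + d) \<partial>haar) < \<gamma>"
    "integrable haar (\<lambda>q. 1 / w q - 1 / (w q + d))"
    by (rule regularization_error[OF \<gamma>])
  have Se: "integrable counting (S (e i))" if "i < N" for i by (rule S_ell1(1)[OF ell2e_sqsum[OF e(1)[OF that]]])
  have Top_ell2e: "Top d (S f) \<in> ell2e" if "f \<in> ell2e" for f
    using that Top_props(1)[OF d(1)] Top_even[OF d(1)] S_ell1(1) S_even by (simp add: ell2e_iff)
  show ?thesis unfolding neg_family_def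
  proof (intro exI[of _ "\<lambda>i. Top d (S (e i))"] conjI allI impI)
    show "Top d (S (e i)) \<in> ell2e" if "i < N" for i by (rule Top_ell2e[OF e(1)[OF that]])
    fix c :: "nat \<Rightarrow> complex" assume c: "\<exists>i<N. c i \<noteq> 0"
    define \<psi> where "\<psi> = (\<Sum>i<N. cscale (c i) (e i))"
    define f where "f = Top d (S \<psi>)"
    have \<psi>: "\<psi> \<in> ell2e" unfolding \<psi>_def by (intro ell2e_sum ell2e_cscale e(1)) simp
    have f: "f \<in> ell2e" unfolding f_def by (rule Top_ell2e[OF \<psi>])
    note \<psi>s = ell2e_sqsum[OF \<psi>] and fs = ell2e_sqsum[OF f]
    have S\<psi>: "integrable counting (S \<psi>)" by (rule S_ell1(1)[OF \<psi>s])
    have fsum: "(\<Sum>i<N. cscale (c i) (Top d (S (e i)))) = f"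
      unfolding f_def \<psi>_def S_sum by (rule Top_sum[OF d(1), symmetric]) (use Se in simp)
    define n where "n = nsq \<psi>"
    have n_sum: "n = (\<Sum>i<N. (cmod (c i))\<^sup>2)"
    proof -
      have "complex_of_real n = (\<Sum>i<N. c i * cnj (c i))"
        unfolding n_def ip_self[symmetric] \<psi>_def by (rule ip_orthonormal_sums[OF e(1) on])
      then have "complex_of_real n = complex_of_real (\<Sum>i<N. (cmod (c i))\<^sup>2)"
        unfolding complex_norm_square[symmetric] of_real_sum .
      then show ?thesis by (simp only: of_real_eq_iff)
    qed
    have n0: "n > 0"
    proof -
      obtain i where "i < N" "c i \<noteq> 0" using c by auto
      then show ?thesis unfolding n_sum by (intro sum_pos2[of _ i]) auto
    qed
    have qB: "qform B' \<psi> \<le> - \<gamma> * n"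
    proof -
      have "B' \<psi> = (\<Sum>i<N. B' (cscale (c i) (e i)))"
        unfolding \<psi>_def by (rule B'.A_sum) (use e(1) in \<open>auto intro: ell2e_cscale\<close>)
      also have "\<dots> = (\<Sum>i<N. cscale (of_real (l i) * c i) (e i))"
      proof (rule sum.cong[OF refl])
        fix i assume "i \<in> {..<N}"
        then show "B' (cscale (c i) (e i)) = cscale (of_real (l i) * c i) (e i)"
          using e by (simp add: B'.scale)
      qed
      finally have "ip (B' \<psi>) \<psi> = (\<Sum>i<N. of_real (l i) * c i * cnj (c i))"
        unfolding \<psi>_def by (simp only: ip_orthonormal_sums[OF e(1) on])
      also have "\<dots> = complex_of_real (\<Sum>i<N. l i * (cmod (c i))\<^sup>2)"
        unfolding of_real_sum of_real_mult complex_norm_square mult.assoc ..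
      finally have "qform B' \<psi> = (\<Sum>i<N. l i * (cmod (c i))\<^sup>2)" by (simp only: qform_def Re_complex_of_real)
      also have "\<dots> \<le> (\<Sum>i<N. - \<gamma> * (cmod (c i))\<^sup>2)"
        using l\<gamma> by (intro sum_mono mult_right_mono) auto
      finally show ?thesis unfolding n_sum sum_distrib_left .
    qed
    then have R: "(1 + \<gamma>) * n \<le> formR (S \<psi>)"
      unfolding qform_B'[OF \<psi>] n_def[symmetric] by (simp add: algebra_simps)
    define \<beta> where "\<beta> = regform d (S \<psi>)"
    \<comment> \<open>Regularising costs less than \<open>\<gamma> * n\<close>, so
      \<open>\<beta>\<close> still exceeds \<open>n\<close>.\<close>
    have "formR (S \<psi>) - \<beta> \<le> n * (V1 * (\<integral>q. 1 / w q - 1 / (w q + d) \<partial>haar))"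
    proof -
      have "formR (S \<psi>) - \<beta> = (\<integral>q. (cmod (dft (S \<psi>) q))\<^sup>2 / w q - (cmod (dft (S \<psi>) q))\<^sup>2 / (w q + d) \<partial>haar)"
        unfolding formR_def \<beta>_def regform_def
        by (rule Bochner_Integration.integral_diff[symmetric, OF formR_integrable[OF S\<psi>] regform_integrable[OF d(1) S\<psi>]])
      also have "\<dots> \<le> (\<integral>q. V1 * n * (1 / w q - 1 / (w q + d)) \<partial>haar)"
      proof (rule integral_mono_AE)
        show "integrable haar (\<lambda>q. (cmod (dft (S \<psi>) q))\<^sup>2 / w q - (cmod (dft (S \<psi>) q))\<^sup>2 / (w q + d))"
          by (rule Bochner_Integration.integrable_diff[OF formR_integrable[OF S\<psi>] regform_integrable[OF d(1) S\<psi>]])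
        show "integrable haar (\<lambda>q. V1 * n * (1 / w q - 1 / (w q + d)))" using d(3) by (rule integrable_mult_right)
        show "AE q in haar. (cmod (dft (S \<psi>) q))\<^sup>2 / w q - (cmod (dft (S \<psi>) q))\<^sup>2 / (w q + d) \<le> V1 * n * (1 / w q - 1 / (w q + d))"
          using w_nonzero_AE
        proof eventually_elim
          case (elim q)
          have wq: "w q > 0" using elim w_nonneg[of q] by simp
          have "(cmod (dft (S \<psi>) q))\<^sup>2 \<le> V1 * n"
            using order_trans[OF dft_sq_le S_ell1_norm[OF \<psi>s]] by (simp add: n_def)
          moreover have "0 \<le> 1 / w q - 1 / (w q + d)" using wq d(1) by (simp add: frac_le)
          ultimately have "(cmod (dft (S \<psi>) q))\<^sup>2 * (1 / w q - 1 / (w q + d)) \<le> V1 * n * (1 / w q - 1 / (w q + d))"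
            by (rule mult_right_mono)
          then show ?case by (simp add: right_diff_distrib)
        qed
      qed
      also have "\<dots> = V1 * n * (\<integral>q. 1 / w q - 1 / (w q + d) \<partial>haar)" by (rule integral_mult_right_zero)
      finally show ?thesis by (simp only: mult_ac)
    qed
    also have "\<dots> < n * \<gamma>" using d(2) n0 by (rule mult_strict_left_mono)
    finally have "n < \<beta>" using R by (simp add: algebra_simps)
    have ipf: "ip f (S \<psi>) = of_real \<beta>" unfolding f_def \<beta>_def by (rule Top_props(3)[OF d(1) S\<psi>])
    have "W f = S \<psi> + cscale (of_real (- d)) f"
      unfolding f_def by (rule ext) (simp add: Top_props(2)[OF d(1) S\<psi>], simp add: cscale_def)
    then have "ip (W f) f = ip (S \<psi>) f + of_real (- d) * ip f f"
      using S_bounded_sqsum[OF \<psi>s] fs by (simp only: ip_add_left sqsum_cscale ip_cscale_left)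
    also have "ip (S \<psi>) f = of_real \<beta>" unfolding ip_cnj[of f "S \<psi>", symmetric] ipf by simp
    finally have P: "Re (ip (W f) f) = \<beta> - d * nsq f" by (simp add: ip_self)
    \<comment> \<open>From here \<open>\<beta>^2 \<le> nsq (S f) * n\<close> with
      \<open>n < \<beta>\<close> gives \<open>nsq (S f) > \<beta>\<close>, while the kinetic form at
      \<open>f\<close> is \<open>\<beta> - d * nsq f\<close>, at most \<open>\<beta>\<close>; so the
      form of \<open>H'\<close> at \<open>f\<close> is negative.\<close>
    have "ip f (S \<psi>) = ip (S f) \<psi>" by (rule ip_S[symmetric])
    then have "(cmod (ip (S f) \<psi>))\<^sup>2 = \<beta>\<^sup>2" using ipf by (metis norm_of_real power2_abs)
    then have "\<beta>\<^sup>2 \<le> nsq (S f) * n"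
      using ip_cauchy_schwarz[OF S_bounded_sqsum[OF fs] \<psi>s] by (simp add: n_def)
    moreover have "\<beta> * n < \<beta> * \<beta>" using n0 \<open>n < \<beta>\<close> by (intro mult_strict_left_mono) auto
    ultimately have "\<beta> * n < nsq (S f) * n" unfolding power2_eq_square by linarith
    then have "\<beta> < nsq (S f)" using n0 by (simp add: mult_less_cancel_right)
    moreover have "0 \<le> d * nsq f" using d(1) by simp
    ultimately show "qform H' (\<Sum>i<N. cscale (c i) (Top d (S (e i)))) < 0"
      unfolding fsum qform_H'[OF f] P by linarith
  qed
qed

text \<open>The way back from \<open>B'\<close> first replaces the negative family by orthonormal
  eigenvectors, since these make the gap explicit.\<close>

theorem eigenvalue_counts_eq: "eigenvalue_count H' {..<0} = eigenvalue_count B' {..<0}"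
proof -
  interpret H': semibounded_form H' V1 by (rule H'_form)
  interpret B': semibounded_form B' "V1 * (\<integral>q. 1 / w q \<partial>haar)" by (rule B'_form)
  have "neg_family H' N \<longleftrightarrow> neg_family B' N" for N
    using neg_family_H_imp_B B'.neg_family_imp_eigenvectors eigenvectors_B_imp_neg_family_H by metis
  then show ?thesis by (intro enat_eqI) (simp add: H'.count_iff_neg_family B'.count_iff_neg_family)
qed

end

section \<open>Identification with the concrete operators and the five assertions\<close>

lemma eigenvalue_count_cong:
  assumes "\<And>f. f \<in> ell2e \<Longrightarrow> A f = A' f"
  shows "eigenvalue_count A X = eigenvalue_count A' X"
proof -
  have "eigenspace A z = eigenspace A' z" for z using assms by (auto simp: eigenspace_def)
  then show ?thesis by (simp add: eigenvalue_count_def)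
qed

lemma cos_cis_double: "cis t + cis (- t) = of_real (2 * cos t)"
  by (simp add: complex_eq_iff)

text \<open>Evenness of the coefficients allows either sign in the expansion of
  \<open>\<epsilon>\<close>. Opposite signs at the two arguments leave the common factor
  \<open>cis (- pairing p x)\<close>, and the two half-momentum phases add up to a cosine.\<close>

lemma Ek_dft:
  fixes \<epsilon> :: "real ^ 'n::finite \<Rightarrow> real" and eh :: "int ^ 'n \<Rightarrow> real"
  assumes eh: "integrable counting eh" and ev: "even_fun eh"
    and \<epsilon>: "\<And>p. complex_of_real (\<epsilon> p) = (\<Sum>\<^sub>\<infinity>x. cis (pairing p x) * complex_of_real (eh x))"
  shows "of_real (Ek \<epsilon> k p) = dft (\<lambda>x. of_real (eh x * (2 * cos (pairing (k /\<^sub>R 2) x)))) p"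
proof -
  define c where "c x = complex_of_real (eh x)" for x
  have c: "integrable counting c" unfolding c_def[abs_def] using eh by (rule integrable_of_real)
  define h where "h = k /\<^sub>R 2"
  have int: "integrable counting (\<lambda>x. cis (g x) * c x)" for g :: "int ^ 'n \<Rightarrow> real"
    by (rule integrable_counting_bound[OF c]) (simp add: norm_mult)
  have 1: "complex_of_real (\<epsilon> q) = (\<integral>x. cis (pairing q x) * c x \<partial>counting)" for q
    unfolding \<epsilon> infsum_eq_integral_counting c_def ..
  have 2: "complex_of_real (\<epsilon> q) = (\<integral>x. cis (- pairing q x) * c x \<partial>counting)" for q
  proof -
    have "(\<integral>x. cis (pairing q x) * c x \<partial>counting) = (\<integral>x. cis (pairing q (- x)) * c (- x) \<partial>counting)"
      by (rule integral_counting_reflect[symmetric])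
    then show ?thesis using ev by (simp add: 1 c_def even_fun_uminus)
  qed
  have "complex_of_real (Ek \<epsilon> k p) = (\<integral>x. cis (- pairing (h + p) x) * c x \<partial>counting) + (\<integral>x. cis (pairing (h - p) x) * c x \<partial>counting)"
    unfolding Ek_def h_def[symmetric] of_real_add 2[of "h + p"] 1[of "h - p"] ..
  also have "\<dots> = (\<integral>x. cis (- pairing (h + p) x) * c x + cis (pairing (h - p) x) * c x \<partial>counting)"
    by (rule Bochner_Integration.integral_add[symmetric, OF int int])
  also have "\<dots> = dft (\<lambda>x. of_real (eh x * (2 * cos (pairing h x)))) p"
    unfolding dft_def
  proof (rule Bochner_Integration.integral_cong[OF refl])
    fix x
    have "cis (- pairing (h + p) x) = cis (- pairing h x) * cis (- pairing p x)"
      "cis (pairing (h - p) x) = cis (pairing h x) * cis (- pairing p x)" by (simp_all add: cis_mult)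
    then have "cis (- pairing (h + p) x) * c x + cis (pairing (h - p) x) * c x
        = (cis (pairing h x) + cis (- pairing h x)) * cis (- pairing p x) * c x" by (simp only:) (simp add: algebra_simps)
    also have "\<dots> = of_real (eh x * (2 * cos (pairing h x))) * cis (- pairing p x)"
      unfolding cos_cis_double c_def by simp
    finally show "cis (- pairing (h + p) x) * c x + cis (pairing (h - p) x) * c x
        = of_real (eh x * (2 * cos (pairing h x))) * cis (- pairing p x)" .
  qed
  finally show ?thesis by (simp add: h_def)
qed

lemma ell0_bounded: assumes "f \<in> ell0" obtains C where "\<And>x. cmod (f x) \<le> C"
  using null_sequence_bounded[of f] assms by (auto simp: ell0_def)

theorem theorem3p12:
  fixes \<epsilon> :: "real ^ 'n \<Rightarrow> real" and \<epsilon>_hat v :: "int ^ 'n \<Rightarrow> real"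
    and \<mu> :: real and k :: "real ^ 'n"
  assumes "\<epsilon>_hat \<in> ell1" and "even_fun \<epsilon>_hat"
    and "\<And>p. complex_of_real (\<epsilon> p) = (\<Sum>\<^sub>\<infinity>x. cis (pairing p x) * complex_of_real (\<epsilon>_hat x))"
    and "Cm 3 \<epsilon>" and "even_fun \<epsilon>" and "morse \<epsilon>"
    and "\<And>p. p \<in> torus \<Longrightarrow> p \<noteq> 0 \<Longrightarrow> \<epsilon> 0 < \<epsilon> p"
    and "v \<in> ell1" and "even_fun v" and "\<And>x. v x \<le> 0"
    and "\<mu> > 0" and "k \<in> GG \<epsilon>"
  shows
    "(CARD('n) \<ge> 3 \<longrightarrow>
       (\<forall>f. f \<in> ell0 \<and> even_fun f \<and> H \<epsilon> v \<mu> k f = cscale (complex_of_real (Emin \<epsilon> k)) f \<longrightarrow>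
          sqrt_absV v f \<in> ell2e \<and>
          sqrt_absV v f = BS \<epsilon> v \<mu> k (Emin \<epsilon> k) (sqrt_absV v f)))
   \<and> (CARD('n) = 3 \<or> CARD('n) = 4 \<longrightarrow>
       (\<forall>\<psi>. \<psi> \<in> ell2e \<and> \<psi> = BS \<epsilon> v \<mu> k (Emin \<epsilon> k) \<psi> \<longrightarrow>
          (let f = R0 \<epsilon> k (Emin \<epsilon> k) (sqrt_absV v \<psi>)
           in f \<in> ell0 \<and> H \<epsilon> v \<mu> k f = cscale (complex_of_real (Emin \<epsilon> k)) f)))
   \<and> (CARD('n) \<ge> 5 \<longrightarrow>
       (\<forall>\<psi>. \<psi> \<in> ell2e \<and> \<psi> = BS \<epsilon> v \<mu> k (Emin \<epsilon> k) \<psi> \<longrightarrow>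
          (let f = R0 \<epsilon> k (Emin \<epsilon> k) (sqrt_absV v \<psi>)
           in f \<in> ell2e \<and> H \<epsilon> v \<mu> k f = cscale (complex_of_real (Emin \<epsilon> k)) f)))
   \<and> (CARD('n) \<ge> 3 \<longrightarrow>
       (\<forall>m. singular_point \<epsilon> v \<mu> k m \<and>
              (threshold_resonance \<epsilon> v \<mu> k \<or> threshold_eigenvalue \<epsilon> v \<mu> k)
            \<longleftrightarrow> eigenvalue_of_multiplicity (BS \<epsilon> v \<mu> k (Emin \<epsilon> k)) 1 m))
   \<and> (CARD('n) \<ge> 3 \<longrightarrow>
       N_minus (Emin \<epsilon> k) (H \<epsilon> v \<mu> k) = N_plus 1 (BS \<epsilon> v \<mu> k (Emin \<epsilon> k)))"
proof (cases "CARD('n) \<ge> 3")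
  \<comment> \<open>All five assertions carry a hypothesis on the dimension that fails here.\<close>
  case False
  then show ?thesis by auto
next
  case d3: True
  define E where "E = Ek \<epsilon> k"
  define e where "e = Emin \<epsilon> k"
  define a where "a x = \<epsilon>_hat x * (2 * cos (pairing (k /\<^sub>R 2) x))" for x
  \<comment> \<open>Subtracting \<open>e\<close> from the coefficient at 0 shifts the symbol by the
    constant \<open>e\<close>.\<close>
  define b where "b x = a x - (if x = 0 then e else 0)" for x
  define w where "w p = E p - e" for p
  have eh: "integrable counting \<epsilon>_hat" using assms(1) by (simp add: ell1_def integrable_counting_iff)
  have v: "integrable counting v" using assms(8) by (simp add: ell1_def integrable_counting_iff)
  have v_even: "v (- x) = v x" for x using assms(9) by (rule even_fun_uminus)
  have a: "integrable counting a"
  proof (rule integrable_counting_bound)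
    show "integrable counting (\<lambda>x. 2 * \<epsilon>_hat x)" using eh by simp
    show "norm (a x) \<le> norm (2 * \<epsilon>_hat x)" for x
      using mult_left_mono[OF abs_cos_le_one[of "pairing (k /\<^sub>R 2) x"], of "2 * \<bar>\<epsilon>_hat x\<bar>"]
      by (simp add: a_def abs_mult mult_ac)
  qed
  have a_even: "a (- x) = a x" for x using assms(2) by (simp add: a_def even_fun_uminus)
  have ac: "integrable counting (\<lambda>x. complex_of_real (a x))" using a by (rule integrable_of_real)
  have E_dft: "complex_of_real (E p) = dft (\<lambda>x. of_real (a x)) p" for p
    unfolding E_def a_def by (rule Ek_dft[OF eh assms(2,3)])
  note delta = integral_counting_finite_support[of "{0 :: int ^ 'n}"]
  have b: "integrable counting b"
    unfolding b_def[abs_def] by (rule Bochner_Integration.integrable_diff[OF a delta(1)]) auto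
  have b_even: "b (- x) = b x" for x by (simp add: b_def a_even)
  have w_dft: "complex_of_real (w p) = dft (\<lambda>x. of_real (b x)) p" for p
  proof -
    have "(\<lambda>x. complex_of_real (b x)) = (\<lambda>x. of_real (a x) - (if x = 0 then of_real e else 0))"
      by (auto simp: b_def)
    moreover have "dft (\<lambda>x. of_real (a x) - (if x = 0 then of_real e else 0)) p
        = dft (\<lambda>x. of_real (a x)) p - dft (\<lambda>x. if x = 0 then of_real e else 0) p"
      by (rule dft_diff[OF ac delta(1)]) auto
    moreover have "dft (\<lambda>x :: int ^ 'n. if x = 0 then of_real e else 0) p = of_real e"
      unfolding dft_def by (subst delta(2)) auto
    ultimately show ?thesis by (simp add: w_def E_dft)
  qed
  have E_abs: "\<bar>E p\<bar> \<le> (\<integral>x. \<bar>a x\<bar> \<partial>counting)" for p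
    using norm_dft_le[of "\<lambda>x. of_real (a x)" p] by (simp add: E_dft[symmetric])
  have "- (\<integral>x. \<bar>a x\<bar> \<partial>counting) \<le> E p" for p using E_abs[of p] by linarith
  then have bdd: "bdd_below (range E)" by (intro bdd_belowI) auto
  have e_le: "e \<le> E p" for p
    unfolding e_def Emin_def E_def[symmetric] by (rule cINF_lower[OF bdd UNIV_I])
  have "Cm 3 E" "morse E" using assms(12) by (auto simp: GG_def E_def)
  then have C: "Cm (Suc (Suc (Suc 0))) E" and morse: "morse E" by (simp_all add: numeral_3_eq_3)
  have zeros: "finite {z. (\<forall>j. \<bar>z $ j\<bar> \<le> 2 * pi) \<and> w z = 0}"
  proof -
    have "finite {z \<in> cbox (- vec (2 * pi)) (vec (2 * pi)). E z = e}"
      by (rule finite_minimizers[OF C morse e_le compact_cbox])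
    moreover have "{z. (\<forall>j. \<bar>z $ j\<bar> \<le> 2 * pi) \<and> w z = 0} = {z \<in> cbox (- vec (2 * pi)) (vec (2 * pi)). E z = e}"
      by (auto simp: mem_box_cart w_def abs_le_iff minus_le_iff)
    ultimately show ?thesis by simp
  qed
  have winv: "integrable haar (\<lambda>p. 1 / w p)"
    using integrable_inverse_power_morse[OF C morse e_le, of 1] d3 by (simp add: w_def)
  interpret threshold b w v \<mu>
    by unfold_locales (fact b b_even w_dft zeros winv v v_even assms(10,11) | simp add: w_def e_le)+
  have Ek_hat: "Ek_hat \<epsilon> k x = of_real (a x)" for x
  proof -
    have "Ek_hat \<epsilon> k x = ft (dft (\<lambda>x. of_real (a x))) (- x)"
      by (simp add: Ek_hat_def ft_def E_dft[symmetric] E_def)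
    then show ?thesis by (simp add: ft_dft[OF ac] a_even)
  qed
  \<comment> \<open>Stated for bounded functions, so that it serves null sequences and
    square-summable functions alike.\<close>
  have H: "H \<epsilon> v \<mu> k f = cscale (of_real e) f + H' f" if f: "\<And>x. cmod (f x) \<le> C" for f C
  proof
    fix x
    have i1: "integrable counting (\<lambda>s. of_real (a (x - s)) * f s)"
      by (rule ell1_mult_bounded[OF _ f]) (rule iffD2[OF integral_counting_bij(2)[OF bij_minus_const] ac])
    have i2: "integrable counting (\<lambda>s. if s = x then of_real e * f x else 0)"
      and s2: "(\<integral>s. (if s = x then of_real e * f x else 0) \<partial>counting) = of_real e * f x"
      using integral_counting_finite_support[of "{x}" "\<lambda>s. if s = x then of_real e * f x else 0"] by auto
    have "W f x = (\<integral>s. of_real (a (x - s)) * f s - (if s = x then of_real e * f x else 0) \<partial>counting)"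
      unfolding W_def bc_def by (rule Bochner_Integration.integral_cong[OF refl]) (auto simp: b_def algebra_simps)
    also have "\<dots> = H0 \<epsilon> k f x - of_real e * f x"
      by (simp add: H0_def infsum_eq_integral_counting Ek_hat Bochner_Integration.integral_diff[OF i1 i2] s2)
    finally show "H \<epsilon> v \<mu> k f x = (cscale (of_real e) f + H' f) x"
      by (simp add: H_def H'_def Vop_def cscale_def)
  qed
  have R: "R0_kernel \<epsilon> k e x = ft res x" for x
    by (simp add: R0_kernel_def ft_def res_def w_def E_def)
  have R0: "R0 \<epsilon> k e g = Rop g" for g
    by (rule ext) (simp add: R0_def Rop_def infsum_eq_integral_counting R)
  have BS: "BS \<epsilon> v \<mu> k e \<psi> = B \<psi>" for \<psi>
  proof
    fix x
    have rv2: "rv x * rv y = \<mu> * sqrt \<bar>v x\<bar> * sqrt \<bar>v y\<bar>" for x y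
      using assms(11) by (simp add: rv_def real_sqrt_mult mult_ac)
    have "B \<psi> x = (\<integral>y. of_real (rv x) * (ft res (x - y) * (of_real (rv y) * \<psi> y)) \<partial>counting)"
      by (simp add: B_def S_def Rop_def)
    also have "\<dots> = (\<integral>y. of_real \<mu> * of_real (sqrt \<bar>v x\<bar>) * ft res (x - y) * of_real (sqrt \<bar>v y\<bar>) * \<psi> y \<partial>counting)"
    proof (rule Bochner_Integration.integral_cong[OF refl])
      fix y
      have "of_real (rv x) * (ft res (x - y) * (of_real (rv y) * \<psi> y)) = of_real (rv x * rv y) * ft res (x - y) * \<psi> y"
        by (simp add: mult_ac)
      then show "of_real (rv x) * (ft res (x - y) * (of_real (rv y) * \<psi> y))
          = of_real \<mu> * of_real (sqrt \<bar>v x\<bar>) * ft res (x - y) * of_real (sqrt \<bar>v y\<bar>) * \<psi> y"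
        unfolding rv2 by (simp add: mult_ac)
    qed
    finally show "BS \<epsilon> v \<mu> k e \<psi> x = B \<psi> x" by (simp add: BS_def infsum_eq_integral_counting R)
  qed
  \<comment> \<open>\<open>S\<close> contains the coupling \<open>\<mu>\<close>, the operator
    \<open>sqrt_absV\<close> does not; they differ by this factor.\<close>
  define s where "s = complex_of_real (sqrt \<mu>)"
  have s0: "s \<noteq> 0" using assms(11) by (simp add: s_def)
  have S_sqrt: "S f = cscale s (sqrt_absV v f)" for f
    using assms(11) by (simp add: fun_eq_iff S_def rv_def s_def sqrt_absV_def cscale_def real_sqrt_mult)
  have sqrt_S: "sqrt_absV v f = cscale (1 / s) (S f)" for f
    using s0 by (simp add: fun_eq_iff S_sqrt cscale_def)
  have B_cscale: "B (cscale c f) = cscale c (B f)" for c f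
    by (simp only: B_def S_cscale Rop_cscale)
  have SS: "S (S f) x = - (of_real (\<mu> * v x) * f x)" for f x
  proof -
    have "S (S f) x = of_real ((rv x)\<^sup>2) * f x" by (simp add: S_def power2_eq_square)
    then show ?thesis unfolding rv(3) by simp
  qed
  have part1: "sqrt_absV v f \<in> ell2e \<and> sqrt_absV v f = BS \<epsilon> v \<mu> k e (sqrt_absV v f)"
    if f: "f \<in> ell0" "even_fun f" and Hf: "H \<epsilon> v \<mu> k f = cscale (of_real e) f" for f
  proof -
    obtain C where C: "\<And>x. cmod (f x) \<le> C" using ell0_bounded[OF f(1)] by blast
    have Sf: "sqsum (S f)" by (rule S_sqsum[OF C])
    have "S f \<in> ell2e" using Sf S_even[OF f(2)] by (simp add: ell2e_iff)
    then have 1: "sqrt_absV v f \<in> ell2e" unfolding sqrt_S by (rule ell2e_cscale)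
    have "W f x = S (S f) x" for x
    proof -
      have "H' f x = 0" using fun_cong[OF Hf, of x] unfolding H[OF C] by simp
      then show ?thesis by (simp add: H'_def SS eq_neg_iff_add_eq_0)
    qed
    then have "f = Rop (S (S f))" using f(1) S_ell1(1)[OF Sf] by (intro Rop_unique) (auto simp: ell0_def)
    then have "S f = B (S f)" by (simp add: B_def)
    then have "sqrt_absV v f = B (sqrt_absV v f)" unfolding sqrt_S B_cscale by simp
    with 1 show ?thesis by (simp add: BS)
  qed
  have part2: "R0 \<epsilon> k e (sqrt_absV v \<psi>) \<in> ell0 \<and> even_fun (R0 \<epsilon> k e (sqrt_absV v \<psi>)) \<and>
      integrable counting (sqrt_absV v \<psi>) \<and>
      H \<epsilon> v \<mu> k (R0 \<epsilon> k e (sqrt_absV v \<psi>)) = cscale (of_real e) (R0 \<epsilon> k e (sqrt_absV v \<psi>))"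
    if \<psi>: "\<psi> \<in> ell2e" "\<psi> = BS \<epsilon> v \<mu> k e \<psi>" for \<psi>
  proof -
    define q where "q = sqrt_absV v \<psi>"
    define f where "f = Rop q"
    have "integrable counting (cscale (1 / s) (S \<psi>))"
      unfolding cscale_def by (rule integrable_mult_right[OF S_ell1(1)[OF ell2e_sqsum[OF \<psi>(1)]]])
    then have q: "integrable counting q" by (simp add: q_def sqrt_S)
    have "even_fun (S \<psi>)" using \<psi>(1) by (intro S_even) (simp add: ell2e_iff)
    then have qe: "even_fun q" by (simp add: q_def sqrt_S even_fun_def cscale_def)
    have f0: "f \<in> ell0" using Rop_null[OF q] by (simp add: ell0_def f_def)
    obtain C where C: "\<And>x. cmod (f x) \<le> C" using ell0_bounded[OF f0] by blast
    have "\<psi> = S (cscale s f)"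
      using \<psi>(2) unfolding BS B_def S_sqrt[of \<psi>] q_def[symmetric] Rop_cscale f_def[symmetric] .
    then have "q = cscale (1 / s) (S (S (cscale s f)))" by (simp add: q_def sqrt_S)
    \<comment> \<open>The fixed-point equation thus says that the source \<open>q\<close> of
      \<open>f\<close> is \<open>- \<mu> v f\<close>, so \<open>W f = q\<close> is the threshold
      equation.\<close>
    then have qf: "q = S (S f)" using s0 by (simp add: S_cscale)
    have "H' f x = 0" for x
    proof -
      have "W f x = q x" unfolding f_def by (rule W_Rop[OF q])
      then show ?thesis using fun_cong[OF qf, of x] by (simp add: H'_def SS)
    qed
    then have "H \<epsilon> v \<mu> k f = cscale (of_real e) f" unfolding H[OF C] by (auto simp: fun_eq_iff)
    then show ?thesis using f0 Rop_even[OF q qe] q by (simp add: R0 f_def q_def)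
  qed
  have part3: "R0 \<epsilon> k e (sqrt_absV v \<psi>) \<in> ell2e"
    if \<psi>: "\<psi> \<in> ell2e" "\<psi> = BS \<epsilon> v \<mu> k e \<psi>" and d5: "CARD('n) \<ge> 5" for \<psi>
  proof -
    define q where "q = sqrt_absV v \<psi>"
    have q: "integrable counting q" and ev: "even_fun (Rop q)" using part2[OF \<psi>] by (auto simp: q_def R0)
    have qm [measurable]: "dft q \<in> borel_measurable borel" by (rule measurable_dft[OF q])
    let ?C = "(\<integral>y. cmod (q y) \<partial>counting)\<^sup>2"
    have "integrable haar (\<lambda>p. ?C * (1 / w p)\<^sup>2)"
      using integrable_inverse_power_morse[OF C morse e_le, of 2] d5 unfolding w_def by (intro integrable_mult_right) simp
    then have "integrable haar (\<lambda>p. (cmod (res p * dft q p))\<^sup>2)"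
    proof (rule Bochner_Integration.integrable_bound)
      show "AE p in haar. norm ((cmod (res p * dft q p))\<^sup>2) \<le> norm (?C * (1 / w p)\<^sup>2)"
      proof (rule AE_I2)
        fix p
        have "(cmod (res p * dft q p))\<^sup>2 = (1 / w p)\<^sup>2 * (cmod (dft q p))\<^sup>2"
          unfolding res_def norm_mult norm_of_real power_mult_distrib power2_abs ..
        also have "\<dots> \<le> (1 / w p)\<^sup>2 * ?C" by (intro mult_left_mono dft_sq_le) simp
        finally show "norm ((cmod (res p * dft q p))\<^sup>2) \<le> norm (?C * (1 / w p)\<^sup>2)" by (simp add: mult.commute)
      qed
    qed measurable
    then have "sqsum (ft (\<lambda>p. res p * dft q p))"
      unfolding sqsum_def by (intro integrable_ft_square) measurable
    moreover have "Rop q = ft (\<lambda>p. res p * dft q p)" using Rop_ft[OF q] by auto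
    ultimately show ?thesis using ev by (simp add: ell2e_iff R0 q_def)
  qed
  \<comment> \<open>A singular point already has multiplicity \<open>m\<close> by definition; what
    remains is to classify one eigenfunction. If its \<open>f\<close> is not square-summable,
    \<open>part3\<close> excludes dimension 5 and above.\<close>
  have part4: "threshold_resonance \<epsilon> v \<mu> k \<or> threshold_eigenvalue \<epsilon> v \<mu> k" if sing: "singular_point \<epsilon> v \<mu> k m" for m
  proof -
    have m: "m \<ge> 1" "cdimension (eigenspace B 1) = enat m"
      using sing by (simp_all add: singular_point_def eigenvalue_of_multiplicity_def e_def[symmetric] BS[abs_def])
    have "enat 0 < cdimension (eigenspace B 1)" using m by simp
    then obtain X where X: "X \<subseteq> eigenspace B 1" "cfun.independent X" "0 < card X"
      unfolding cdimension_def less_SUP_iff by auto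
    then obtain \<psi> where \<psi>X: "\<psi> \<in> X" by (metis card.empty ex_in_conv less_irrefl)
    then have \<psi>: "\<psi> \<in> ell2e" "\<psi> = BS \<epsilon> v \<mu> k e \<psi>" "\<psi> \<noteq> 0"
      using X cfun.dependent_zero by (auto simp: eigenspace_def BS)
    have r: "R0 \<epsilon> k e (sqrt_absV v \<psi>) \<in> ell0" using part2[OF \<psi>(1,2)] by simp
    show ?thesis
    proof (cases "R0 \<epsilon> k e (sqrt_absV v \<psi>) \<in> ell2e")
      case True
      then have "threshold_eigenvalue \<epsilon> v \<mu> k"
        unfolding threshold_eigenvalue_def e_def[symmetric] using sing \<psi> by blast
      then show ?thesis ..
    next
      case False
      then have "\<not> CARD('n) \<ge> 5" using part3[OF \<psi>(1,2)] by blast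
      then have "CARD('n) \<in> {3, 4}" using d3 by auto
      then have "threshold_resonance \<epsilon> v \<mu> k"
        unfolding threshold_resonance_def e_def[symmetric] using sing \<psi> False r by blast
      then show ?thesis ..
    qed
  qed
  have part5: "N_minus e (H \<epsilon> v \<mu> k) = N_plus 1 (BS \<epsilon> v \<mu> k e)"
  proof -
    have "N_minus e (H \<epsilon> v \<mu> k) = eigenvalue_count (\<lambda>f. cscale (of_real e) f + cscale (of_real 1) (H' f)) ((\<lambda>z. e + 1 * z) ` {..<0})"
    proof -
      have "z \<in> (\<lambda>z. e + 1 * z) ` {..<0}" if "z < e" for z
        by (rule image_eqI[of _ _ "z - e"]) (use that in auto)
      then have set_eq: "{..<e} = (\<lambda>z. e + 1 * z) ` {..<0}" by auto
      have "H \<epsilon> v \<mu> k f = cscale (of_real e) f + cscale (of_real 1) (H' f)" if "f \<in> ell2e" for f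
        using H[OF sqsum_cmod_le[OF ell2e_sqsum[OF that]]] by simp
      then show ?thesis unfolding N_minus_def set_eq by (rule eigenvalue_count_cong)
    qed
    also have "\<dots> = eigenvalue_count H' {..<0}" by (rule eigenvalue_count_affine) simp
    also have "\<dots> = eigenvalue_count B' {..<0}" by (rule eigenvalue_counts_eq)
    \<comment> \<open>The reflection \<open>z\<close> to \<open>1 - z\<close> exchanges the negative
      half-line with the values above 1.\<close>
    also have "\<dots> = eigenvalue_count (\<lambda>f. cscale (of_real 1) f + cscale (of_real (- 1)) (B' f)) ((\<lambda>z. 1 + - 1 * z) ` {..<0})"
      by (rule eigenvalue_count_affine[symmetric]) simp
    also have "\<dots> = N_plus 1 (BS \<epsilon> v \<mu> k e)"
    proof -
      have "z \<in> (\<lambda>z. 1 + - 1 * z) ` {..<0}" if "1 < z" for z :: real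
        by (rule image_eqI[of _ _ "1 - z"]) (use that in auto)
      then have set_eq: "{1<..} = (\<lambda>z. 1 + - 1 * z :: real) ` {..<0}" by auto
      have "BS \<epsilon> v \<mu> k e f = cscale (of_real 1) f + cscale (of_real (- 1)) (B' f)" for f
        by (simp add: BS fun_eq_iff cscale_def B'_def)
      then show ?thesis unfolding N_plus_def set_eq by (intro eigenvalue_count_cong) simp
    qed
    finally show ?thesis .
  qed
  show ?thesis
    unfolding e_def[symmetric] Let_def
    using part1 part2 part3 part4 part5 by (auto simp: singular_point_def e_def[symmetric])
qed

end
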